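(* Let $(M^n,g,\xi,\lambda,\rho)$ be a compact almost Ricci-Bourguignon soliton with scalar curvature $S$ and Ricci operator $Q$. Then $$\int_M\left((\lambda+\rho S)S-\|Q\|^2-\frac12 S\bigl(n(\lambda+\rho S)-S\bigr)\right)=0.$$
   Context: Manifolds are smooth and without boundary. An almost Ricci-Bourguignon (almost RB) soliton $(M^n,g,\xi,\lambda,\rho)$ is an $n$-dimensional Riemannian manifold $(M^n,g)$ with a smooth vector field $\xi$ (the potential field), a smooth function $\lambda$ on $M$ (the soliton function) and a real constant $\rho$ such that $\operatorname{Ric}+\frac12\mathcal{L}_\xi g=(\lambda+\rho S)g$, where $\operatorname{Ric}$ is the Ricci tensor, $S$ the scalar curvature and $\mathcal{L}_\xi$ the Lie derivative. The Ricci operator $Q$ is defined by $\operatorname{Ric}(X,Y)=g(QX,Y)$, and $\|Q\|^2=\sum_{i=1}^n g(Qe_i,Qe_i)$ for a local orthonormal frame $\{e_i\}$. Integrals are with respect to the Riemannian volume. *)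

theory Defs
  imports "HOL-Analysis.Analysis"
begin

section \<open>Smooth manifolds\<close>

(* Class C^k on an open set S; all directional derivatives are again of class C^(k-1). *)
primrec Ck_on :: "nat \<Rightarrow> (real^'n) set \<Rightarrow> (real^'n \<Rightarrow> 'b::real_normed_vector) \<Rightarrow> bool" where
  "Ck_on 0 S f \<longleftrightarrow> continuous_on S f"
| "Ck_on (Suc k) S f \<longleftrightarrow>
     f differentiable_on S \<and> (\<forall>v. Ck_on k S (\<lambda>x. frechet_derivative f (at x) v))"

definition smooth_on :: "(real^'n) set \<Rightarrow> (real^'n \<Rightarrow> 'b::real_normed_vector) \<Rightarrow> bool" where
  "smooth_on S f \<longleftrightarrow> (\<forall>k. Ck_on k S f)"

(* A chart is a domain together with its coordinate map; the values of the map outside the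
   domain are irrelevant.  The dimension of the manifold is CARD('n). *)
type_synonym ('a, 'n) chart = "'a set \<times> ('a \<Rightarrow> real^'n)"

record ('a, 'n::finite) charted_space =
  mtop :: "'a topology"
  atlas :: "('a, 'n) chart set"

abbreviation points :: "('a, 'n::finite) charted_space \<Rightarrow> 'a set" where
  "points M \<equiv> topspace (mtop M)"

(* The atlas is not required to be maximal: it determines the smooth structure. *)
definition smooth_manifold :: "('a, 'n::finite) charted_space \<Rightarrow> bool" where
  "smooth_manifold M \<longleftrightarrow>
     Hausdorff_space (mtop M) \<and> second_countable (mtop M) \<and>
     (\<forall>(U, \<phi>) \<in> atlas M. openin (mtop M) U \<and> open (\<phi> ` U) \<and>
        homeomorphic_map (subtopology (mtop M) U) (top_of_set (\<phi> ` U)) \<phi>) \<and>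
     (\<Union>(U, \<phi>) \<in> atlas M. U) = points M \<and>
     (\<forall>(U, \<phi>) \<in> atlas M. \<forall>(V, \<psi>) \<in> atlas M.
        smooth_on (\<phi> ` (U \<inter> V)) (\<psi> \<circ> inv_into U \<phi>))"

(* Smooth real functions on an open subset W of M. *)
definition smooth_fun :: "('a, 'n::finite) charted_space \<Rightarrow> 'a set \<Rightarrow> ('a \<Rightarrow> real) \<Rightarrow> bool" where
  "smooth_fun M W f \<longleftrightarrow> (\<forall>(U, \<phi>) \<in> atlas M. smooth_on (\<phi> ` (U \<inter> W)) (f \<circ> inv_into U \<phi>))"

definition smooth_near :: "('a, 'n::finite) charted_space \<Rightarrow> 'a \<Rightarrow> ('a \<Rightarrow> real) \<Rightarrow> bool" where
  "smooth_near M p f \<longleftrightarrow> (\<exists>W. openin (mtop M) W \<and> p \<in> W \<and> smooth_fun M W f)"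

section \<open>Tangent vectors and vector fields\<close>

(* A tangent vector at p is a directional derivative acting on the functions that are smooth
   near p.  By convention it is 0 on all other functions, so that equality of tangent vectors
   is equality of functionals. *)
type_synonym 'a tvec = "('a \<Rightarrow> real) \<Rightarrow> real"
type_synonym 'a vfield = "'a \<Rightarrow> 'a tvec"

definition chart_vec ::
    "('a, 'n::finite) charted_space \<Rightarrow> ('a, 'n) chart \<Rightarrow> 'a \<Rightarrow> real^'n \<Rightarrow> 'a tvec" where
  "chart_vec M c p u = (\<lambda>f.
     if smooth_near M p f
     then frechet_derivative (f \<circ> inv_into (fst c) (snd c)) (at (snd c p)) u else 0)"

definition tangent_space :: "('a, 'n::finite) charted_space \<Rightarrow> 'a \<Rightarrow> 'a tvec set" where
  "tangent_space M p = {chart_vec M c p u | c u. c \<in> atlas M \<and> p \<in> fst c}"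

definition smooth_vfield :: "('a, 'n::finite) charted_space \<Rightarrow> 'a set \<Rightarrow> 'a vfield \<Rightarrow> bool" where
  "smooth_vfield M W X \<longleftrightarrow>
     (\<forall>p\<in>W. X p \<in> tangent_space M p) \<and>
     (\<forall>V f. openin (mtop M) V \<and> V \<subseteq> W \<and> smooth_fun M V f \<longrightarrow> smooth_fun M V (\<lambda>p. X p f))"

definition smooth_vfield_near :: "('a, 'n::finite) charted_space \<Rightarrow> 'a \<Rightarrow> 'a vfield \<Rightarrow> bool" where
  "smooth_vfield_near M p X \<longleftrightarrow> (\<exists>W. openin (mtop M) W \<and> p \<in> W \<and> smooth_vfield M W X)"

(* Some smooth local vector field through the tangent vector v at p.  It is used only to evaluate
   tensorial expressions, whose value at p does not depend on the choice. *)
definition extension :: "('a, 'n::finite) charted_space \<Rightarrow> 'a \<Rightarrow> 'a tvec \<Rightarrow> 'a vfield" where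
  "extension M p v = (SOME X. smooth_vfield_near M p X \<and> X p = v)"

(* The guard keeps the convention that tangent vectors vanish on functions not smooth near p. *)
definition lie_bracket ::
    "('a, 'n::finite) charted_space \<Rightarrow> 'a vfield \<Rightarrow> 'a vfield \<Rightarrow> 'a vfield" where
  "lie_bracket M X Y = (\<lambda>p f.
     if smooth_near M p f then X p (\<lambda>q. Y q f) - Y p (\<lambda>q. X q f) else 0)"

section \<open>Riemannian metrics and curvature\<close>

type_synonym 'a metric_tensor = "'a \<Rightarrow> 'a tvec \<Rightarrow> 'a tvec \<Rightarrow> real"

definition riemannian_metric ::
    "('a, 'n::finite) charted_space \<Rightarrow> 'a metric_tensor \<Rightarrow> bool" where
  "riemannian_metric M g \<longleftrightarrow>
     (\<forall>p\<in>points M.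
        (\<forall>u\<in>tangent_space M p. \<forall>v\<in>tangent_space M p. g p u v = g p v u) \<and>
        (\<forall>u\<in>tangent_space M p. \<forall>v\<in>tangent_space M p. \<forall>w\<in>tangent_space M p. \<forall>a b.
           g p (\<lambda>f. a * u f + b * v f) w = a * g p u w + b * g p v w) \<and>
        (\<forall>v\<in>tangent_space M p. v \<noteq> (\<lambda>f. 0) \<longrightarrow> g p v v > 0)) \<and>
     (\<forall>W X Y. openin (mtop M) W \<and> smooth_vfield M W X \<and> smooth_vfield M W Y \<longrightarrow>
        smooth_fun M W (\<lambda>p. g p (X p) (Y p)))"

(* The Levi-Civita covariant derivative of Y along X, determined by the Koszul formula. *)
definition koszul ::
    "('a, 'n::finite) charted_space \<Rightarrow> 'a metric_tensor \<Rightarrow> 'a vfield \<Rightarrow> 'a vfield \<Rightarrow> 'a vfield \<Rightarrow> 'a \<Rightarrow> real" where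
  "koszul M g X Y Z p =
     X p (\<lambda>q. g q (Y q) (Z q)) + Y p (\<lambda>q. g q (X q) (Z q)) - Z p (\<lambda>q. g q (X q) (Y q))
     + g p (lie_bracket M X Y p) (Z p) - g p (lie_bracket M X Z p) (Y p)
     - g p (lie_bracket M Y Z p) (X p)"

definition levi_civita ::
    "('a, 'n::finite) charted_space \<Rightarrow> 'a metric_tensor \<Rightarrow> 'a vfield \<Rightarrow> 'a vfield \<Rightarrow> 'a vfield" where
  "levi_civita M g X Y = (\<lambda>p. THE v. v \<in> tangent_space M p \<and>
     (\<forall>Z. smooth_vfield_near M p Z \<longrightarrow> 2 * g p v (Z p) = koszul M g X Y Z p))"

definition curvature ::
    "('a, 'n::finite) charted_space \<Rightarrow> 'a metric_tensor \<Rightarrow> 'a vfield \<Rightarrow> 'a vfield \<Rightarrow> 'a vfield \<Rightarrow> 'a vfield" where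
  "curvature M g X Y Z = (\<lambda>p f.
     levi_civita M g X (levi_civita M g Y Z) p f
     - levi_civita M g Y (levi_civita M g X Z) p f
     - levi_civita M g (lie_bracket M X Y) Z p f)"

definition orthonormal_basis ::
    "('a, 'n::finite) charted_space \<Rightarrow> 'a metric_tensor \<Rightarrow> 'a \<Rightarrow> ('n \<Rightarrow> 'a tvec) \<Rightarrow> bool" where
  "orthonormal_basis M g p e \<longleftrightarrow>
     (\<forall>i. e i \<in> tangent_space M p) \<and> (\<forall>i j. g p (e i) (e j) = (if i = j then 1 else 0))"

(* Some orthonormal basis of the tangent space at p; the traces below do not depend on it. *)
definition onb :: "('a, 'n::finite) charted_space \<Rightarrow> 'a metric_tensor \<Rightarrow> 'a \<Rightarrow> 'n \<Rightarrow> 'a tvec" where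
  "onb M g p = (SOME e. orthonormal_basis M g p e)"

(* Ric(v,w) is the trace of u |-> R(u,v)w. *)
definition ricci ::
    "('a, 'n::finite) charted_space \<Rightarrow> 'a metric_tensor \<Rightarrow> 'a metric_tensor" where
  "ricci M g p v w = (\<Sum>i\<in>UNIV. g p
     (curvature M g (extension M p (onb M g p i)) (extension M p v) (extension M p w) p)
     (onb M g p i))"

definition scalar_curvature ::
    "('a, 'n::finite) charted_space \<Rightarrow> 'a metric_tensor \<Rightarrow> 'a \<Rightarrow> real" where
  "scalar_curvature M g p = (\<Sum>i\<in>UNIV. ricci M g p (onb M g p i) (onb M g p i))"

definition ricci_operator ::
    "('a, 'n::finite) charted_space \<Rightarrow> 'a metric_tensor \<Rightarrow> 'a \<Rightarrow> 'a tvec \<Rightarrow> 'a tvec" where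
  "ricci_operator M g p v = (THE w. w \<in> tangent_space M p \<and>
     (\<forall>u\<in>tangent_space M p. ricci M g p v u = g p w u))"

definition ricci_operator_norm_sq ::
    "('a, 'n::finite) charted_space \<Rightarrow> 'a metric_tensor \<Rightarrow> 'a \<Rightarrow> real" where
  "ricci_operator_norm_sq M g p = (\<Sum>i\<in>UNIV.
     g p (ricci_operator M g p (onb M g p i)) (ricci_operator M g p (onb M g p i)))"

(* (L_\<xi> g)(X,Y) = \<xi>(g(X,Y)) - g([\<xi>,X],Y) - g(X,[\<xi>,Y]), evaluated on tangent vectors at p. *)
definition lie_derivative_metric ::
    "('a, 'n::finite) charted_space \<Rightarrow> 'a vfield \<Rightarrow> 'a metric_tensor \<Rightarrow> 'a metric_tensor" where
  "lie_derivative_metric M \<xi> g p v w =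
     (let X = extension M p v; Y = extension M p w in
      \<xi> p (\<lambda>q. g q (X q) (Y q))
      - g p (lie_bracket M \<xi> X p) (Y p) - g p (X p) (lie_bracket M \<xi> Y p))"

section \<open>Riemannian volume\<close>

(* The matrix of g at p in the coordinate frame of the chart c. *)
definition metric_matrix ::
    "('a, 'n::finite) charted_space \<Rightarrow> 'a metric_tensor \<Rightarrow> ('a, 'n) chart \<Rightarrow> 'a \<Rightarrow> real^'n^'n" where
  "metric_matrix M g c p =
     (\<chi> i j. g p (chart_vec M c p (axis i 1)) (chart_vec M c p (axis j 1)))"

(* The Borel measure on M that is sqrt (det g_ij) dx in every chart. *)
definition riemannian_volume ::
    "('a, 'n::finite) charted_space \<Rightarrow> 'a metric_tensor \<Rightarrow> 'a measure" where
  "riemannian_volume M g = (THE \<mu>.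
     space \<mu> = points M \<and> sets \<mu> = sigma_sets (points M) {U. openin (mtop M) U} \<and>
     (\<forall>(U, \<phi>) \<in> atlas M. \<forall>B \<in> sets \<mu>. B \<subseteq> U \<longrightarrow>
        emeasure \<mu> B = (\<integral>\<^sup>+x\<in>\<phi> ` B.
          ennreal (sqrt (det (metric_matrix M g (U, \<phi>) (inv_into U \<phi> x)))) \<partial>lborel)))"

section \<open>Almost Ricci-Bourguignon solitons\<close>

definition almost_RB_soliton ::
    "('a, 'n::finite) charted_space \<Rightarrow> 'a metric_tensor \<Rightarrow> 'a vfield \<Rightarrow> ('a \<Rightarrow> real) \<Rightarrow> real \<Rightarrow> bool" where
  "almost_RB_soliton M g \<xi> lam \<rho> \<longleftrightarrow>
     smooth_manifold M \<and> riemannian_metric M g \<and>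
     smooth_vfield M (points M) \<xi> \<and> smooth_fun M (points M) lam \<and>
     (\<forall>p\<in>points M. \<forall>v\<in>tangent_space M p. \<forall>w\<in>tangent_space M p.
        ricci M g p v w + 1/2 * lie_derivative_metric M \<xi> g p v w
        = (lam p + \<rho> * scalar_curvature M g p) * g p v w)"

end

(* Write E = Q - (S/2) I.  Contracting the soliton equation with Ric and with g turns the integrand
   into trace (E o nabla xi), and by the contracted second Bianchi identity div E = 0 this is
   div (E xi).  The Bianchi identity is proved in an arbitrary chart: with A_i the matrices of
   Christoffel symbols and F_ij = d_i A_j - d_j A_i + [A_i, A_j], the cyclic sum of
   d_k F_ij + [A_k, F_ij] vanishes, and contracting after raising an index gives div E = 0.  For the
   divergence theorem the integrand is split as the sum of the functions h_k div (E xi) + (E xi) h_k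
   over a partition of unity (h_k): in the chart around the support of h_k such a function times the
   volume density is a Euclidean divergence with compact support. *)

theory Submission
  imports Defs
begin

section \<open>Functions of class C^k\<close>

text \<open>The factor 1/2 in E is forced twice. Let B be the matrix of nabla \<xi>, B' its adjoint
  and \<mu> = lam + \<rho> S. The soliton equation says Q = \<mu> - (B + B')/2, so trace B = n \<mu>
  - S and |Q|^2 = \<mu> S - trace (Q B), and the integrand is trace (Q B) - (S/2) trace B. On the
  other hand S/2 is exactly the correction that makes E divergence free. The partition enters with
  its sum 1 twice: the terms h_k div (E \<xi>) add up to the integrand, the terms (E \<xi>) h_k to
  the derivative of a constant. The obstacle is that tangent vectors are functionals and that
  \<open>extension\<close>, \<open>onb\<close>, \<open>levi_civita\<close>,
  \<open>ricci_operator\<close> and \<open>riemannian_volume\<close> are choices or definite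
  descriptions. Each is identified once with an expression in an arbitrary chart; the rest is matrix
  calculus on an open set. For the volume this means that exactly one measure meets the description:
  chart measures are glued over a finite subcover, and they agree on overlaps by the change of
  variables formula.\<close>

abbreviation D :: "(real^'n \<Rightarrow> 'b::real_normed_vector) \<Rightarrow> real^'n \<Rightarrow> real^'n \<Rightarrow> 'b" where
  "D f x \<equiv> frechet_derivative f (at x)"

section \<open>Derivatives on open sets: locality, expansion along the axes, product rules\<close>

lemma differentiable_on_openD:
  "f differentiable_on S \<Longrightarrow> open S \<Longrightarrow> x \<in> S \<Longrightarrow> f differentiable (at x)"
  by (metis at_within_open differentiable_on_def)

lemma differentiable_on_openI:
  "(\<And>x. x \<in> S \<Longrightarrow> f differentiable (at x)) \<Longrightarrow> f differentiable_on S"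
  by (simp add: differentiable_at_withinI differentiable_on_def)

lemma has_derivative_cong_open:
  assumes "open S" "x \<in> S" "\<And>y. y \<in> S \<Longrightarrow> f y = g y"
  shows "(f has_derivative f') (at x) \<longleftrightarrow> (g has_derivative f') (at x)"
  using has_derivative_transform_within_open[of f f' x UNIV S g] has_derivative_transform_within_open[of g f' x UNIV S f]
    assms by auto

text \<open>\<open>frechet_derivative\<close> is a choice among the derivatives at x, so maps that
  agree near x make the same choice, differentiable or not.\<close>

lemma D_cong:
  assumes "open S" "x \<in> S" "\<And>y. y \<in> S \<Longrightarrow> f y = g y"
  shows "D f x = D g x"
  using has_derivative_cong_open[OF assms] unfolding frechet_derivative_def by simp

lemma differentiable_cong_open:
  assumes "open S" "x \<in> S" "\<And>y. y \<in> S \<Longrightarrow> f y = g y"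
  shows "f differentiable (at x) \<longleftrightarrow> g differentiable (at x)"
  using has_derivative_cong_open[OF assms] unfolding differentiable_def by simp

lemma has_derivative_D: "f differentiable (at x) \<Longrightarrow> (f has_derivative D f x) (at x)"
  by (simp add: frechet_derivative_works)

lemma D_eqI: "(f has_derivative f') (at x) \<Longrightarrow> D f x = f'"
  by (rule frechet_derivative_at[symmetric])

lemma D_linear:
  assumes "f differentiable (at x)"
  shows "D f x (a *\<^sub>R u + b *\<^sub>R v) = a *\<^sub>R D f x u + b *\<^sub>R D f x v"
  using linear_frechet_derivative[OF assms] by (simp add: linear_add linear_scale)

lemma linear_expand_axis:
  fixes f :: "real^'n \<Rightarrow> 'b::real_vector"
  assumes "linear f"
  shows "f u = (\<Sum>i\<in>UNIV. (u $ i) *\<^sub>R f (axis i 1))"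
proof -
  have "u = (\<Sum>i\<in>UNIV. (u $ i) *\<^sub>R axis i 1)"
    by (simp add: vec_eq_iff axis_def if_distrib cong: if_cong)
  then have "f u = f (\<Sum>i\<in>UNIV. (u $ i) *\<^sub>R axis i 1)" by simp
  then show ?thesis by (simp only: linear_sum[OF assms] linear_scale[OF assms])
qed

text \<open>Replaces a direction that moves with the point by the fixed axis directions, the only
  kind that the inductive definition of \<open>Ck_on\<close> handles.\<close>

lemma D_expand:
  fixes f :: "real^'n \<Rightarrow> 'b::real_normed_vector"
  assumes "f differentiable (at x)"
  shows "D f x v = (\<Sum>i\<in>UNIV. (v $ i) *\<^sub>R D f x (axis i 1))"
  by (rule linear_expand_axis[OF linear_frechet_derivative[OF assms]])

lemma D_add: "f differentiable (at x) \<Longrightarrow> g differentiable (at x) \<Longrightarrow>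
    D (\<lambda>x. f x + g x) x v = D f x v + D g x v"
  by (subst D_eqI[OF has_derivative_add[OF has_derivative_D has_derivative_D]]) auto

lemma D_diff: "f differentiable (at x) \<Longrightarrow> g differentiable (at x) \<Longrightarrow>
    D (\<lambda>x. f x - g x) x v = D f x v - D g x v"
  by (subst D_eqI[OF has_derivative_diff[OF has_derivative_D has_derivative_D]]) auto

lemma D_sum: "(\<And>i. i \<in> I \<Longrightarrow> f i differentiable (at x)) \<Longrightarrow>
    D (\<lambda>x. \<Sum>i\<in>I. f i x) x v = (\<Sum>i\<in>I. D (f i) x v)"
  by (subst D_eqI[OF has_derivative_sum[OF has_derivative_D]]) auto

lemma D_bilinear:
  fixes x :: "real^'n"
  assumes "bounded_bilinear p" "f differentiable (at x)" "g differentiable (at x)"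
  shows "D (\<lambda>x. p (f x) (g x)) x v = p (f x) (D g x v) + p (D f x v) (g x)"
  by (subst D_eqI[OF bounded_bilinear.FDERIV[OF assms(1) has_derivative_D[OF assms(2)] has_derivative_D[OF assms(3)]]]) simp

lemma differentiable_bilinear:
  fixes x :: "real^'n"
  assumes "bounded_bilinear p" "f differentiable (at x)" "g differentiable (at x)"
  shows "(\<lambda>x. p (f x) (g x)) differentiable (at x)"
  using bounded_bilinear.FDERIV[OF assms(1) has_derivative_D[OF assms(2)] has_derivative_D[OF assms(3)]]
  unfolding differentiable_def by blast

lemma D_bounded_linear:
  assumes "bounded_linear h" "f differentiable (at x)"
  shows "D (\<lambda>x. h (f x)) x v = h (D f x v)"
  by (subst D_eqI[OF bounded_linear.has_derivative[OF assms(1) has_derivative_D[OF assms(2)]]]) simp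

lemma differentiable_bounded_linear:
  fixes x :: "real^'n"
  assumes "bounded_linear h" "f differentiable (at x)"
  shows "(\<lambda>x. h (f x)) differentiable (at x)"
  using bounded_linear.has_derivative[OF assms(1) has_derivative_D[OF assms(2)]]
  unfolding differentiable_def by blast

lemma D_nth:
  fixes f :: "real^'n \<Rightarrow> 'b::real_normed_vector^'m"
  shows "f differentiable (at x) \<Longrightarrow> D (\<lambda>x. f x $ i) x v = D f x v $ i"
  by (rule D_bounded_linear[OF bounded_linear_vec_nth])

lemmas differentiable_nth = differentiable_bounded_linear[OF bounded_linear_vec_nth]

lemma differentiable_vec:
  fixes f :: "real^'n \<Rightarrow> 'b::real_normed_vector^'m"
  assumes "\<And>i. (\<lambda>x. f x $ i) differentiable (at x)"
  shows "f differentiable (at x)"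
proof -
  have "(f has_derivative (\<lambda>v. \<chi> i. D (\<lambda>x. f x $ i) x v)) (at x)"
  proof (rule has_derivativeI)
    have *: "bounded_linear (D (\<lambda>x. f x $ i) x)" for i
      using has_derivative_D[OF assms] has_derivative_bounded_linear by blast
    show "bounded_linear (\<lambda>v. \<chi> i. D (\<lambda>x. f x $ i) x v)"
      by (rule linear_conv_bounded_linear[THEN iffD1], rule linearI)
        (simp_all add: vec_eq_iff linear_add linear_scale bounded_linear.linear[OF *])
    show "((\<lambda>y. (f y - f x - (\<chi> i. D (\<lambda>x. f x $ i) x (y - x))) /\<^sub>R norm (y - x)) \<longlongrightarrow> 0) (at x)"
      apply (rule vec_tendstoI)
      using has_derivative_D[OF assms] by (simp add: has_derivative_at_within)
  qed
  then show ?thesis unfolding differentiable_def by blast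
qed

section \<open>Closure properties of the class C^k\<close>

lemma Ck_on_subset: "Ck_on k S f \<Longrightarrow> T \<subseteq> S \<Longrightarrow> Ck_on k T f"
  by (induction k arbitrary: f) (auto intro: continuous_on_subset differentiable_on_subset)

lemma Ck_on_cong:
  assumes "open S" "\<And>x. x \<in> S \<Longrightarrow> f x = g x" "Ck_on k S f"
  shows "Ck_on k S g"
  using assms(2,3)
proof (induction k arbitrary: f g)
  case 0
  then show ?case unfolding Ck_on.simps by (rule continuous_on_eq[rotated])
next
  case (Suc k)
  have eq: "D f x = D g x" if "x \<in> S" for x by (rule D_cong[OF assms(1) that Suc.prems(1)])
  show ?case unfolding Ck_on.simps
  proof (intro conjI allI)
    show "g differentiable_on S"
      using Suc.prems differentiable_cong_open[OF assms(1), of _ f g] differentiable_on_openD[OF _ assms(1), of f]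
      by (intro differentiable_on_openI) auto
    show "Ck_on k S (\<lambda>x. D g x v)" for v
      by (rule Suc.IH[of "\<lambda>x. D f x v"]) (use eq Suc.prems(2) in auto)
  qed
qed

lemma Ck_on_SucD: "open S \<Longrightarrow> Ck_on (Suc k) S f \<Longrightarrow> Ck_on k S f"
proof (induction k arbitrary: f)
  case 0 then show ?case by (simp add: differentiable_imp_continuous_on)
qed (auto)

text \<open>The derivatives in \<open>Ck_on\<close> are taken at x in the full space, so only the
  behaviour near each point counts. This is what makes extensions by zero smooth.\<close>

lemma Ck_on_local:
  assumes "\<And>x. x \<in> S \<Longrightarrow> \<exists>T. open T \<and> x \<in> T \<and> Ck_on k T f"
  shows "Ck_on k S f"
  using assms
proof (induction k arbitrary: f)
  case 0
  show ?case
    unfolding Ck_on.simps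
  proof (rule continuous_at_imp_continuous_on, rule ballI)
    fix x assume "x \<in> S"
    then obtain T where "open T" "x \<in> T" "continuous_on T f" using 0 by auto
    then show "isCont f x" by (simp add: continuous_on_eq_continuous_at)
  qed
next
  case (Suc k)
  show ?case unfolding Ck_on.simps
  proof (intro conjI allI)
    show "f differentiable_on S"
    proof (rule differentiable_on_openI)
      fix x assume "x \<in> S"
      then obtain T where "open T" "x \<in> T" "f differentiable_on T" using Suc.prems by auto
      then show "f differentiable (at x)" using differentiable_on_openD by blast
    qed
    show "Ck_on k S (\<lambda>x. D f x v)" for v
    proof (rule Suc.IH)
      fix x assume "x \<in> S"
      then show "\<exists>T. open T \<and> x \<in> T \<and> Ck_on k T (\<lambda>x. D f x v)"
        using Suc.prems by auto
    qed
  qed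
qed

lemma Ck_on_const: "Ck_on k S (\<lambda>x. c)"
  by (induction k arbitrary: c) auto

lemma Ck_on_bounded_linear:
  assumes "bounded_linear h" "open S" shows "Ck_on k S f \<Longrightarrow> Ck_on k S (\<lambda>x. h (f x))"
proof (induction k arbitrary: f)
  case 0 then show ?case
    using bounded_linear.continuous_on[OF assms(1)] by auto
next
  case (Suc k)
  then have d: "\<And>x. x \<in> S \<Longrightarrow> f differentiable (at x)" using assms(2) by (auto intro: differentiable_on_openD)
  show ?case unfolding Ck_on.simps
  proof (intro conjI allI)
    show "(\<lambda>x. h (f x)) differentiable_on S"
      using d differentiable_bounded_linear[OF assms(1)] by (blast intro: differentiable_on_openI)
    show "Ck_on k S (\<lambda>x. D (\<lambda>x. h (f x)) x v)" for v
      apply (rule Ck_on_cong[OF assms(2) _ Suc.IH[of "\<lambda>x. D f x v"]])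
      using D_bounded_linear[OF assms(1) d] Suc.prems by auto
  qed
qed

lemma Ck_on_add:
  assumes "open S" shows "Ck_on k S f \<Longrightarrow> Ck_on k S g \<Longrightarrow> Ck_on k S (\<lambda>x. f x + g x)"
proof (induction k arbitrary: f g)
  case 0 then show ?case by (auto intro: continuous_on_add)
next
  case (Suc k)
  then have d: "\<And>x. x \<in> S \<Longrightarrow> f differentiable (at x)" "\<And>x. x \<in> S \<Longrightarrow> g differentiable (at x)"
    using assms by (auto intro: differentiable_on_openD)
  show ?case unfolding Ck_on.simps
  proof (intro conjI allI)
    show "(\<lambda>x. f x + g x) differentiable_on S"
      using Suc.prems by auto
    show "Ck_on k S (\<lambda>x. D (\<lambda>x. f x + g x) x v)" for v
      apply (rule Ck_on_cong[OF assms _ Suc.IH[of "\<lambda>x. D f x v" "\<lambda>x. D g x v"]])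
      using D_add[OF d] Suc.prems by auto
  qed
qed

lemma Ck_on_sum:
  assumes "open S" "\<And>i. i \<in> I \<Longrightarrow> Ck_on k S (f i)" shows "Ck_on k S (\<lambda>x. \<Sum>i\<in>I. f i x)"
  using assms(2)
  by (induction I rule: infinite_finite_induct) (auto intro: Ck_on_add[OF assms(1)] Ck_on_const)

text \<open>One Leibniz argument for scalars, inner products, \<open>scaleR\<close> and matrix
  products alike; the factor that is not differentiated is C^k by \<open>Ck_on_SucD\<close>.\<close>

lemma Ck_on_bilinear:
  assumes "bounded_bilinear p" "open S"
  shows "Ck_on k S f \<Longrightarrow> Ck_on k S g \<Longrightarrow> Ck_on k S (\<lambda>x. p (f x) (g x))"
proof (induction k arbitrary: f g)
  case 0 then show ?case using bounded_bilinear.continuous_on[OF assms(1)] by auto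
next
  case (Suc k)
  then have d: "\<And>x. x \<in> S \<Longrightarrow> f differentiable (at x)" "\<And>x. x \<in> S \<Longrightarrow> g differentiable (at x)"
    using assms by (auto intro: differentiable_on_openD)
  have c: "Ck_on k S f" "Ck_on k S g" using Suc.prems Ck_on_SucD[OF assms(2)] by blast+
  show ?case unfolding Ck_on.simps
  proof (intro conjI allI)
    show "(\<lambda>x. p (f x) (g x)) differentiable_on S"
      using d differentiable_bilinear[OF assms(1)] by (blast intro: differentiable_on_openI)
    show "Ck_on k S (\<lambda>x. D (\<lambda>x. p (f x) (g x)) x v)" for v
      apply (rule Ck_on_cong[OF assms(2), of "\<lambda>x. p (f x) (D g x v) + p (D f x v) (g x)"])
      subgoal using D_bilinear[OF assms(1) d] by auto
      subgoal using Suc.prems c by (intro Ck_on_add[OF assms(2)] Suc.IH) auto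
      done
  qed
qed

lemma Ck_on_compose:
  fixes g :: "real^'n \<Rightarrow> real^'m"
  assumes "open S" "open T"
  shows "Ck_on k T f \<Longrightarrow> Ck_on k S g \<Longrightarrow> g ` S \<subseteq> T \<Longrightarrow> Ck_on k S (\<lambda>x. f (g x))"
proof (induction k arbitrary: f)
  case 0 then show ?case by (auto intro: continuous_on_compose2)
next
  case (Suc k)
  then have d: "\<And>x. x \<in> T \<Longrightarrow> f differentiable (at x)" "\<And>x. x \<in> S \<Longrightarrow> g differentiable (at x)"
    using assms by (auto intro: differentiable_on_openD)
  have gT: "g x \<in> T" if "x \<in> S" for x using Suc.prems(3) that by auto
  have h: "((\<lambda>x. f (g x)) has_derivative (\<lambda>v. D f (g x) (D g x v))) (at x)" if "x \<in> S" for x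
    using diff_chain_at[OF has_derivative_D[OF d(2)[OF that]] has_derivative_D[OF d(1)[OF gT[OF that]]]]
    by (simp add: o_def)
  show ?case unfolding Ck_on.simps
  proof (intro conjI allI)
    show "(\<lambda>x. f (g x)) differentiable_on S"
      using h by (intro differentiable_on_openI) (rule differentiableI)
    show "Ck_on k S (\<lambda>x. D (\<lambda>x. f (g x)) x v)" for v
    \<comment> \<open>The chain rule evaluates \<open>D f (g x)\<close> on a direction that moves
      with x. Along the axes the direction is fixed, so each partial derivative of f is again a map
      to which the induction hypothesis applies.\<close>
    proof (rule Ck_on_cong[OF assms(1), of "\<lambda>x. \<Sum>i\<in>UNIV. (D g x v $ i) *\<^sub>R D f (g x) (axis i 1)"])
      show "(\<Sum>i\<in>UNIV. D g x v $ i *\<^sub>R D f (g x) (axis i 1)) = D (\<lambda>x. f (g x)) x v" if "x \<in> S" for x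
        unfolding D_eqI[OF h[OF that]] by (rule D_expand[OF d(1)[OF gT[OF that]], symmetric])
      have g: "Ck_on k S g" using Suc.prems Ck_on_SucD assms(1) by blast
      show "Ck_on k S (\<lambda>x. \<Sum>i\<in>UNIV. (D g x v $ i) *\<^sub>R D f (g x) (axis i 1))"
        by (intro Ck_on_sum Ck_on_bilinear[OF bounded_bilinear_scaleR] assms
            Ck_on_bounded_linear[OF bounded_linear_vec_nth] Suc.IH[of "\<lambda>y. D f y (axis i 1)" for i] g Suc.prems(3))
          (use Suc.prems in auto)
    qed
  qed
qed

lemma Ck_on_inverse:
  fixes f :: "real^'n \<Rightarrow> real"
  assumes "open S" "\<And>x. x \<in> S \<Longrightarrow> f x \<noteq> 0"
  shows "Ck_on k S f \<Longrightarrow> Ck_on k S (\<lambda>x. inverse (f x))"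
proof (induction k)
  case 0 then show ?case using assms by (auto intro: continuous_on_inverse)
next
  case (Suc k)
  then have d: "\<And>x. x \<in> S \<Longrightarrow> f differentiable (at x)"
    using assms by (auto intro: differentiable_on_openD)
  have c: "Ck_on k S f" using Suc.prems Ck_on_SucD[OF assms(1)] by blast
  have h: "((\<lambda>x. inverse (f x)) has_derivative (\<lambda>h. - (inverse (f x) * D f x h * inverse (f x)))) (at x)" if "x \<in> S" for x
    using Deriv.has_derivative_inverse[OF assms(2)[OF that] has_derivative_D[OF d[OF that]]] by simp
  note mult = Ck_on_bilinear[OF bounded_bilinear_mult assms(1)]
  show ?case unfolding Ck_on.simps
  proof (intro conjI allI)
    show "(\<lambda>x. inverse (f x)) differentiable_on S"
      using h by (intro differentiable_on_openI) (rule differentiableI)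
    show "Ck_on k S (\<lambda>x. D (\<lambda>x. inverse (f x)) x v)" for v
      \<comment> \<open>The derivative of 1/f is built from D f and two copies of 1/f, which are C^k
        by the induction hypothesis.\<close>
      apply (rule Ck_on_cong[OF assms(1), of "\<lambda>x. (-1) * (inverse (f x) * D f x v * inverse (f x))"])
      subgoal using D_eqI[OF h] by simp
      subgoal using Suc.prems c by (intro mult Suc.IH Ck_on_const) auto
      done
  qed
qed

lemma Ck_on_id: "open S \<Longrightarrow> Ck_on k S (\<lambda>x. x)"
  by (cases k) (auto simp: Ck_on_const)

lemma Ck_on_vec:
  fixes f :: "real^'n \<Rightarrow> 'b::real_normed_vector^'m"
  assumes "open S" "\<And>i. Ck_on k S (\<lambda>x. f x $ i)"
  shows "Ck_on k S f"
  using assms(2)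
proof (induction k arbitrary: f)
  case 0
  then show ?case by (auto simp: continuous_on_def intro: vec_tendstoI)
next
  case (Suc k)
  have d: "(\<lambda>x. f x $ i) differentiable (at x)" if "x \<in> S" for x i
    using Suc.prems assms(1) that by (auto intro: differentiable_on_openD)
  have d': "f differentiable (at x)" if "x \<in> S" for x
    using differentiable_vec d that by blast
  show ?case unfolding Ck_on.simps
  proof (intro conjI allI)
    show "f differentiable_on S" using d' differentiable_on_openI by blast
    show "Ck_on k S (\<lambda>x. D f x v)" for v
    proof (rule Suc.IH)
      show "Ck_on k S (\<lambda>x. D f x v $ i)" for i
        apply (rule Ck_on_cong[OF assms(1), of "\<lambda>x. D (\<lambda>x. f x $ i) x v"])
        using D_nth[OF d'] Suc.prems by auto
    qed
  qed
qed

section \<open>Closure properties of smooth maps\<close>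

lemma smooth_on_subset: "smooth_on S f \<Longrightarrow> T \<subseteq> S \<Longrightarrow> smooth_on T f"
  using Ck_on_subset unfolding smooth_on_def by blast

lemma smooth_on_cong:
  "open S \<Longrightarrow> (\<And>x. x \<in> S \<Longrightarrow> f x = g x) \<Longrightarrow> smooth_on S f \<longleftrightarrow> smooth_on S g"
  unfolding smooth_on_def using Ck_on_cong[of S f g] Ck_on_cong[of S g f] by auto

lemma smooth_on_local:
  "(\<And>x. x \<in> S \<Longrightarrow> \<exists>T. open T \<and> x \<in> T \<and> smooth_on T f) \<Longrightarrow> smooth_on S f"
  unfolding smooth_on_def using Ck_on_local by metis

lemma smooth_on_differentiable: "smooth_on S f \<Longrightarrow> open S \<Longrightarrow> x \<in> S \<Longrightarrow> f differentiable (at x)"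
  unfolding smooth_on_def by (metis Ck_on.simps(2) differentiable_on_openD)

lemma smooth_on_continuous: "smooth_on S f \<Longrightarrow> continuous_on S f"
  unfolding smooth_on_def by (metis Ck_on.simps(1))

lemma smooth_on_D: "smooth_on S f \<Longrightarrow> smooth_on S (\<lambda>x. D f x v)"
  unfolding smooth_on_def by (metis Ck_on.simps(2))

lemma smooth_on_const: "smooth_on S (\<lambda>x. c)"
  by (simp add: smooth_on_def Ck_on_const)

lemma smooth_on_id: "open S \<Longrightarrow> smooth_on S (\<lambda>x. x)"
  by (simp add: smooth_on_def Ck_on_id)

lemma smooth_on_add: "open S \<Longrightarrow> smooth_on S f \<Longrightarrow> smooth_on S g \<Longrightarrow> smooth_on S (\<lambda>x. f x + g x)"
  by (simp add: smooth_on_def Ck_on_add)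

lemma smooth_on_sum: "open S \<Longrightarrow> (\<And>i. i \<in> I \<Longrightarrow> smooth_on S (f i)) \<Longrightarrow> smooth_on S (\<lambda>x. \<Sum>i\<in>I. f i x)"
  by (simp add: smooth_on_def Ck_on_sum)

lemma smooth_on_bilinear: "bounded_bilinear p \<Longrightarrow> open S \<Longrightarrow> smooth_on S f \<Longrightarrow> smooth_on S g \<Longrightarrow>
    smooth_on S (\<lambda>x. p (f x) (g x))"
  by (simp add: smooth_on_def Ck_on_bilinear)

lemma smooth_on_bounded_linear: "bounded_linear h \<Longrightarrow> open S \<Longrightarrow> smooth_on S f \<Longrightarrow> smooth_on S (\<lambda>x. h (f x))"
  by (simp add: smooth_on_def Ck_on_bounded_linear)

lemmas smooth_on_scaleR = smooth_on_bilinear[OF bounded_bilinear_scaleR]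
lemmas smooth_on_mult = smooth_on_bilinear[OF bounded_bilinear_mult]
lemmas smooth_on_nth = smooth_on_bounded_linear[OF bounded_linear_vec_nth]

lemma smooth_on_minus: "open S \<Longrightarrow> smooth_on S f \<Longrightarrow> smooth_on S (\<lambda>x. - f x)"
  by (rule smooth_on_bounded_linear[OF bounded_linear_minus[OF bounded_linear_ident]])

lemma smooth_on_diff: "open S \<Longrightarrow> smooth_on S f \<Longrightarrow> smooth_on S g \<Longrightarrow> smooth_on S (\<lambda>x. f x - g x)"
  using smooth_on_add[of S f "\<lambda>x. - g x"] smooth_on_minus[of S g] by simp

lemma smooth_on_prod:
  fixes f :: "'i \<Rightarrow> real^'n \<Rightarrow> real"
  assumes "open S" "\<And>i. i \<in> I \<Longrightarrow> smooth_on S (f i)" shows "smooth_on S (\<lambda>x. \<Prod>i\<in>I. f i x)"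
  using assms(2)
  by (induction I rule: infinite_finite_induct) (auto intro: smooth_on_mult[OF assms(1)] smooth_on_const)

lemma smooth_on_inverse:
  fixes f :: "real^'n \<Rightarrow> real"
  shows "open S \<Longrightarrow> (\<And>x. x \<in> S \<Longrightarrow> f x \<noteq> 0) \<Longrightarrow> smooth_on S f \<Longrightarrow> smooth_on S (\<lambda>x. inverse (f x))"
  by (simp add: smooth_on_def Ck_on_inverse)

lemma smooth_on_compose:
  fixes g :: "real^'n \<Rightarrow> real^'m"
  shows "open S \<Longrightarrow> open T \<Longrightarrow> smooth_on T f \<Longrightarrow> smooth_on S g \<Longrightarrow> g ` S \<subseteq> T \<Longrightarrow> smooth_on S (\<lambda>x. f (g x))"
  by (simp add: smooth_on_def Ck_on_compose)

lemma smooth_on_vec: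
  fixes f :: "real^'n \<Rightarrow> 'b::real_normed_vector^'m"
  shows "open S \<Longrightarrow> (\<And>i. smooth_on S (\<lambda>x. f x $ i)) \<Longrightarrow> smooth_on S f"
  by (simp add: smooth_on_def Ck_on_vec)

lemma smooth_on_D_along:
  assumes "open S" "smooth_on S f" "smooth_on S v"
  shows "smooth_on S (\<lambda>x. D f x (v x))"
proof -
  have "smooth_on S (\<lambda>x. \<Sum>i\<in>UNIV. (v x $ i) *\<^sub>R D f x (axis i 1))"
    using assms by (intro smooth_on_sum smooth_on_scaleR smooth_on_nth smooth_on_D)
  then show ?thesis
    by (subst smooth_on_cong[OF assms(1), of _ "\<lambda>x. \<Sum>i\<in>UNIV. (v x $ i) *\<^sub>R D f x (axis i 1)"])
      (rule D_expand[OF smooth_on_differentiable[OF assms(2,1)]])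
qed

section \<open>Symmetry of second derivatives\<close>

lemma has_real_derivative_along_line:
  fixes F :: "real^'n \<Rightarrow> real"
  assumes "F differentiable (at (a + s *\<^sub>R w))"
  shows "((\<lambda>s. F (a + s *\<^sub>R w)) has_real_derivative D F (a + s *\<^sub>R w) w) (at s)"
proof -
  have 1: "((\<lambda>s. a + s *\<^sub>R w) has_derivative (\<lambda>s. s *\<^sub>R w)) (at s)"
    by (auto intro!: derivative_eq_intros)
  have "((\<lambda>s. F (a + s *\<^sub>R w)) has_derivative (\<lambda>r. D F (a + s *\<^sub>R w) (r *\<^sub>R w))) (at s)"
    using diff_chain_at[OF 1 has_derivative_D[OF assms]] by (simp add: o_def)
  then show ?thesis
    unfolding has_field_derivative_def
    by (rule has_derivative_eq_rhs)
      (simp add: fun_eq_iff linear_scale[OF linear_frechet_derivative[OF assms]])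
qed

text \<open>Two mean value theorems: one along u for the v-difference of f, one along v for the
  u-derivative of f.\<close>

lemma mixed_difference_mean_value:
  fixes f :: "real^'n \<Rightarrow> real"
  assumes S: "open S" and f: "smooth_on S f" and h: "h > 0"
    and sub: "\<And>s t. s \<in> {0..h} \<Longrightarrow> t \<in> {0..h} \<Longrightarrow> x + s *\<^sub>R u + t *\<^sub>R v \<in> S"
  obtains s t where "s \<in> {0..h}" "t \<in> {0..h}"
    "f (x + h *\<^sub>R u + h *\<^sub>R v) - f (x + h *\<^sub>R u) - f (x + h *\<^sub>R v) + f x
      = h^2 * D (\<lambda>y. D f y u) (x + s *\<^sub>R u + t *\<^sub>R v) v"
proof -
  have df: "f differentiable (at y)" if "y \<in> S" for y
    using smooth_on_differentiable[OF f S that] .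
  have df2: "(\<lambda>y. D f y u) differentiable (at y)" if "y \<in> S" for y
    using smooth_on_differentiable[OF smooth_on_D[OF f] S that] .
  note der = has_real_derivative_along_line
  define P where "P s = f ((x + h *\<^sub>R v) + s *\<^sub>R u) - f (x + s *\<^sub>R u)" for s
  have 1: "DERIV P s :> D f ((x + h *\<^sub>R v) + s *\<^sub>R u) u - D f (x + s *\<^sub>R u) u" if "0 \<le> s" "s \<le> h" for s
    unfolding P_def
  proof (intro DERIV_diff der df)
    show "x + h *\<^sub>R v + s *\<^sub>R u \<in> S" using sub[of s h] that h by (simp add: algebra_simps)
    show "x + s *\<^sub>R u \<in> S" using sub[of s 0] that h by simp
  qed
  obtain s where s: "0 < s" "s < h" "P h - P 0 = (h - 0) * (D f ((x + h *\<^sub>R v) + s *\<^sub>R u) u - D f (x + s *\<^sub>R u) u)"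
    using MVT2[OF h 1] by blast
  define R where "R t = D f ((x + s *\<^sub>R u) + t *\<^sub>R v) u" for t
  have 2: "DERIV R t :> D (\<lambda>y. D f y u) ((x + s *\<^sub>R u) + t *\<^sub>R v) v" if "0 \<le> t" "t \<le> h" for t
    unfolding R_def by (rule der, rule df2) (use sub[of s t] that s in simp)
  obtain t where t: "0 < t" "t < h" "R h - R 0 = (h - 0) * D (\<lambda>y. D f y u) ((x + s *\<^sub>R u) + t *\<^sub>R v) v"
    using MVT2[OF h 2] by blast
  have "R h - R 0 = D f ((x + h *\<^sub>R v) + s *\<^sub>R u) u - D f (x + s *\<^sub>R u) u"
    unfolding R_def by (simp add: algebra_simps)
  then have "P h - P 0 = h^2 * D (\<lambda>y. D f y u) (x + s *\<^sub>R u + t *\<^sub>R v) v"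
    using s(3) t(3) by (simp add: power2_eq_square)
  moreover have "P h - P 0 = f (x + h *\<^sub>R u + h *\<^sub>R v) - f (x + h *\<^sub>R u) - f (x + h *\<^sub>R v) + f x"
    unfolding P_def by (simp add: algebra_simps)
  ultimately show ?thesis using that[of s t] s t by auto
qed

text \<open>The second difference over a parallelogram does not see the order of u and v, so the two
  mixed derivatives agree at two points near x; continuity brings this to x.\<close>

lemma D_D_sym_real:
  fixes f :: "real^'n \<Rightarrow> real"
  assumes S: "open S" and f: "smooth_on S f" and x: "x \<in> S"
  shows "D (\<lambda>y. D f y u) x v = D (\<lambda>y. D f y v) x u"
proof (rule ccontr)
  let ?A = "\<lambda>y. D (\<lambda>y. D f y u) y v" and ?B = "\<lambda>y. D (\<lambda>y. D f y v) y u"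
  assume ne: "?A x \<noteq> ?B x"
  define e where "e = \<bar>?A x - ?B x\<bar> / 2"
  have e: "e > 0" using ne by (simp add: e_def)
  have "continuous_on S ?A" "continuous_on S ?B"
    using f by (intro smooth_on_continuous smooth_on_D; assumption)+
  then have "isCont ?A x" "isCont ?B x" using S x continuous_on_eq_continuous_at by blast+
  then obtain d1 d2 where d: "d1 > 0" "d2 > 0" "\<And>y. dist y x < d1 \<Longrightarrow> dist (?A y) (?A x) < e"
      "\<And>y. dist y x < d2 \<Longrightarrow> dist (?B y) (?B x) < e"
    unfolding continuous_at_eps_delta using e by metis
  obtain d3 where d3: "d3 > 0" "ball x d3 \<subseteq> S" using S x open_contains_ball by blast
  define d where "d = min d1 (min d2 d3)"
  define N where "N = norm u + norm v + 1"
  \<comment> \<open>N exceeds the sum of the lengths of u and v, so every point of the parallelogram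
    has distance at most h N = d/2 from x.\<close>
  define h where "h = d / (2 * N)"
  have np: "N > 0" using norm_ge_zero[of u] norm_ge_zero[of v] unfolding N_def by linarith
  have dpos: "d > 0" using d d3 by (simp add: d_def)
  then have h: "h > 0" using np by (simp add: h_def)
  have near: "dist (x + s *\<^sub>R u + t *\<^sub>R v) x < d" if "s \<in> {0..h}" "t \<in> {0..h}" for s t
  proof -
    have "dist (x + s *\<^sub>R u + t *\<^sub>R v) x \<le> s * norm u + t * norm v"
      using norm_triangle_ineq[of "s *\<^sub>R u" "t *\<^sub>R v"] that by (simp add: dist_norm)
    also have "\<dots> \<le> h * norm u + h * norm v"
      using that by (intro add_mono mult_right_mono) auto
    also have "\<dots> \<le> h * N" using h by (simp add: N_def algebra_simps)
    also have "\<dots> = d / 2" using np by (simp add: h_def)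
    finally show ?thesis using dpos by simp
  qed
  have sub: "x + s *\<^sub>R u + t *\<^sub>R v \<in> S" if "s \<in> {0..h}" "t \<in> {0..h}" for s t
    using near[OF that] d3(2) by (auto simp: d_def dist_commute)
  obtain s t where st: "s \<in> {0..h}" "t \<in> {0..h}"
    "f (x + h *\<^sub>R u + h *\<^sub>R v) - f (x + h *\<^sub>R u) - f (x + h *\<^sub>R v) + f x = h^2 * ?A (x + s *\<^sub>R u + t *\<^sub>R v)"
    using mixed_difference_mean_value[OF S f h sub] by metis
  have sub': "x + s *\<^sub>R v + t *\<^sub>R u \<in> S" if "s \<in> {0..h}" "t \<in> {0..h}" for s t
    using sub[OF that(2,1)] by (simp add: algebra_simps)
  obtain s' t' where st': "s' \<in> {0..h}" "t' \<in> {0..h}"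
    "f (x + h *\<^sub>R v + h *\<^sub>R u) - f (x + h *\<^sub>R v) - f (x + h *\<^sub>R u) + f x = h^2 * ?B (x + s' *\<^sub>R v + t' *\<^sub>R u)"
    using mixed_difference_mean_value[OF S f h sub'] by metis
  \<comment> \<open>Both sides are the same second difference, once with u first and once with v
    first.\<close>
  have "h^2 * ?A (x + s *\<^sub>R u + t *\<^sub>R v) = h^2 * ?B (x + t' *\<^sub>R u + s' *\<^sub>R v)"
    using st(3) st'(3) by (simp add: algebra_simps)
  then have "?A (x + s *\<^sub>R u + t *\<^sub>R v) = ?B (x + t' *\<^sub>R u + s' *\<^sub>R v)" using h by simp
  moreover have "dist (?A (x + s *\<^sub>R u + t *\<^sub>R v)) (?A x) < e"
    using near[OF st(1,2)] by (intro d(3)) (simp add: d_def)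
  moreover have "dist (?B (x + t' *\<^sub>R u + s' *\<^sub>R v)) (?B x) < e"
    using near[OF st'(2,1)] by (intro d(4)) (simp add: d_def)
  ultimately show False unfolding e_def dist_real_def by (smt (verit) field_sum_of_halves)
qed

lemma D_D_sym:
  fixes f :: "real^'n \<Rightarrow> 'b::euclidean_space"
  assumes S: "open S" and f: "smooth_on S f" and x: "x \<in> S"
  shows "D (\<lambda>y. D f y u) x v = D (\<lambda>y. D f y v) x u"
proof -
  have *: "D (\<lambda>y. D f y u) x v \<bullet> b = D (\<lambda>y. D (\<lambda>z. f z \<bullet> b) y u) x v" for u v b
  proof -
    have "D (\<lambda>y. D f y u) x v \<bullet> b = D (\<lambda>y. D f y u \<bullet> b) x v"
      by (rule D_bounded_linear[OF bounded_linear_inner_left, symmetric])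
        (rule smooth_on_differentiable[OF smooth_on_D[OF f] S x])
    also have "\<dots> = D (\<lambda>y. D (\<lambda>z. f z \<bullet> b) y u) x v"
      by (subst D_cong[OF S x]) (auto simp: D_bounded_linear[OF bounded_linear_inner_left smooth_on_differentiable[OF f S]])
    finally show ?thesis .
  qed
  show ?thesis
  proof (rule euclidean_eqI)
    show "D (\<lambda>y. D f y u) x v \<bullet> b = D (\<lambda>y. D f y v) x u \<bullet> b" for b
      unfolding * by (rule D_D_sym_real[OF S smooth_on_bounded_linear[OF bounded_linear_inner_left S f] x])
  qed
qed

section \<open>Matrix calculus\<close>

text \<open>Makes the general product rules for \<open>D\<close> and \<open>Ck_on\<close> available
  for matrix products, with no index computation.\<close>

interpretation mm: bounded_bilinear "(**) :: real^'n^'m \<Rightarrow> real^'p^'n \<Rightarrow> real^'p^'m"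
proof -
  have "bilinear ((**) :: real^'n^'m \<Rightarrow> real^'p^'n \<Rightarrow> real^'p^'m)"
    unfolding bilinear_def
    by (auto intro!: linearI simp: matrix_matrix_mult_def vec_eq_iff sum.distrib sum_distrib_left algebra_simps)
  then show "bounded_bilinear ((**) :: real^'n^'m \<Rightarrow> real^'p^'n \<Rightarrow> real^'p^'m)"
    by (simp add: bilinear_conv_bounded_bilinear)
qed

interpretation mv: bounded_bilinear "(*v) :: real^'n^'m \<Rightarrow> real^'n \<Rightarrow> real^'m"
proof -
  have "bilinear ((*v) :: real^'n^'m \<Rightarrow> real^'n \<Rightarrow> real^'m)"
    unfolding bilinear_def
    by (auto intro!: linearI simp: matrix_vector_mult_def vec_eq_iff sum.distrib sum_distrib_left algebra_simps)
  then show "bounded_bilinear ((*v) :: real^'n^'m \<Rightarrow> real^'n \<Rightarrow> real^'m)"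
    by (simp add: bilinear_conv_bounded_bilinear)
qed

lemma bounded_linear_transpose: "bounded_linear (transpose :: real^'n^'m \<Rightarrow> real^'m^'n)"
  by (rule linear_conv_bounded_linear[THEN iffD1], rule linearI) (auto simp: transpose_def vec_eq_iff)

lemma bounded_linear_trace: "bounded_linear (trace :: real^'n^'n \<Rightarrow> real)"
  by (rule linear_conv_bounded_linear[THEN iffD1], rule linearI)
    (auto simp: trace_def sum.distrib sum_distrib_left)

lemma transpose_add: "transpose (A + B :: real^'n^'m) = transpose A + transpose B"
  and transpose_diff: "transpose (A - B :: real^'n^'m) = transpose A - transpose B"
  and transpose_minus: "transpose (- A :: real^'n^'m) = - transpose A"
  by (auto simp: transpose_def vec_eq_iff)

lemma trace_transpose: "trace (transpose A) = trace A"
  by (simp add: trace_def transpose_def)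

lemma inner_transpose:
  fixes A :: "real^'n^'m"
  shows "u \<bullet> (transpose A *v w) = (A *v u) \<bullet> w"
  using dot_lmul_matrix[of u "transpose A" w] transpose_matrix_vector[of "transpose A" u] by simp

lemma inner_matrix_vector_sym:
  fixes G :: "real^'n^'n"
  assumes "transpose G = G"
  shows "u \<bullet> (G *v w) = w \<bullet> (G *v u)"
  by (metis assms dot_lmul_matrix inner_commute transpose_matrix_vector)

section \<open>Smoothness and derivatives of inverse matrices and determinants\<close>

lemma matrix_inv_mult:
  fixes A :: "real^'n^'n"
  assumes "det A \<noteq> 0"
  shows "A ** matrix_inv A = mat 1" "matrix_inv A ** A = mat 1"
proof -
  have "\<exists>A'. A ** A' = mat 1 \<and> A' ** A = mat 1"
    using assms invertible_det_nz unfolding invertible_def by blast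
  then have "A ** matrix_inv A = mat 1 \<and> matrix_inv A ** A = mat 1"
    unfolding matrix_inv_def by (rule someI_ex)
  then show "A ** matrix_inv A = mat 1" "matrix_inv A ** A = mat 1" by auto
qed

lemma smooth_on_det:
  fixes A :: "real^'n \<Rightarrow> real^'m^'m"
  assumes "open S" "\<And>i j. smooth_on S (\<lambda>x. A x $ i $ j)"
  shows "smooth_on S (\<lambda>x. det (A x))"
  unfolding det_def
  by (intro smooth_on_sum smooth_on_mult smooth_on_const smooth_on_prod assms)

text \<open>Cramer's rule for the j-th column writes the entries of the inverse as polynomials over
  the determinant, which is where smoothness of the inverse comes from.\<close>

lemma matrix_inv_component:
  fixes A :: "real^'n^'n"
  assumes "det A \<noteq> 0"
  shows "matrix_inv A $ i $ j =
    det (\<chi> a b. if b = i then axis j 1 $ a else A $ a $ b) * inverse (det A)"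
proof -
  have "A *v (matrix_inv A *v axis j 1) = axis j 1"
    by (simp add: matrix_vector_mul_assoc matrix_inv_mult[OF assms])
  then have "matrix_inv A *v axis j 1 =
      (\<chi> k. det (\<chi> a b. if b = k then axis j 1 $ a else A $ a $ b) / det A)"
    using cramer[OF assms] by blast
  moreover have "(matrix_inv A *v axis j 1) $ i = matrix_inv A $ i $ j"
    by (simp add: matrix_vector_mult_basis column_def)
  ultimately show ?thesis by (simp add: divide_inverse)
qed

lemma smooth_on_matrix_inv:
  fixes A :: "real^'n \<Rightarrow> real^'m^'m"
  assumes S: "open S" and A: "smooth_on S A" and det: "\<And>x. x \<in> S \<Longrightarrow> det (A x) \<noteq> 0"
  shows "smooth_on S (\<lambda>x. matrix_inv (A x))"
proof (intro smooth_on_vec[OF S])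
  fix i j
  have c: "smooth_on S (\<lambda>x. A x $ i $ j)" for i j
    by (intro smooth_on_nth S A)
  have c': "smooth_on S (\<lambda>x. (\<chi> a b. if b = i then axis j 1 $ a else A x $ a $ b) $ k $ l)" for k l
    by (cases "l = i") (simp_all add: smooth_on_const c)
  have "smooth_on S (\<lambda>x. det (\<chi> a b. if b = i then axis j 1 $ a else A x $ a $ b) * inverse (det (A x)))"
    by (intro smooth_on_mult smooth_on_inverse smooth_on_det S c c' det)
  then show "smooth_on S (\<lambda>x. matrix_inv (A x) $ i $ j)"
    by (subst smooth_on_cong[OF S]) (simp_all add: matrix_inv_component det)
qed

text \<open>Differentiate \<open>matrix_inv (A x) ** A x = mat 1\<close> and multiply by the inverse
  from the right.\<close>

lemma D_matrix_inv:
  fixes A :: "real^'n \<Rightarrow> real^'m^'m"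
  assumes S: "open S" and A: "smooth_on S A" and det: "\<And>x. x \<in> S \<Longrightarrow> det (A x) \<noteq> 0" and x: "x \<in> S"
  shows "D (\<lambda>x. matrix_inv (A x)) x v = - (matrix_inv (A x) ** D A x v ** matrix_inv (A x))"
proof -
  have "0 = D (\<lambda>x. mat 1 :: real^'m^'m) x v" by simp
  also have "\<dots> = D (\<lambda>x. matrix_inv (A x) ** A x) x v"
    by (subst D_cong[OF S x, of _ "\<lambda>x. matrix_inv (A x) ** A x"]) (simp_all add: matrix_inv_mult det)
  also have "\<dots> = matrix_inv (A x) ** D A x v + D (\<lambda>x. matrix_inv (A x)) x v ** A x"
    by (intro D_bilinear[OF mm.bounded_bilinear_axioms] smooth_on_differentiable[OF _ S x] A smooth_on_matrix_inv S det)
  finally have "D (\<lambda>x. matrix_inv (A x)) x v ** A x = - (matrix_inv (A x) ** D A x v)"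
    by (simp add: eq_neg_iff_add_eq_0 add.commute)
  then have "D (\<lambda>x. matrix_inv (A x)) x v ** A x ** matrix_inv (A x) = - (matrix_inv (A x) ** D A x v) ** matrix_inv (A x)"
    by simp
  then show ?thesis
    by (simp add: matrix_mul_assoc[symmetric] matrix_inv_mult det x mm.minus_left)
qed

text \<open>In the Leibniz expansion a permutation other than the identity moves at least two
  indices. Even with one factor differentiated, a zero entry of the identity matrix remains, so only
  the diagonal term survives.\<close>

lemma has_derivative_det_at_id:
  fixes B :: "real^'n \<Rightarrow> real^'m^'m"
  assumes "B differentiable (at x)" "B x = mat 1"
  shows "((\<lambda>x. det (B x)) has_derivative (\<lambda>v. trace (D B x v))) (at x)"
proof -
  let ?P = "{p. p permutes (UNIV :: 'm set)}"
  let ?d = "\<lambda>v p. of_int (sign p) * (\<Sum>i\<in>UNIV. D B x v $ i $ p i * (\<Prod>j\<in>UNIV - {i}. B x $ j $ p j))"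
  have c: "((\<lambda>x. B x $ i $ j) has_derivative (\<lambda>v. D B x v $ i $ j)) (at x)" for i j
    using bounded_linear.has_derivative[OF bounded_linear_vec_nth
        bounded_linear.has_derivative[OF bounded_linear_vec_nth has_derivative_D[OF assms(1)]]] by simp
  have 1: "((\<lambda>x. det (B x)) has_derivative (\<lambda>v. \<Sum>p\<in>?P. ?d v p)) (at x)"
    unfolding det_def by (intro has_derivative_sum has_derivative_mult_right has_derivative_prod c)
  have "(\<Sum>p\<in>?P. ?d v p) = trace (D B x v)" for v
  proof -
    have z: "?d v p = 0" if p: "p \<in> ?P" "p \<noteq> id" for p
    proof -
      have zero: "(\<Prod>j\<in>UNIV - {i}. B x $ j $ p j) = 0" for i
      proof -
        obtain k where k: "p k \<noteq> k" using p(2) by (auto simp: fun_eq_iff)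
        have "inj p" using p(1) permutes_inj by auto
        \<comment> \<open>k and p k are two distinct points moved by p, and at least one of them
          differs from i.\<close>
        then have "p (p k) \<noteq> p k" using k by (auto dest: injD)
        then obtain j where "j \<noteq> i" "p j \<noteq> j" using k by metis
        then show ?thesis by (intro prod_zero) (auto simp: assms(2) mat_def intro!: bexI[of _ j])
      qed
      show ?thesis by (simp only: zero mult_zero_right sum.neutral_const)
    qed
    have "(\<Sum>p\<in>?P. ?d v p) = (\<Sum>p\<in>{id}. ?d v p)"
      by (rule sum.mono_neutral_right) (use z in \<open>auto simp: permutes_id\<close>)
    also have "\<dots> = trace (D B x v)"
      by (simp add: trace_def assms(2) mat_def)
    finally show ?thesis .
  qed
  with 1 show ?thesis by simp
qed

text \<open>Jacobi's formula, reduced to the identity matrix by splitting det (A x) off from det (A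
  y).\<close>

lemma has_derivative_det:
  fixes A :: "real^'n \<Rightarrow> real^'m^'m"
  assumes "A differentiable (at x)" "det (A x) \<noteq> 0"
  shows "((\<lambda>x. det (A x)) has_derivative (\<lambda>v. det (A x) * trace (matrix_inv (A x) ** D A x v))) (at x)"
proof -
  let ?B = "\<lambda>y. matrix_inv (A x) ** A y"
  have "?B differentiable (at x)"
    by (rule differentiable_bilinear[OF mm.bounded_bilinear_axioms _ assms(1)]) simp
  from has_derivative_det_at_id[OF this]
  have "((\<lambda>y. det (?B y)) has_derivative (\<lambda>v. trace (D ?B x v))) (at x)"
    by (simp add: matrix_inv_mult assms(2))
  moreover have "D ?B x v = matrix_inv (A x) ** D A x v" for v
    using D_bilinear[OF mm.bounded_bilinear_axioms _ assms(1), of "\<lambda>y. matrix_inv (A x)"] by simp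
  ultimately have "((\<lambda>y. det (A x) * det (?B y)) has_derivative (\<lambda>v. det (A x) * trace (matrix_inv (A x) ** D A x v))) (at x)"
    using has_derivative_mult_right by fastforce
  moreover have "det (A x) * det (?B y) = det (A y)" for y
    by (metis det_mul matrix_inv_mult(1)[OF assms(2)] matrix_mul_assoc matrix_mul_lid)
  ultimately show ?thesis by simp
qed

section \<open>Orthonormal bases of a positive definite form\<close>

lemma orthonormal_family_exists:
  fixes G :: "real^'n^'n"
  assumes sym: "transpose G = G" and pos: "\<And>u. u \<noteq> 0 \<Longrightarrow> 0 < u \<bullet> (G *v u)"
    and "k \<le> CARD('n)"
  shows "\<exists>e :: nat \<Rightarrow> real^'n. \<forall>i<k. \<forall>j<k. e i \<bullet> (G *v e j) = (if i = j then 1 else 0)"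
  using assms(3)
proof (induction k)
  case (Suc k)
  then obtain e :: "nat \<Rightarrow> real^'n" where e: "\<forall>i<k. \<forall>j<k. e i \<bullet> (G *v e j) = (if i = j then 1 else 0)"
    by auto
  have symm: "u \<bullet> (G *v w) = w \<bullet> (G *v u)" for u w
    by (metis dot_lmul_matrix inner_commute sym transpose_matrix_vector)
  \<comment> \<open>In place of Gram-Schmidt: fewer than n vectors G e_i span a proper subspace, and
    a Euclidean normal x of it is G-orthogonal to all e_i and only needs scaling.\<close>
  have "dim ((\<lambda>i. G *v e i) ` {..<k}) \<le> card ((\<lambda>i. G *v e i) ` {..<k})"
    by (rule dim_le_card') simp
  also have "\<dots> \<le> k" using card_image_le[of "{..<k}"] by simp
  also have "\<dots> < DIM(real^'n)" using Suc.prems by simp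
  finally obtain x where x: "x \<noteq> 0" "\<And>y. y \<in> span ((\<lambda>i. G *v e i) ` {..<k}) \<Longrightarrow> orthogonal x y"
    using orthogonal_to_subspace_exists by blast
  have ox: "x \<bullet> (G *v e i) = 0" if "i < k" for i
    using x(2)[of "G *v e i"] that by (auto simp: orthogonal_def intro: span_base)
  define c where "c = 1 / sqrt (x \<bullet> (G *v x))"
  have c: "c * (c * (x \<bullet> (G *v x))) = 1"
    using pos[OF x(1)] by (simp add: c_def field_simps flip: power2_eq_square)
  have "(e(k := c *\<^sub>R x)) i \<bullet> (G *v (e(k := c *\<^sub>R x)) j) = (if i = j then 1 else 0)" if "i < Suc k" "j < Suc k" for i j
    using that e ox symm[of "e i" x] c
    by (auto simp: mv.scaleR_right less_Suc_eq)
  then show ?case by blast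
qed simp

lemma orthonormal_basis_exists:
  fixes G :: "real^'n^'n"
  assumes "transpose G = G" "\<And>u. u \<noteq> 0 \<Longrightarrow> 0 < u \<bullet> (G *v u)"
  obtains e :: "'n \<Rightarrow> real^'n" where "\<And>i j. e i \<bullet> (G *v e j) = (if i = j then 1 else 0)"
proof -
  obtain e :: "nat \<Rightarrow> real^'n" where e: "\<forall>i<CARD('n). \<forall>j<CARD('n). e i \<bullet> (G *v e j) = (if i = j then 1 else 0)"
    using orthonormal_family_exists[OF assms order_refl] by blast
  obtain h :: "'n \<Rightarrow> nat" where h: "bij_betw h UNIV {0..<CARD('n)}"
    using ex_bij_betw_finite_nat[of "UNIV :: 'n set"] by auto
  then have "h i < CARD('n)" "h i = h j \<longleftrightarrow> i = j" for i j
    by (auto simp: bij_betw_def inj_eq)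
  then show ?thesis using e that[of "\<lambda>i. e (h i)"] by simp
qed

text \<open>With the e_i as columns of P the assumption reads
  \<open>transpose P ** (G ** P) = mat 1\<close>. Moving P to the other side gives
  \<open>P ** transpose P = matrix_inv G\<close>, and determinants give the sign.\<close>

lemma orthonormal_basis_gram:
  fixes G :: "real^'n^'n" and e :: "'n \<Rightarrow> real^'n"
  assumes e: "\<And>i j. e i \<bullet> (G *v e j) = (if i = j then 1 else 0)"
  shows "det G \<noteq> 0" "(\<Sum>i\<in>UNIV. e i $ k * e i $ l) = matrix_inv G $ k $ l"
    "transpose G = G \<Longrightarrow> det G > 0"
proof -
  define P :: "real^'n^'n" where "P = (\<chi> k i. e i $ k)"
  have P: "transpose P ** (G ** P) = mat 1"
    using e unfolding P_def
    by (simp add: vec_eq_iff matrix_matrix_mult_def transpose_def mat_def inner_vec_def matrix_vector_mult_def)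
  have "det P * det G * det P = 1"
    using arg_cong[OF P, of det] by (simp add: det_mul det_transpose mult.assoc)
  then show d: "det G \<noteq> 0" by auto
  have "(det P)\<^sup>2 * det G = 1" using \<open>det P * det G * det P = 1\<close> by (simp add: power2_eq_square ac_simps)
  then show "det G > 0" by (metis zero_less_mult_pos zero_less_one zero_less_power2 mult_zero_left power_zero_numeral zero_neq_one)
  have "G ** P ** transpose P = mat 1"
    using P matrix_left_right_inverse by blast
  then have "matrix_inv G ** (G ** (P ** transpose P)) = matrix_inv G"
    by (simp add: matrix_mul_assoc)
  then have "P ** transpose P = matrix_inv G"
    by (simp add: matrix_mul_assoc matrix_inv_mult d)
  then have "(P ** transpose P) $ k $ l = matrix_inv G $ k $ l" by simp
  then show "(\<Sum>i\<in>UNIV. e i $ k * e i $ l) = matrix_inv G $ k $ l"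
    by (simp add: P_def matrix_matrix_mult_def transpose_def)
qed

lemmas matrix_algebra = mm.add_left mm.add_right mm.diff_left mm.diff_right mm.minus_left mm.minus_right
  matrix_transpose_mul transpose_add transpose_diff transpose_minus transpose_transpose matrix_mul_assoc

lemma smooth_on_mm:
  "open S \<Longrightarrow> smooth_on S A \<Longrightarrow> smooth_on S B \<Longrightarrow> smooth_on S (\<lambda>x. (A x :: real^'n^'m) ** (B x :: real^'p^'n))"
  by (rule smooth_on_bilinear[OF mm.bounded_bilinear_axioms])

lemma smooth_on_mv:
  "open S \<Longrightarrow> smooth_on S A \<Longrightarrow> smooth_on S u \<Longrightarrow> smooth_on S (\<lambda>x. (A x :: real^'n^'m) *v u x)"
  by (rule smooth_on_bilinear[OF mv.bounded_bilinear_axioms])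

lemma smooth_on_transpose:
  "open S \<Longrightarrow> smooth_on S A \<Longrightarrow> smooth_on S (\<lambda>x. transpose (A x :: real^'n^'m))"
  by (rule smooth_on_bounded_linear[OF bounded_linear_transpose])

lemma smooth_on_inner:
  "open S \<Longrightarrow> smooth_on S f \<Longrightarrow> smooth_on S g \<Longrightarrow> smooth_on S (\<lambda>x. f x \<bullet> g x)"
  by (rule smooth_on_bilinear[OF bounded_bilinear_inner])

lemma smooth_on_trace:
  "open S \<Longrightarrow> smooth_on S A \<Longrightarrow> smooth_on S (\<lambda>x. trace (A x :: real^'n^'n))"
  by (rule smooth_on_bounded_linear[OF bounded_linear_trace])

section \<open>Bump functions, compactly supported derivatives, change of variables\<close>

text \<open>The usual flat function exp (-1/t) is the member n = 0. The extra powers of 1/t close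
  the family under differentiation: the derivative combines the members n + 1 and n + 2.\<close>

definition expdecay :: "nat \<Rightarrow> real \<Rightarrow> real" where
  "expdecay n t = (if t > 0 then exp (- inverse t) * inverse t ^ n else 0)"

text \<open>With s = 1/t, one term of the exponential series bounds s^(n+2) by (n+2)! exp s. A
  quadratic bound in t is what the difference quotient at 0 needs.\<close>

lemma expdecay_le: "\<bar>expdecay n t\<bar> \<le> fact (n + 2) * t\<^sup>2"
proof (cases "t > 0")
  case True
  define s where "s = inverse t"
  have s: "s > 0" using True by (simp add: s_def)
  have "s ^ (n + 2) / fact (n + 2) \<le> exp s"
  proof -
    have "(\<Sum>k\<in>{n+2}. s ^ k /\<^sub>R fact k) \<le> (\<Sum>k. s ^ k /\<^sub>R fact k)"
      by (rule sum_le_suminf[OF summable_exp_generic]) (use s in auto)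
    then show ?thesis by (simp add: exp_def divide_inverse mult.commute)
  qed
  then have "s ^ n * s\<^sup>2 \<le> fact (n + 2) * exp s"
    by (simp only: divide_le_eq fact_gt_zero if_True power_add mult.commute[of "exp s"])
  then have "s ^ n / exp s \<le> fact (n + 2) / s\<^sup>2"
    using s by (subst frac_le_eq, simp, simp) (auto intro!: divide_nonpos_pos)
  moreover have "fact (n + 2) / s\<^sup>2 = fact (n + 2) * t\<^sup>2"
    by (simp only: s_def power_inverse divide_inverse inverse_inverse_eq)
  moreover have "\<bar>expdecay n t\<bar> = s ^ n / exp s"
    using True s by (simp add: expdecay_def s_def[symmetric] exp_minus divide_inverse)
  ultimately show ?thesis by linarith
qed (simp add: expdecay_def)

lemma has_derivative_expdecay:
  "(expdecay n has_real_derivative (expdecay (n + 2) t - real n * expdecay (n + 1) t)) (at t)"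
proof -
  consider "t > 0" | "t < 0" | "t = 0" by linarith
  then show ?thesis
  proof cases
    case 1
    have "((\<lambda>t. exp (- inverse t) * inverse t ^ n) has_real_derivative
        (expdecay (n + 2) t - real n * expdecay (n + 1) t)) (at t)"
    proof (cases n)
      case 0
      then show ?thesis
        using 1 by (auto intro!: derivative_eq_intros simp: expdecay_def power2_eq_square)
    next
      case (Suc m)
      have "((\<lambda>t. exp (- inverse t)) has_real_derivative exp (- inverse t) * (inverse t * inverse t)) (at t)"
        using 1 by (auto intro!: derivative_eq_intros)
      note * = DERIV_mult'[OF this DERIV_power_Suc[OF DERIV_inverse[of t], of m]]
      show ?thesis
        using * 1 by (simp add: Suc expdecay_def algebra_simps)
    qed
    then show ?thesis
      by (rule has_field_derivative_transform_within_open[of _ _ _ "{0<..}"]) (use 1 in \<open>auto simp: expdecay_def\<close>)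
  next
    case 2
    have "((\<lambda>t. 0) has_real_derivative (expdecay (n + 2) t - real n * expdecay (n + 1) t)) (at t)"
      using 2 by (simp add: expdecay_def)
    then show ?thesis
      by (rule has_field_derivative_transform_within_open[of _ _ _ "{..<0}"]) (use 2 in \<open>auto simp: expdecay_def\<close>)
  next
    case 3
    \<comment> \<open>The quadratic bound makes the difference quotient at 0 at most a multiple of
      |s|, so the flat function glues to 0 with derivative 0.\<close>
    have "((\<lambda>s. expdecay n s / s) \<longlongrightarrow> 0) (at 0)"
    proof (rule Lim_null_comparison)
      show "\<forall>\<^sub>F s in at 0. norm (expdecay n s / s) \<le> fact (n + 2) * \<bar>s\<bar>"
      proof (intro always_eventually allI)
        fix s
        define c :: real where "c = fact (n + 2)"
        have "\<bar>expdecay n s\<bar> \<le> (c * \<bar>s\<bar>) * \<bar>s\<bar>"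
          using expdecay_le[of n s, folded c_def] by (simp add: power2_eq_square mult.assoc)
        then have "norm (expdecay n s / s) \<le> c * \<bar>s\<bar>"
          by (cases "s = 0") (simp_all add: divide_le_eq)
        then show "norm (expdecay n s / s) \<le> fact (n + 2) * \<bar>s\<bar>" by (simp only: c_def)
      qed
      show "((\<lambda>s. fact (n + 2) * \<bar>s\<bar>) \<longlongrightarrow> (0::real)) (at 0)"
        by (auto intro!: tendsto_eq_intros)
    qed
    then show ?thesis
      using 3 by (simp add: has_field_derivative_iff expdecay_def[of _ 0])
  qed
qed

text \<open>Induction on k with n arbitrary, since every derivative raises n.\<close>

lemma Ck_on_expdecay:
  fixes q :: "real^'n \<Rightarrow> real"
  assumes q: "smooth_on UNIV q"
  shows "Ck_on k UNIV (\<lambda>x. expdecay n (q x))"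
proof (induction k arbitrary: n)
  have dq: "q differentiable (at x)" for x
    by (rule smooth_on_differentiable[OF q]) auto
  have der: "((\<lambda>x. expdecay n (q x)) has_derivative
      (\<lambda>v. (expdecay (n + 2) (q x) - real n * expdecay (n + 1) (q x)) * D q x v)) (at x)" for n x
    using diff_chain_at[OF has_derivative_D[OF dq] has_derivative_expdecay[THEN has_field_derivative_imp_has_derivative]]
    by (simp add: o_def)
  {
    case 0
    show ?case
      by (auto intro!: continuous_at_imp_continuous_on has_derivative_continuous[OF der])
  next
    case (Suc k)
    have Dq: "Ck_on k UNIV (\<lambda>x. D q x v)" for v
      using smooth_on_D[OF q] by (simp add: smooth_on_def)
    note mult = Ck_on_bilinear[OF bounded_bilinear_mult open_UNIV]
    have "Ck_on k UNIV (\<lambda>x. (expdecay (n + 2) (q x) + (- real n) * expdecay (n + 1) (q x)) * D q x v)" for v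
      by (intro mult Ck_on_add open_UNIV Suc.IH Dq Ck_on_const)
    moreover have "D (\<lambda>x. expdecay n (q x)) x v = (expdecay (n + 2) (q x) + (- real n) * expdecay (n + 1) (q x)) * D q x v" for x v
      by (subst D_eqI[OF der]) simp
    ultimately show ?case
      using der by (auto intro!: differentiable_on_openI differentiableI)
  }
qed

lemma bump_function_exists:
  fixes p :: "real^'n"
  assumes "r > 0"
  obtains b :: "real^'n \<Rightarrow> real" where "smooth_on UNIV b" "\<And>x. 0 \<le> b x" "b p > 0" "\<And>x. dist p x \<ge> r \<Longrightarrow> b x = 0"
proof
  \<comment> \<open>Positive exactly inside the ball of radius r around p.\<close>
  let ?q = "\<lambda>x. r\<^sup>2 - (x - p) \<bullet> (x - p)"
  have "smooth_on UNIV ?q"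
    by (intro smooth_on_diff smooth_on_inner smooth_on_const smooth_on_id open_UNIV)
  then show "smooth_on UNIV (\<lambda>x. expdecay 0 (?q x))"
    by (simp add: smooth_on_def Ck_on_expdecay)
  show "0 \<le> expdecay 0 (?q x)" for x by (simp add: expdecay_def)
  show "expdecay 0 (?q p) > 0" using assms by (simp add: expdecay_def)
  show "expdecay 0 (?q x) = 0" if "dist p x \<ge> r" for x
  proof -
    have "r\<^sup>2 \<le> (x - p) \<bullet> (x - p)"
      using power_mono[OF that] assms by (simp add: dist_norm norm_minus_commute dot_square_norm)
    then show ?thesis by (simp add: expdecay_def)
  qed
qed

section \<open>Integrals of derivatives of compactly supported functions\<close>

lemma integral_D_compact_support:
  fixes f :: "real^'n \<Rightarrow> real"
  assumes f: "\<And>x. f differentiable (at x)" and Df: "continuous_on UNIV (\<lambda>x. D f x v)"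
    and supp: "\<And>x. norm x \<ge> R \<Longrightarrow> f x = 0"
  shows "integrable lborel (\<lambda>x. D f x v)" "integral\<^sup>L lborel (\<lambda>x. D f x v) = 0"
proof -
  \<comment> \<open>The radius is enlarged by \<open>norm v\<close>, so that outside B both f x and
    the translates f (x + t v) with t in [0, 1] vanish and all difference quotients below live on
    B.\<close>
  define B where "B = cball (0::real^'n) (\<bar>R\<bar> + norm v + 1)"
  have "compact B" by (simp add: B_def)
  have fc: "continuous_on UNIV f"
    by (intro continuous_at_imp_continuous_on) (auto intro: differentiable_imp_continuous_within f)
  have f0: "f x = 0" "f (x + t *\<^sub>R v) = 0" if "x \<notin> B" "0 \<le> t" "t \<le> 1" for x t
  proof -
    have x: "\<bar>R\<bar> + norm v + 1 < norm x" using that by (simp add: B_def)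
    then show "f x = 0" using norm_ge_zero[of v] by (intro supp) linarith
    have "norm (t *\<^sub>R v) \<le> norm v" using that by (simp add: mult_left_le_one_le)
    moreover have "norm x \<le> norm (x + t *\<^sub>R v) + norm (t *\<^sub>R v)" using norm_triangle_ineq4[of "x + t *\<^sub>R v" "t *\<^sub>R v"] by simp
    ultimately show "f (x + t *\<^sub>R v) = 0" using x by (intro supp) linarith
  qed
  have Df0: "D f x v = 0" if "x \<notin> B" for x
  proof -
    have "D f x = D (\<lambda>x. 0) x"
      by (rule D_cong[of "- B"]) (use that f0(1)[of _ 0] in \<open>auto simp: B_def open_Compl\<close>)
    then show ?thesis by simp
  qed
  have B_int: "integrable lborel g" if "continuous_on UNIV g" "\<And>x. x \<notin> B \<Longrightarrow> g x = 0" for g :: "real^'n \<Rightarrow> real"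
  proof -
    have "integrable lborel (\<lambda>x. indicator B x *\<^sub>R g x)"
      by (rule borel_integrable_compact[OF \<open>compact B\<close>]) (use that continuous_on_subset in blast)
    moreover have "(\<lambda>x. indicator B x *\<^sub>R g x) = g" using that(2) by (auto simp: indicator_def fun_eq_iff)
    ultimately show ?thesis by simp
  qed
  show int: "integrable lborel (\<lambda>x. D f x v)" by (rule B_int[OF Df Df0])
  have fi: "integrable lborel f" by (rule B_int[OF fc f0(1)[of _ 0]]) auto
  obtain C where C: "\<And>x. x \<in> B \<Longrightarrow> \<bar>D f x v\<bar> \<le> C"
  proof -
    have "compact ((\<lambda>x. D f x v) ` B)"
      by (rule compact_continuous_image[OF continuous_on_subset[OF Df] \<open>compact B\<close>]) auto
    then have "bounded ((\<lambda>x. D f x v) ` B)" by (rule compact_imp_bounded)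
    then show ?thesis using that unfolding bounded_iff by auto
  qed
  have C': "\<bar>D f x v\<bar> \<le> \<bar>C\<bar>" for x using C[of x] Df0[of x] by (cases "x \<in> B") auto
  define t where "t m = inverse (real (Suc m))" for m
  have t: "0 < t m" "t m \<le> 1" for m by (auto simp: t_def field_simps)
  define F where "F m x = (f (x + t m *\<^sub>R v) - f x) / t m" for m x
  have shift: "integrable lborel (\<lambda>x. f (x + c))" "integral\<^sup>L lborel (\<lambda>x. f (x + c)) = integral\<^sup>L lborel f" for c
  proof -
    have m: "(+) c \<in> measurable lborel borel" "f \<in> borel_measurable borel"
      using fi by (auto simp: borel_measurable_integrable)
    show "integrable lborel (\<lambda>x. f (x + c))"
      using integrable_distr_eq[OF m] fi by (simp add: lborel_distr_plus add.commute)
    show "integral\<^sup>L lborel (\<lambda>x. f (x + c)) = integral\<^sup>L lborel f"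
      using integral_distr[OF m] by (simp add: lborel_distr_plus add.commute)
  qed
  \<comment> \<open>By translation invariance of Lebesgue measure every difference quotient
    integrates to 0; dominated convergence carries this over to the derivative.\<close>
  have F0: "integral\<^sup>L lborel (F m) = 0" for m
    unfolding F_def using shift fi by simp
  note der = has_real_derivative_along_line[OF f]
  have "(\<lambda>m. integral\<^sup>L lborel (F m)) \<longlonglongrightarrow> integral\<^sup>L lborel (\<lambda>x. D f x v)"
  proof (rule integral_dominated_convergence[where w = "\<lambda>x. \<bar>C\<bar> * indicator B x"])
    show "(\<lambda>x. D f x v) \<in> borel_measurable lborel" using int by (rule borel_measurable_integrable)
    show "F m \<in> borel_measurable lborel" for m
      unfolding F_def using shift(1) fi by (intro borel_measurable_integrable) auto
    have "emeasure lborel B < \<infinity>" using \<open>compact B\<close> by (rule emeasure_compact_finite)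
    then show "integrable lborel (\<lambda>x. \<bar>C\<bar> * indicator B x)"
      using \<open>compact B\<close> by (intro integrable_mult_right integrable_real_indicator) (auto intro: borel_compact)
    show "AE x in lborel. (\<lambda>m. F m x) \<longlonglongrightarrow> D f x v"
    proof (rule AE_I2)
      fix x
      have "((\<lambda>s. (f (x + s *\<^sub>R v) - f x) / s) \<longlongrightarrow> D f x v) (at 0)"
        using der[where a = x and s = 0 and w = v] by (simp add: has_field_derivative_iff)
      moreover have "filterlim t (at 0) sequentially"
        unfolding filterlim_at using t LIMSEQ_inverse_real_of_nat by (auto simp: t_def[abs_def] intro!: always_eventually)
      ultimately show "(\<lambda>m. F m x) \<longlonglongrightarrow> D f x v"
        unfolding F_def by (rule filterlim_compose)
    qed
    show "AE x in lborel. norm (F m x) \<le> \<bar>C\<bar> * indicator B x" for m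
    proof (rule AE_I2)
      fix x
      show "norm (F m x) \<le> \<bar>C\<bar> * indicator B x"
      proof (cases "x \<in> B")
        case False
        then show ?thesis using f0[OF False, of "t m"] t[of m] by (simp add: F_def)
      next
        case True
        obtain s where "f (x + t m *\<^sub>R v) - f (x + 0 *\<^sub>R v) = (t m - 0) * D f (x + s *\<^sub>R v) v"
          using MVT2[OF t(1)[of m] der] by blast
        then have "F m x = D f (x + s *\<^sub>R v) v" using t(1)[of m] by (simp add: F_def)
        then show ?thesis using C' True by simp
      qed
    qed
  qed
  then show "integral\<^sup>L lborel (\<lambda>x. D f x v) = 0"
    by (simp add: F0 LIMSEQ_const_iff)
qed

text \<open>The extension of f by zero is smooth on the whole space, because \<Omega> and the
  complement of K are open and cover it.\<close>

lemma integral_D_smooth_compact_support: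
  fixes f :: "real^'n \<Rightarrow> real"
  assumes \<Omega>: "open \<Omega>" and f: "smooth_on \<Omega> f" and K: "compact K" "K \<subseteq> \<Omega>"
    and supp: "\<And>x. x \<in> \<Omega> - K \<Longrightarrow> f x = 0"
  shows "integrable lborel (\<lambda>x. indicator \<Omega> x * D f x v)" "integral\<^sup>L lborel (\<lambda>x. indicator \<Omega> x * D f x v) = 0"
proof -
  define g where "g x = (if x \<in> \<Omega> then f x else 0)" for x
  have oK: "open (- K)" using K(1) compact_imp_closed by blast
  have g: "smooth_on UNIV g"
  proof (rule smooth_on_local)
    fix x
    show "\<exists>T. open T \<and> x \<in> T \<and> smooth_on T g"
    proof (cases "x \<in> \<Omega>")
      case True
      have "smooth_on \<Omega> g" by (subst smooth_on_cong[OF \<Omega>, of g f]) (auto simp: g_def f)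
      then show ?thesis using \<Omega> True by blast
    next
      case False
      have "smooth_on (- K) g"
        by (subst smooth_on_cong[OF oK, of g "\<lambda>x. 0"]) (use supp in \<open>auto simp: g_def smooth_on_const\<close>)
      then show ?thesis using oK False K(2) by blast
    qed
  qed
  obtain R where R: "\<And>x. x \<in> K \<Longrightarrow> norm x \<le> R" using compact_imp_bounded[OF K(1)] by (auto simp: bounded_iff)
  have z: "g x = 0" if "norm x \<ge> R + 1" for x
    using that R[of x] supp[of x] by (auto simp: g_def)
  have Dg: "D g x v = indicator \<Omega> x * D f x v" for x
  proof (cases "x \<in> \<Omega>")
    case True
    have "D g x = D f x" by (rule D_cong[OF \<Omega> True]) (simp add: g_def)
    then show ?thesis using True by simp
  next
    case False
    have "D g x = D (\<lambda>x. 0) x" by (rule D_cong[OF oK]) (use False K supp in \<open>auto simp: g_def\<close>)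
    then show ?thesis using False by simp
  qed
  note * = integral_D_compact_support[OF smooth_on_differentiable[OF g open_UNIV UNIV_I] smooth_on_continuous[OF smooth_on_D[OF g]] z]
  show "integrable lborel (\<lambda>x. indicator \<Omega> x * D f x v)" "integral\<^sup>L lborel (\<lambda>x. indicator \<Omega> x * D f x v) = 0"
    using *[where v = v] by (simp_all add: Dg)
qed

section \<open>Change of variables for nonnegative functions\<close>

lemma nn_integral_change_of_variables_wellorder:
  fixes T :: "real^'m::{finite,wellorder} \<Rightarrow> real^'m::_" and f :: "real^'m::_ \<Rightarrow> real"
  assumes S: "S \<in> sets borel" and T: "\<And>x. x \<in> S \<Longrightarrow> T differentiable (at x)" and inj: "inj_on T S"
    and nonneg: "\<And>x. x \<in> S \<Longrightarrow> 0 \<le> f (T x)"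
    and m1: "(\<lambda>y. indicator (T ` S) y * f y) \<in> borel_measurable borel"
    and m2: "(\<lambda>x. indicator S x * (\<bar>det (matrix (D T x))\<bar> * f (T x))) \<in> borel_measurable borel"
  shows "(\<integral>\<^sup>+y. ennreal (indicator (T ` S) y * f y) \<partial>lborel)
      = (\<integral>\<^sup>+x. ennreal (indicator S x * (\<bar>det (matrix (D T x))\<bar> * f (T x))) \<partial>lborel)"
proof -
  let ?g = "\<lambda>x. \<bar>det (matrix (D T x))\<bar> * f (T x)"
  have "S \<in> sets lebesgue" using S by simp
  moreover have "(T has_derivative D T x) (at x within S)" if "x \<in> S" for x
    using has_derivative_D[OF T[OF that]] has_derivative_at_withinI by blast
  \<comment> \<open>The theorem on absolute integrals is about vector-valued maps;
    \<open>vec\<close> into \<open>real^1\<close> makes it scalar, and the free b lets it transport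
    the integral together with integrability.\<close>
  ultimately have cov: "(?g absolutely_integrable_on S \<and> integral S ?g = b)
     \<longleftrightarrow> (f absolutely_integrable_on (T ` S) \<and> integral (T ` S) f = b)" for b
    using has_absolute_integral_change_of_variables[of S T "D T" "\<lambda>x. vec (f x) :: real^1" "vec b"] inj
    by (simp add: absolutely_integrable_on_1_iff integral_on_1_eq)
  \<comment> \<open>For a nonnegative function the extended integral is infinite precisely when
    absolute integrability fails, so \<open>cov\<close> settles the finite and the infinite case
    together.\<close>
  have key: "(\<integral>\<^sup>+x. ennreal (indicator A x * h x) \<partial>lborel) =
      (if h absolutely_integrable_on A then ennreal (integral A h) else \<infinity>)"
    if m: "(\<lambda>x. indicator A x * h x) \<in> borel_measurable borel" and p: "\<And>x. x \<in> A \<Longrightarrow> 0 \<le> h x"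
    for A and h :: "real^'m::_ \<Rightarrow> real"
  proof (cases "h absolutely_integrable_on A")
    case True
    then have i: "integrable lebesgue (\<lambda>x. indicator A x * h x)" by (simp add: set_integrable_def)
    have "(\<integral>\<^sup>+x. ennreal (indicator A x * h x) \<partial>lebesgue) = ennreal (integral\<^sup>L lebesgue (\<lambda>x. indicator A x * h x))"
      by (rule nn_integral_eq_integral[OF i]) (auto simp: indicator_def p)
    then show ?thesis
      using True set_lebesgue_integral_eq_integral(2)[OF True]
      by (simp add: nn_integral_completion set_lebesgue_integral_def)
  next
    case False
    have "\<not> integrable lebesgue (\<lambda>x. indicator A x * h x)" using False by (simp add: set_integrable_def)
    then have "\<not> (\<integral>\<^sup>+x. ennreal (indicator A x * h x) \<partial>lebesgue) < \<infinity>"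
      using integrableI_nonneg[of "\<lambda>x. indicator A x * h x" lebesgue] m p
      by (auto simp: indicator_def measurable_completion)
    then show ?thesis using False by (simp add: nn_integral_completion not_less top_unique)
  qed
  show ?thesis
    by (subst key[OF m1], use nonneg in force, subst key[OF m2], use nonneg in force) (use cov[of "integral (T ` S) f"] cov[of "integral S ?g"] in auto)
qed

text \<open>The change of variables theorem of the library needs a well-ordered index type; a copy of the
  index type that is ordered through an enumeration provides one.\<close>

typedef 'n wellordered = "UNIV :: 'n set" by simp

lemma bij_Rep_wellordered: "bij Rep_wellordered"
  by (metis Abs_wellordered_inverse Rep_wellordered_inverse UNIV_I bijI')

instance wellordered :: (finite) finite
proof
  have "finite (Rep_wellordered -` (UNIV :: 'a set))"
    by (rule finite_vimageI) (use bij_Rep_wellordered in \<open>auto simp: bij_def\<close>)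
  then show "finite (UNIV :: 'a wellordered set)" by simp
qed

instantiation wellordered :: (finite) wellorder
begin

definition less_eq_wellordered :: "'a wellordered \<Rightarrow> 'a wellordered \<Rightarrow> bool" where
  "less_eq_wellordered x y \<longleftrightarrow> to_nat_on UNIV (Rep_wellordered x) \<le> to_nat_on UNIV (Rep_wellordered y)"

definition less_wellordered :: "'a wellordered \<Rightarrow> 'a wellordered \<Rightarrow> bool" where
  "less_wellordered x y \<longleftrightarrow> to_nat_on UNIV (Rep_wellordered x) < to_nat_on UNIV (Rep_wellordered y)"

instance
proof
  fix x y z :: "'a wellordered"
  have inj: "inj (to_nat_on (UNIV :: 'a set))"
    using inj_on_to_nat_on[OF countable_finite[OF finite]] .
  show "x \<le> y \<Longrightarrow> y \<le> x \<Longrightarrow> x = y"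
    unfolding less_eq_wellordered_def using inj by (auto simp: inj_eq Rep_wellordered_inject)
  show "P x" if "\<And>x. (\<And>y. y < x \<Longrightarrow> P y) \<Longrightarrow> P x" for P and x :: "'a wellordered"
    by (induction "to_nat_on UNIV (Rep_wellordered x)" arbitrary: x rule: less_induct)
      (use that in \<open>auto simp: less_wellordered_def\<close>)
qed (auto simp: less_eq_wellordered_def less_wellordered_def)

end

definition to_wo :: "real^'n \<Rightarrow> real^'n wellordered" where "to_wo x = (\<chi> i. x $ Rep_wellordered i)"
definition from_wo :: "real^'n wellordered \<Rightarrow> real^'n" where "from_wo y = (\<chi> i. y $ Abs_wellordered i)"

lemma from_wo_to_wo [simp]: "from_wo (to_wo x) = x" and to_wo_from_wo [simp]: "to_wo (from_wo y) = y"
  by (simp_all add: from_wo_def to_wo_def Abs_wellordered_inverse Rep_wellordered_inverse)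

lemma bounded_linear_to_wo: "bounded_linear to_wo" and bounded_linear_from_wo: "bounded_linear from_wo"
  by (rule linear_conv_bounded_linear[THEN iffD1], rule linearI, simp_all add: to_wo_def from_wo_def vec_eq_iff)+

lemma prod_Basis_vec: "(\<Prod>b\<in>Basis. f b) = (\<Prod>i\<in>UNIV. f (axis i 1 :: real^'n))"
proof -
  have "(Basis :: (real^'n) set) = range (\<lambda>i. axis i 1)" by (auto simp: Basis_vec_def)
  moreover have inj: "inj (\<lambda>i::'n. axis i (1::real))" by (auto intro!: injI simp: axis_eq_axis)
  ultimately show ?thesis using prod.reindex[OF inj, of f] by (simp add: o_def)
qed

text \<open>Lebesgue measure is determined by its values on boxes, and relabelling coordinates only
  permutes the factors in the product of side lengths.\<close>

lemma distr_lborel_to_wo: "distr lborel borel (to_wo :: real^'n \<Rightarrow> real^'n wellordered) = lborel"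
proof (rule lborel_eqI[symmetric])
  have m: "to_wo \<in> measurable lborel borel"
    using borel_measurable_continuous_onI[OF linear_continuous_on[OF bounded_linear_to_wo]] by simp
  fix l u :: "real^'n wellordered"
  assume lu: "\<And>b. b \<in> Basis \<Longrightarrow> l \<bullet> b \<le> u \<bullet> b"
  have le: "l $ i \<le> u $ i" for i using lu[of "axis i 1"] by (simp add: inner_axis)
  have b: "bij (Abs_wellordered :: 'n \<Rightarrow> 'n wellordered)"
    by (metis Abs_wellordered_inverse Rep_wellordered_inverse UNIV_I bijI')
  have "to_wo -` box l u = box (from_wo l) (from_wo u)"
  proof -
    have "(\<forall>i. l $ i < to_wo x $ i \<and> to_wo x $ i < u $ i) \<longleftrightarrow> (\<forall>i. from_wo l $ i < x $ i \<and> x $ i < from_wo u $ i)" for x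
      unfolding to_wo_def from_wo_def vec_lambda_beta
      by (metis Abs_wellordered_inverse Rep_wellordered_inverse UNIV_I)
    then show ?thesis by (auto simp: mem_box_cart)
  qed
  then have "emeasure (distr lborel borel to_wo) (box l u) = emeasure lborel (box (from_wo l) (from_wo u))"
    by (subst emeasure_distr[OF m]) simp_all
  also have "\<dots> = (\<Prod>b\<in>Basis. (from_wo u - from_wo l) \<bullet> b)"
    by (rule emeasure_lborel_box) (auto simp: Basis_vec_def inner_axis from_wo_def le)
  also have "(\<Prod>b\<in>Basis. (from_wo u - from_wo l) \<bullet> b) = (\<Prod>i\<in>UNIV. (u - l) $ Abs_wellordered i)"
    by (simp add: prod_Basis_vec inner_axis from_wo_def)
  also have "\<dots> = (\<Prod>i\<in>UNIV. (u - l) $ i)"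
    using prod.reindex_bij_betw[OF b] .
  also have "\<dots> = (\<Prod>b\<in>Basis. (u - l) \<bullet> b)"
    by (simp add: prod_Basis_vec inner_axis)
  finally show "emeasure (distr lborel borel to_wo) (box l u) = ennreal (\<Prod>b\<in>Basis. (u - l) \<bullet> b)" .
qed simp

text \<open>Conjugation by the relabelling is a sign-preserving bijection between the two
  permutation groups, so the Leibniz sums match term by term.\<close>

lemma det_reindex_wellordered:
  fixes A :: "real^'n^'n"
  shows "det (\<chi> i j. A $ Rep_wellordered i $ Rep_wellordered j) = det A"
proof -
  let ?q = "Rep_wellordered :: 'n wellordered \<Rightarrow> 'n"
  let ?m = "map_permutation UNIV ?q"
  have q: "bij_betw ?q UNIV UNIV" and inj: "inj ?q" using bij_Rep_wellordered by (auto simp: bij_def)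
  have bij: "bij_betw ?m {p. p permutes UNIV} {p. p permutes UNIV}"
  proof (rule bij_betw_byWitness[where f' = "map_permutation UNIV Abs_wellordered"], safe)
    have q': "bij_betw (Abs_wellordered :: 'n \<Rightarrow> 'n wellordered) UNIV UNIV"
      by (metis Abs_wellordered_inverse Rep_wellordered_inverse UNIV_I bijI')
    show "map_permutation UNIV Abs_wellordered (?m p) = p" if "p permutes UNIV" for p
      by (rule map_permutation_compose_inv[OF q that]) (simp add: Rep_wellordered_inverse)
    show "?m (map_permutation UNIV Abs_wellordered p) = p" if "p permutes UNIV" for p
      by (rule map_permutation_compose_inv[OF q' that]) (simp add: Abs_wellordered_inverse)
    show "?m p permutes UNIV" if "p permutes UNIV" for p
      by (rule map_permutation_permutes[OF q that])
    show "map_permutation UNIV (Abs_wellordered :: 'n \<Rightarrow> 'n wellordered) p permutes UNIV" if "p permutes UNIV" for p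
      by (rule map_permutation_permutes[OF q' that])
  qed
  have "det A = (\<Sum>p\<in>{p. p permutes UNIV}. of_int (sign (?m p)) * (\<Prod>i\<in>UNIV. A $ i $ ?m p i))"
    unfolding det_def by (rule sum.reindex_bij_betw[OF bij, symmetric])
  also have "\<dots> = (\<Sum>p\<in>{p. p permutes UNIV}. of_int (sign p) * (\<Prod>i\<in>UNIV. A $ ?q i $ ?q (p i)))"
  proof (intro sum.cong refl arg_cong2[where f = "(*)"])
    fix p :: "'n wellordered \<Rightarrow> 'n wellordered" assume p: "p \<in> {p. p permutes UNIV}"
    show "of_int (sign (?m p)) = (of_int (sign p) :: real)"
      using sign_map_permutation[OF inj, of p] p by simp
    show "(\<Prod>i\<in>UNIV. A $ i $ ?m p i) = (\<Prod>i\<in>UNIV. A $ ?q i $ ?q (p i))"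
      using prod.reindex_bij_betw[OF q, of "\<lambda>i. A $ i $ ?m p i", symmetric] inj by (simp add: map_permutation_apply)
  qed
  finally show ?thesis by (simp add: det_def)
qed

text \<open>Conjugating T with \<open>to_wo\<close> changes neither the Jacobian determinant nor
  Lebesgue measure, so the well-ordered case carries over.\<close>

lemma nn_integral_change_of_variables:
  fixes T :: "real^'n \<Rightarrow> real^'n" and f :: "real^'n \<Rightarrow> real"
  assumes S: "S \<in> sets borel" and T: "\<And>x. x \<in> S \<Longrightarrow> T differentiable (at x)" and inj: "inj_on T S"
    and nonneg: "\<And>x. x \<in> S \<Longrightarrow> 0 \<le> f (T x)"
    and m1: "(\<lambda>y. indicator (T ` S) y * f y) \<in> borel_measurable borel"
    and m2: "(\<lambda>x. indicator S x * (\<bar>det (matrix (D T x))\<bar> * f (T x))) \<in> borel_measurable borel"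
  shows "(\<integral>\<^sup>+y. ennreal (indicator (T ` S) y * f y) \<partial>lborel)
      = (\<integral>\<^sup>+x. ennreal (indicator S x * (\<bar>det (matrix (D T x))\<bar> * f (T x))) \<partial>lborel)"
proof -
  let ?to_wo = "to_wo :: real^'n \<Rightarrow> real^'n wellordered"
  let ?S = "?to_wo ` S" and ?T = "\<lambda>y. to_wo (T (from_wo y))" and ?f = "\<lambda>y. f (from_wo y)"
  have mto: "?to_wo \<in> measurable borel borel" and mfrom: "(from_wo :: _ \<Rightarrow> real^'n) \<in> measurable borel borel"
    using bounded_linear_to_wo bounded_linear_from_wo linear_continuous_on borel_measurable_continuous_onI by blast+
  have img: "y \<in> ?to_wo ` A \<longleftrightarrow> from_wo y \<in> A" for A y by (metis imageE imageI to_wo_from_wo from_wo_to_wo)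
  have "?S = from_wo -` S" using img by auto
  then have S': "?S \<in> sets borel" using measurable_sets[OF mfrom S] by simp
  have dT: "(?T has_derivative (\<lambda>v. to_wo (D T (from_wo y) (from_wo v)))) (at y)" if "y \<in> ?S" for y
  proof -
    have "(T has_derivative D T (from_wo y)) (at (from_wo y))" using T that img has_derivative_D by blast
    from diff_chain_at[OF bounded_linear_imp_has_derivative[OF bounded_linear_from_wo] this]
    have "((\<lambda>y. T (from_wo y)) has_derivative (\<lambda>v. D T (from_wo y) (from_wo v))) (at y)" by (simp add: o_def)
    from bounded_linear.has_derivative[OF bounded_linear_to_wo this] show ?thesis .
  qed
  have det: "det (matrix (D ?T y)) = det (matrix (D T (from_wo y)))" if "y \<in> ?S" for y
  proof -
    have *: "from_wo (axis j 1) = axis (Rep_wellordered j) 1" for j :: "'n wellordered"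
      by (auto simp: from_wo_def axis_def vec_eq_iff Abs_wellordered_inverse Rep_wellordered_inverse)
    have "matrix (D ?T y) = (\<chi> i j. matrix (D T (from_wo y)) $ Rep_wellordered i $ Rep_wellordered j)"
      unfolding D_eqI[OF dT[OF that]] by (simp add: matrix_def to_wo_def vec_eq_iff *)
    then show ?thesis by (simp add: det_reindex_wellordered)
  qed
  have TS: "?T ` ?S = ?to_wo ` T ` S" by (auto simp: image_image)
  have i1: "indicator (?T ` ?S) y * ?f y = indicator (T ` S) (from_wo y) * f (from_wo y)" for y
    unfolding TS indicator_def img ..
  have i2: "indicator ?S y * (\<bar>det (matrix (D ?T y))\<bar> * ?f (?T y))
     = indicator S (from_wo y) * (\<bar>det (matrix (D T (from_wo y)))\<bar> * f (T (from_wo y)))" for y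
    using det[of y] img[of y S] by (simp add: indicator_def)
  have "(\<integral>\<^sup>+y. ennreal (indicator (?T ` ?S) y * ?f y) \<partial>lborel)
      = (\<integral>\<^sup>+x. ennreal (indicator ?S x * (\<bar>det (matrix (D ?T x))\<bar> * ?f (?T x))) \<partial>lborel)"
  proof (rule nn_integral_change_of_variables_wellorder[OF S'])
    show "?T differentiable (at y)" if "y \<in> ?S" for y using dT[OF that] by (rule differentiableI)
    show "inj_on ?T ?S" using inj by (auto simp: inj_on_def) (metis from_wo_to_wo)
    show "0 \<le> ?f (?T y)" if "y \<in> ?S" for y using nonneg that by auto
    show "(\<lambda>y. indicator (?T ` ?S) y * ?f y) \<in> borel_measurable borel"
      unfolding i1 by (rule measurable_compose[OF mfrom m1])
    show "(\<lambda>y. indicator ?S y * (\<bar>det (matrix (D ?T y))\<bar> * ?f (?T y))) \<in> borel_measurable borel"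
      unfolding i2 by (rule measurable_compose[OF mfrom m2])
  qed
  then have "(\<integral>\<^sup>+y. ennreal (indicator (T ` S) (from_wo y) * f (from_wo y)) \<partial>distr lborel borel ?to_wo)
      = (\<integral>\<^sup>+x. ennreal (indicator S (from_wo x) * (\<bar>det (matrix (D T (from_wo x)))\<bar> * f (T (from_wo x)))) \<partial>distr lborel borel ?to_wo)"
    unfolding i1 i2 distr_lborel_to_wo .
  then show ?thesis
    using measurable_compose[OF mfrom m1] measurable_compose[OF mfrom m2] mto
    by (simp add: nn_integral_distr)
qed

section \<open>Curvature of a metric on an open set of Euclidean space\<close>

text \<open>G plays the role of the matrix of g in a chart with image \<Omega>. Curvature thus
  becomes a computation with matrix functions on an open set, free of manifold notions.\<close>

locale metric_patch =
  fixes \<Omega> :: "(real^'n) set" and G :: "real^'n \<Rightarrow> real^'n^'n"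
  assumes open_\<Omega>: "open \<Omega>" and smooth_G: "smooth_on \<Omega> G"
    and sym_G: "x \<in> \<Omega> \<Longrightarrow> transpose (G x) = G x"
    and pos_G: "x \<in> \<Omega> \<Longrightarrow> u \<noteq> 0 \<Longrightarrow> 0 < u \<bullet> (G x *v u)"
begin

definition H where "H x = matrix_inv (G x)"

text \<open>The Christoffel symbols of the first kind as a trilinear form, g (\<Gamma>(u, w), z);
  the Koszul formula for constant fields reduces to it.\<close>

definition christoffel :: "real^'n \<Rightarrow> real^'n \<Rightarrow> real^'n \<Rightarrow> real^'n \<Rightarrow> real" where
  "christoffel x u w z = (w \<bullet> (D G x u *v z) + u \<bullet> (D G x w *v z) - u \<bullet> (D G x z *v w)) / 2"

text \<open>\<open>conn u x\<close> is the matrix of \<open>w \<mapsto> \<Gamma>(u, w)\<close>, and \<open>curv u v x\<close> that of \<open>w \<mapsto> R(u, v) w\<close>.\<close>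

definition conn :: "real^'n \<Rightarrow> real^'n \<Rightarrow> real^'n^'n" where
  "conn u x = H x ** (\<chi> k l. christoffel x u (axis l 1) (axis k 1))"

definition curv :: "real^'n \<Rightarrow> real^'n \<Rightarrow> real^'n \<Rightarrow> real^'n^'n" where
  "curv u v x = D (conn v) x u - D (conn u) x v + conn u x ** conn v x - conn v x ** conn u x"

text \<open>Follows the convention that Ric (v, w) is the trace of u |-> R (u, v) w; the row index
  belongs to v.\<close>

definition ric :: "real^'n \<Rightarrow> real^'n^'n" where
  "ric x = (\<chi> j l. \<Sum>k\<in>UNIV. curv (axis k 1) (axis j 1) x $ k $ l)"

text \<open>The solution Q of \<open>transpose Q ** G x = ric x\<close>, that is of Ric (u, w) = g
  (Q u, w) with the arguments of Ric in this order.\<close>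

definition ricop :: "real^'n \<Rightarrow> real^'n^'n" where
  "ricop x = transpose (ric x ** H x)"

definition scal :: "real^'n \<Rightarrow> real" where
  "scal x = trace (ricop x)"

definition dens :: "real^'n \<Rightarrow> real" where
  "dens x = sqrt (det (G x))"

section \<open>The metric, its inverse and the Levi-Civita connection\<close>

lemma det_G_pos: "x \<in> \<Omega> \<Longrightarrow> det (G x) > 0"
  using orthonormal_basis_exists[OF sym_G pos_G] orthonormal_basis_gram(3) sym_G by metis

lemma GH: "x \<in> \<Omega> \<Longrightarrow> G x ** H x = mat 1" and HG: "x \<in> \<Omega> \<Longrightarrow> H x ** G x = mat 1"
  using matrix_inv_mult[of "G x"] det_G_pos[of x] by (auto simp: H_def)

lemma sym_H: assumes x: "x \<in> \<Omega>" shows "transpose (H x) = H x"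
proof -
  have "transpose (H x) = transpose (H x) ** (G x ** H x)" by (simp add: GH x)
  also have "\<dots> = transpose (G x ** H x) ** H x" by (simp add: matrix_algebra sym_G x)
  finally show ?thesis by (simp add: GH x)
qed

lemma smooth_H: "smooth_on \<Omega> H"
  unfolding H_def using det_G_pos by (intro smooth_on_matrix_inv open_\<Omega> smooth_G) fastforce

lemma differentiable_G: "x \<in> \<Omega> \<Longrightarrow> G differentiable (at x)"
  by (rule smooth_on_differentiable[OF smooth_G open_\<Omega>])

lemma sym_DG: assumes x: "x \<in> \<Omega>" shows "transpose (D G x u) = D G x u"
proof -
  have "transpose (D G x u) = D (\<lambda>x. transpose (G x)) x u"
    by (rule D_bounded_linear[OF bounded_linear_transpose differentiable_G[OF x], symmetric])
  also have "\<dots> = D G x u" by (subst D_cong[OF open_\<Omega> x, of _ G]) (simp_all add: sym_G)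
  finally show ?thesis .
qed

lemma smooth_conn: "smooth_on \<Omega> (conn u)"
proof -
  have "smooth_on \<Omega> (\<lambda>x. christoffel x u w z)" for w z
    unfolding christoffel_def divide_inverse diff_conv_add_uminus[of _ "u \<bullet> _"]
    by (intro smooth_on_mult smooth_on_add smooth_on_minus smooth_on_inner smooth_on_mv smooth_on_D
        smooth_on_const open_\<Omega> smooth_G)
  then have "smooth_on \<Omega> (\<lambda>x. (\<chi> k l. christoffel x u (axis l 1) (axis k 1)) :: real^'n^'n)"
    by (intro smooth_on_vec open_\<Omega>) simp
  then show ?thesis
    unfolding conn_def[abs_def] by (intro smooth_on_mm open_\<Omega> smooth_H)
qed

lemma D_G_linear: "x \<in> \<Omega> \<Longrightarrow> linear (D G x)"
  by (rule linear_frechet_derivative[OF differentiable_G])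

text \<open>The form is linear in w and in z, so the matrix of its values on the axes reproduces
  it.\<close>

lemma christoffel_matrix:
  assumes x: "x \<in> \<Omega>"
  shows "z \<bullet> ((\<chi> k l. christoffel x u (axis l 1) (axis k 1)) *v w) = christoffel x u w z"
proof -
  note lin = linear_add[OF D_G_linear[OF x]] linear_scale[OF D_G_linear[OF x]]
  have l1: "linear (\<lambda>w. christoffel x u w z)" for z
    by (rule linearI) (simp_all add: christoffel_def lin inner_add_left inner_add_right mv.add_left mv.add_right
        mv.scaleR_left mv.scaleR_right algebra_simps add_divide_distrib diff_divide_distrib)
  have l2: "linear (\<lambda>z. christoffel x u w z)" for w
    by (rule linearI) (simp_all add: christoffel_def lin inner_add_left inner_add_right mv.add_left mv.add_right
        mv.scaleR_left mv.scaleR_right algebra_simps add_divide_distrib diff_divide_distrib)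
  have "christoffel x u w z = (\<Sum>k\<in>UNIV. z $ k * (\<Sum>l\<in>UNIV. w $ l * christoffel x u (axis l 1) (axis k 1)))"
    unfolding linear_expand_axis[OF l2, of w z] real_scaleR_def
    by (intro sum.cong refl arg_cong2[where f = "(*)"] linear_expand_axis[OF l1, unfolded real_scaleR_def])
  then show ?thesis
    by (simp add: inner_vec_def matrix_vector_mult_def sum_distrib_left algebra_simps)
qed

text \<open>The characterisation of \<open>conn\<close> through the metric; symmetry of the
  connection and its compatibility with g are both read off from it.\<close>

lemma conn_metric: "x \<in> \<Omega> \<Longrightarrow> z \<bullet> (G x *v (conn u x *v w)) = christoffel x u w z"
  by (simp add: conn_def matrix_vector_mul_assoc matrix_mul_assoc GH christoffel_matrix)

lemma nondegenerate_G:
  assumes x: "x \<in> \<Omega>" and "\<And>z. z \<bullet> (G x *v u) = z \<bullet> (G x *v w)"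
  shows "u = w"
proof (rule ccontr)
  assume "u \<noteq> w"
  then have "0 < (u - w) \<bullet> (G x *v (u - w))" by (intro pos_G x) simp
  then show False using assms(2)[of "u - w"] by (simp add: mv.diff_right inner_diff_right)
qed

lemma inner_DG_sym: "x \<in> \<Omega> \<Longrightarrow> u \<bullet> (D G x v *v w) = w \<bullet> (D G x v *v u)"
  by (rule inner_matrix_vector_sym[OF sym_DG])

text \<open>Torsion freeness: as the matrices D G are symmetric, so is the Christoffel form in u and
  w.\<close>

lemma conn_sym: assumes x: "x \<in> \<Omega>" shows "conn u x *v w = conn w x *v u"
  by (rule nondegenerate_G[OF x]) (simp add: conn_metric[OF x] christoffel_def inner_DG_sym[OF x, of w _ u])

text \<open>By \<open>conn_sym\<close>, linearity in u is linearity of a matrix in the vector it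
  acts on.\<close>

lemma conn_linear:
  assumes x: "x \<in> \<Omega>" shows "linear (\<lambda>u. conn u x)"
proof (rule linearI)
  show "conn (u + v) x = conn u x + conn v x" for u v
    by (simp add: matrix_eq mv.add_left conn_sym[OF x, of _ ] mv.add_right)
  show "conn (r *\<^sub>R u) x = r *\<^sub>R conn u x" for r u
    by (simp add: matrix_eq mv.scaleR_left conn_sym[OF x, of _ ] mv.scaleR_right)
qed

text \<open>Compatibility with the metric in matrix form: in the sum of the Christoffel forms for
  (w, z) and (z, w) everything but the derivative along u cancels.\<close>

lemma DG_conn:
  assumes x: "x \<in> \<Omega>" shows "D G x u = G x ** conn u x + transpose (conn u x) ** G x"
proof -
  have "w \<bullet> (D G x u *v z) = w \<bullet> ((G x ** conn u x + transpose (conn u x) ** G x) *v z)" for w z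
  proof -
    have "w \<bullet> ((transpose (conn u x) ** G x) *v z) = z \<bullet> (G x *v (conn u x *v w))"
      by (metis dot_lmul_matrix inner_commute matrix_vector_mul_assoc sym_G transpose_matrix_vector x)
    then have "w \<bullet> ((G x ** conn u x + transpose (conn u x) ** G x) *v z) = christoffel x u z w + christoffel x u w z"
      unfolding mv.add_left inner_add_right conn_metric[OF x] by (simp add: conn_metric x flip: matrix_vector_mul_assoc)
    also have "\<dots> = w \<bullet> (D G x u *v z)"
      unfolding christoffel_def using inner_DG_sym[OF x, of w u z] inner_DG_sym[OF x, of w z u] inner_DG_sym[OF x, of u w z]
        inner_DG_sym[OF x, of z w u] by (simp add: field_simps)
    finally show ?thesis ..
  qed
  then have "D G x u *v z = (G x ** conn u x + transpose (conn u x) ** G x) *v z" for z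
    using vector_eq_ldot by blast
  then show ?thesis using matrix_eq by blast
qed

text \<open>The inverse metric is parallel too: substitute \<open>DG_conn\<close> into the
  derivative of an inverse.\<close>

lemma DH_conn:
  assumes x: "x \<in> \<Omega>" shows "D H x u = - (conn u x ** H x + H x ** transpose (conn u x))"
proof -
  have "D H x u = - (H x ** D G x u ** H x)"
    unfolding H_def
    using det_G_pos by (intro D_matrix_inv[OF open_\<Omega> smooth_G _ x]) fastforce
  also have "\<dots> = - (H x ** G x ** conn u x ** H x + H x ** transpose (conn u x) ** (G x ** H x))"
    by (simp add: DG_conn x matrix_algebra)
  finally show ?thesis by (simp add: GH HG x)
qed

lemma differentiable_conn: "x \<in> \<Omega> \<Longrightarrow> conn u differentiable (at x)"
  by (rule smooth_on_differentiable[OF smooth_conn open_\<Omega>])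

section \<open>Symmetries of the curvature\<close>

lemma curv_skew: "curv u v x = - curv v u x"
  by (simp add: curv_def)

lemma D_DG_conn:
  assumes x: "x \<in> \<Omega>"
  shows "D (\<lambda>y. D G y v) x u =
    G x ** conn u x ** conn v x + transpose (conn u x) ** G x ** conn v x + G x ** D (conn v) x u
    + transpose (G x ** conn u x ** conn v x + transpose (conn u x) ** G x ** conn v x + G x ** D (conn v) x u)"
proof -
  have "D (\<lambda>y. D G y v) x u = D (\<lambda>y. G y ** conn v y + transpose (conn v y) ** G y) x u"
    by (subst D_cong[OF open_\<Omega> x]) (auto simp: DG_conn)
  also have "\<dots> = (G x ** D (conn v) x u + D G x u ** conn v x) +
      (transpose (conn v x) ** D G x u + transpose (D (conn v) x u) ** G x)"
    by (simp add: D_add D_bilinear[OF mm.bounded_bilinear_axioms] D_bounded_linear[OF bounded_linear_transpose]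
        differentiable_bilinear[OF mm.bounded_bilinear_axioms] differentiable_bounded_linear[OF bounded_linear_transpose]
        differentiable_conn differentiable_G x)
  finally show ?thesis
    by (simp add: DG_conn x matrix_algebra sym_G algebra_simps)
qed

text \<open>Exchange u and v in \<open>D_DG_conn\<close>, whose right side has the form X +
  transpose X. In the difference of the two X the terms with
  \<open>transpose (conn u x) ** G x ** conn v x\<close> form a skew matrix and drop out on
  symmetrising; the rest is \<open>G x ** curv u v x\<close>.\<close>

lemma curv_metric_skew:
  assumes x: "x \<in> \<Omega>"
  shows "G x ** curv u v x + transpose (G x ** curv u v x) = 0"
proof -
  have "D (\<lambda>y. D G y v) x u = D (\<lambda>y. D G y u) x v"
    by (rule D_D_sym[OF open_\<Omega> smooth_G x])
  then show ?thesis
    unfolding D_DG_conn[OF x] curv_def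
    by (simp add: matrix_algebra sym_G x algebra_simps)
qed

text \<open>With its last index raised the curvature is skew in both pairs of indices, so the contractions
  in the Bianchi identity are plain sums over coordinates.\<close>

definition curv2 :: "real^'n \<Rightarrow> real^'n \<Rightarrow> real^'n \<Rightarrow> real^'n^'n" where
  "curv2 u v x = curv u v x ** H x"

text \<open>\<open>curv_metric_skew\<close> multiplied by H from both sides.\<close>

lemma curv2_transpose:
  assumes x: "x \<in> \<Omega>" shows "transpose (curv2 u v x) = - curv2 u v x"
proof -
  have "H x ** (G x ** curv u v x + transpose (G x ** curv u v x)) ** H x = 0"
    by (simp add: curv_metric_skew x mm.zero_left mm.zero_right)
  then have "(H x ** G x) ** curv u v x ** H x + H x ** transpose (curv u v x) ** (G x ** H x) = 0"
    by (simp add: matrix_algebra sym_G x)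
  then show ?thesis
    by (simp add: curv2_def matrix_transpose_mul sym_H x GH HG eq_neg_iff_add_eq_0 add.commute)
qed

lemma smooth_curv: "smooth_on \<Omega> (curv u v)"
  unfolding curv_def[abs_def]
  by (intro smooth_on_add smooth_on_diff smooth_on_D smooth_on_mm smooth_conn open_\<Omega>)

lemma smooth_curv2: "smooth_on \<Omega> (curv2 u v)"
  unfolding curv2_def[abs_def] by (intro smooth_on_mm smooth_curv smooth_H open_\<Omega>)

section \<open>The second Bianchi identity and its contraction\<close>

lemma bianchi_curv:
  assumes x: "x \<in> \<Omega>"
  shows "(D (curv u v) x w + conn w x ** curv u v x - curv u v x ** conn w x)
       + (D (curv v w) x u + conn u x ** curv v w x - curv v w x ** conn u x)
       + (D (curv w u) x v + conn v x ** curv w u x - curv w u x ** conn v x) = 0"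
proof -
  have d: "(\<lambda>y. D (conn u) y v) differentiable (at x)" for u v
    by (rule smooth_on_differentiable[OF smooth_on_D[OF smooth_conn] open_\<Omega> x])
  have c: "conn u differentiable (at x)" for u by (rule differentiable_conn[OF x])
  note cc = differentiable_bilinear[OF mm.bounded_bilinear_axioms c c]
  have e: "D (curv u v) x w = D (\<lambda>y. D (conn v) y u) x w - D (\<lambda>y. D (conn u) y v) x w
      + (conn u x ** D (conn v) x w + D (conn u) x w ** conn v x)
      - (conn v x ** D (conn u) x w + D (conn v) x w ** conn u x)" for u v w
    unfolding curv_def[abs_def]
    by (simp add: D_add D_diff D_bilinear[OF mm.bounded_bilinear_axioms] d c cc differentiable_add differentiable_diff)
  \<comment> \<open>Second derivatives of \<open>conn\<close> commute and cancel in pairs. What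
    remains are products of \<open>conn\<close> with its first derivatives and triple products,
    which cancel as in the Jacobi identity.\<close>
  have s: "D (\<lambda>y. D (conn v) y u) x w = D (\<lambda>y. D (conn v) y w) x u" for u v w
    by (rule D_D_sym[OF open_\<Omega> smooth_conn x])
  show ?thesis
    unfolding e[of u v w] e[of v w u] e[of w u v] s[of v u w] s[of u v w] s[of w u v]
    by (simp add: curv_def matrix_algebra algebra_simps)
qed

text \<open>The covariant derivative along w in the two matrix indices only. The Christoffel terms
  for the slots u and v are left out: by torsion freeness they would cancel in the cyclic
  sum.\<close>

definition dcurv2 :: "real^'n \<Rightarrow> real^'n \<Rightarrow> real^'n \<Rightarrow> real^'n \<Rightarrow> real^'n^'n" where
  "dcurv2 w u v x = D (curv2 u v) x w + conn w x ** curv2 u v x + curv2 u v x ** transpose (conn w x)"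

text \<open>\<open>DH_conn\<close> trades the term with \<open>transpose (conn w x)\<close> for the
  right half of the commutator of \<open>conn\<close> and \<open>curv\<close>; this is how
  \<open>bianchi_curv\<close> passes to \<open>curv2\<close>.\<close>

lemma dcurv2_eq:
  assumes x: "x \<in> \<Omega>"
  shows "dcurv2 w u v x = (D (curv u v) x w + conn w x ** curv u v x - curv u v x ** conn w x) ** H x"
proof -
  have "D (curv2 u v) x w = curv u v x ** D H x w + D (curv u v) x w ** H x"
    unfolding curv2_def[abs_def]
    by (rule D_bilinear[OF mm.bounded_bilinear_axioms
        smooth_on_differentiable[OF smooth_curv open_\<Omega> x] smooth_on_differentiable[OF smooth_H open_\<Omega> x]])
  then show ?thesis
    by (simp add: dcurv2_def curv2_def DH_conn x matrix_algebra algebra_simps)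
qed

lemma bianchi: "x \<in> \<Omega> \<Longrightarrow> dcurv2 w u v x + dcurv2 u v w x + dcurv2 v w u x = 0"
  using bianchi_curv[of x u v w] by (simp add: dcurv2_eq mm.zero_left flip: mm.add_left)

text \<open>With the index raised the contraction pairs a direction slot with a row index and
  involves no further metric factor, so it commutes with coordinate derivatives.\<close>

lemma ricop_component:
  assumes x: "x \<in> \<Omega>"
  shows "ricop x $ m $ j = (\<Sum>k\<in>UNIV. curv2 (axis k 1) (axis j 1) x $ k $ m)"
proof -
  have "ricop x $ m $ j = (\<Sum>l\<in>UNIV. \<Sum>k\<in>UNIV. curv (axis k 1) (axis j 1) x $ k $ l * H x $ l $ m)"
    by (simp add: ricop_def ric_def transpose_def matrix_matrix_mult_def sum_distrib_right)
  also have "\<dots> = (\<Sum>k\<in>UNIV. \<Sum>l\<in>UNIV. curv (axis k 1) (axis j 1) x $ k $ l * H x $ l $ m)"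
    by (rule sum.swap)
  finally show ?thesis by (simp add: curv2_def matrix_matrix_mult_def)
qed

lemma smooth_ricop: "smooth_on \<Omega> ricop"
proof -
  have "smooth_on \<Omega> ric"
    by (intro smooth_on_vec open_\<Omega>) (auto simp: ric_def intro!: smooth_on_sum smooth_on_nth smooth_curv open_\<Omega>)
  then show ?thesis
    unfolding ricop_def[abs_def] by (intro smooth_on_transpose smooth_on_mm smooth_H open_\<Omega>)
qed

lemma smooth_scal: "smooth_on \<Omega> scal"
  unfolding scal_def[abs_def] by (intro smooth_on_trace smooth_ricop open_\<Omega>)

lemma curv2_flip:
  assumes x: "x \<in> \<Omega>"
  shows "curv2 u v x $ i $ j = curv2 v u x $ j $ i"
proof -
  have "curv2 u v x $ i $ j = - transpose (curv2 u v x) $ i $ j"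
    by (simp add: curv2_transpose x)
  also have "\<dots> = curv2 v u x $ j $ i"
    by (simp add: transpose_def curv2_def curv_skew[of u v] mm.minus_left)
  finally show ?thesis .
qed

lemma differentiable_curv2: "x \<in> \<Omega> \<Longrightarrow> curv2 u v differentiable (at x)"
  by (rule smooth_on_differentiable[OF smooth_curv2 open_\<Omega>])

text \<open>A linear relation between the matrices \<open>curv2\<close> passes to their derivatives;
  in this way \<open>dcurv2\<close> inherits the skew symmetries.\<close>

lemma D_curv2_linear:
  assumes "bounded_linear h" "\<And>y. y \<in> \<Omega> \<Longrightarrow> h (curv2 u v y) = curv2 u' v' y" and x: "x \<in> \<Omega>"
  shows "h (D (curv2 u v) x w) = D (curv2 u' v') x w"
proof -
  have "h (D (curv2 u v) x w) = D (\<lambda>y. h (curv2 u v y)) x w"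
    by (rule D_bounded_linear[OF assms(1) differentiable_curv2[OF x], symmetric])
  also have "\<dots> = D (curv2 u' v') x w"
    by (subst D_cong[OF open_\<Omega> x, of _ "curv2 u' v'"]) (auto simp: assms)
  finally show ?thesis .
qed

lemma curv2_skew: "curv2 v u x = - curv2 u v x"
  by (simp add: curv2_def curv_skew[of u v] mm.minus_left)

lemma dcurv2_skew:
  assumes x: "x \<in> \<Omega>"
  shows "dcurv2 w v u x = - dcurv2 w u v x"
  using D_curv2_linear[OF bounded_linear_minus[OF bounded_linear_ident] _ x, of u v v u w] curv2_skew[of v u]
  by (simp add: dcurv2_def mm.minus_left mm.minus_right)

lemma dcurv2_transpose:
  assumes x: "x \<in> \<Omega>"
  shows "transpose (dcurv2 w u v x) = dcurv2 w v u x"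
proof -
  have c: "transpose (curv2 u v y) = curv2 v u y" if "y \<in> \<Omega>" for y
    using curv2_transpose[OF that] by (simp add: curv2_skew[of v u])
  show ?thesis
    using D_curv2_linear[OF bounded_linear_transpose c x, of w]
    by (simp add: dcurv2_def transpose_add matrix_transpose_mul c x)
qed

lemma conn_component_sym:
  "x \<in> \<Omega> \<Longrightarrow> conn (axis i 1) x $ k $ j = conn (axis j 1) x $ k $ i"
  using conn_sym[of x "axis i 1" "axis j 1"] by (simp add: matrix_vector_mult_basis column_def vec_eq_iff)

lemma D_component2:
  fixes f :: "real^'n \<Rightarrow> real^'p^'q"
  assumes "f differentiable (at x)"
  shows "D (\<lambda>y. f y $ i $ j) x v = D f x v $ i $ j"
  using D_nth[OF assms] D_nth[OF differentiable_nth[OF assms]] by metis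

lemma D_ricop_component:
  assumes x: "x \<in> \<Omega>"
  shows "D ricop x v $ m $ j = (\<Sum>k\<in>UNIV. D (curv2 (axis k 1) (axis j 1)) x v $ k $ m)"
proof -
  have d: "curv2 u v differentiable (at x)" for u v
    by (rule smooth_on_differentiable[OF smooth_curv2 open_\<Omega> x])
  have "D ricop x v $ m $ j = D (\<lambda>y. ricop y $ m $ j) x v"
    by (rule D_component2[OF smooth_on_differentiable[OF smooth_ricop open_\<Omega> x], symmetric])
  also have "\<dots> = D (\<lambda>y. \<Sum>k\<in>UNIV. curv2 (axis k 1) (axis j 1) y $ k $ m) x v"
    by (subst D_cong[OF open_\<Omega> x, of _ "\<lambda>y. \<Sum>k\<in>UNIV. curv2 (axis k 1) (axis j 1) y $ k $ m"])
      (auto simp: ricop_component)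
  also have "\<dots> = (\<Sum>k\<in>UNIV. D (\<lambda>y. curv2 (axis k 1) (axis j 1) y $ k $ m) x v)"
    by (intro D_sum differentiable_nth d)
  also have "\<dots> = (\<Sum>k\<in>UNIV. D (curv2 (axis k 1) (axis j 1)) x v $ k $ m)"
    by (simp only: D_component2[OF d])
  finally show ?thesis .
qed

lemma D_scal: "x \<in> \<Omega> \<Longrightarrow> D scal x v = trace (D ricop x v)"
  unfolding scal_def[abs_def]
  by (rule D_bounded_linear[OF bounded_linear_trace smooth_on_differentiable[OF smooth_ricop open_\<Omega>]])

text \<open>Put e_m, e_k, e_j into \<open>bianchi\<close>, take the entry (k, j) and sum over k and
  j. Two of the three terms coincide after renaming, which is the origin of the factor 2.\<close>

lemma contracted_bianchi:
  assumes x: "x \<in> \<Omega>"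
  shows "D scal x (axis m 1) = 2 * (\<Sum>k\<in>UNIV. (D ricop x (axis k 1) + conn (axis k 1) x ** ricop x
    - ricop x ** conn (axis k 1) x) $ k $ m)"
proof -
  let ?e = "\<lambda>k::'n. axis k (1::real)"
  let ?K = "\<lambda>i j. curv2 (?e i) (?e j) x" and ?A = "\<lambda>i. conn (?e i) x"
  let ?T = "\<lambda>w i j. dcurv2 (?e w) (?e i) (?e j) x"
  have Tskew: "?T w i j = - ?T w j i" for w i j by (rule dcurv2_skew[OF x])
  have Ttr: "?T w i j $ a $ b = ?T w j i $ b $ a" for w i j a b
    by (subst dcurv2_transpose[OF x, symmetric]) (simp add: transpose_def)
  \<comment> \<open>The skew symmetries give the two divergence terms a common shape; they differ
    only by the names of k and j.\<close>
  have "?T m k j $ k $ j = ?T k j m $ j $ k + ?T j k m $ k $ j" for k j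
  proof -
    have "(?T m k j + ?T k j m + ?T j m k) $ k $ j = 0"
      by (simp only: bianchi[OF x] zero_index)
    then show ?thesis
      using Ttr[of k j m k j] Tskew[of k m j] Tskew[of j m k] by simp
  qed
  then have "(\<Sum>k\<in>UNIV. \<Sum>j\<in>UNIV. ?T m k j $ k $ j)
      = (\<Sum>k\<in>UNIV. \<Sum>j\<in>UNIV. ?T k j m $ j $ k) + (\<Sum>k\<in>UNIV. \<Sum>j\<in>UNIV. ?T j k m $ k $ j)"
    by (simp only: sum.distrib)
  also have "(\<Sum>k\<in>UNIV. \<Sum>j\<in>UNIV. ?T j k m $ k $ j) = (\<Sum>k\<in>UNIV. \<Sum>j\<in>UNIV. ?T k j m $ j $ k)"
    by (rule sum.swap)
  finally have TT: "(\<Sum>k\<in>UNIV. \<Sum>j\<in>UNIV. ?T m k j $ k $ j) = 2 * (\<Sum>k\<in>UNIV. \<Sum>j\<in>UNIV. ?T k j m $ j $ k)"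
    by simp
  \<comment> \<open>The contraction yields the derivative of \<open>scal\<close>, and each of the
    two matrix indices adds one copy of the same trace.\<close>
  have left: "(\<Sum>k\<in>UNIV. \<Sum>j\<in>UNIV. ?T m k j $ k $ j) = D scal x (?e m) + 2 * trace (?A m ** ricop x)"
  proof -
    have 1: "(\<Sum>k\<in>UNIV. \<Sum>j\<in>UNIV. D (curv2 (?e k) (?e j)) x (?e m) $ k $ j) = D scal x (?e m)"
      unfolding D_scal[OF x] trace_def D_ricop_component[OF x] by (rule sum.swap)
    have "(\<Sum>j\<in>UNIV. (?A m ** ?K k j) $ k $ j) = (?A m ** ricop x) $ k $ k" for k
    proof -
      have "(\<Sum>j\<in>UNIV. (?A m ** ?K k j) $ k $ j) = (\<Sum>l\<in>UNIV. \<Sum>j\<in>UNIV. ?A m $ k $ l * ?K k j $ l $ j)"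
        unfolding matrix_matrix_mult_def vec_lambda_beta by (rule sum.swap)
      also have "\<dots> = (?A m ** ricop x) $ k $ k"
        unfolding matrix_matrix_mult_def vec_lambda_beta ricop_component[OF x] sum_distrib_left
        by (intro sum.cong refl arg_cong2[where f = "(*)"] curv2_flip[OF x])
      finally show ?thesis .
    qed
    then have 2: "(\<Sum>k\<in>UNIV. \<Sum>j\<in>UNIV. (?A m ** ?K k j) $ k $ j) = trace (?A m ** ricop x)"
      by (simp add: trace_def)
    have "(\<Sum>k\<in>UNIV. (?K k j ** transpose (?A m)) $ k $ j) = (?A m ** ricop x) $ j $ j" for j
    proof -
      have "(\<Sum>k\<in>UNIV. (?K k j ** transpose (?A m)) $ k $ j) = (\<Sum>l\<in>UNIV. \<Sum>k\<in>UNIV. ?K k j $ k $ l * ?A m $ j $ l)"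
        unfolding matrix_matrix_mult_def vec_lambda_beta transpose_def by (rule sum.swap)
      also have "\<dots> = (?A m ** ricop x) $ j $ j"
        unfolding matrix_matrix_mult_def vec_lambda_beta ricop_component[OF x] sum_distrib_left
        by (intro sum.cong refl mult.commute)
      finally show ?thesis .
    qed
    then have 3: "(\<Sum>k\<in>UNIV. \<Sum>j\<in>UNIV. (?K k j ** transpose (?A m)) $ k $ j) = trace (?A m ** ricop x)"
      by (subst sum.swap) (simp add: trace_def)
    show ?thesis
      unfolding dcurv2_def vector_add_component sum.distrib 1 2 3 by simp
  qed
  have right: "(\<Sum>k\<in>UNIV. \<Sum>j\<in>UNIV. ?T k j m $ j $ k)
      = (\<Sum>k\<in>UNIV. D ricop x (?e k) $ k $ m) + (\<Sum>k\<in>UNIV. (?A k ** ricop x) $ k $ m)"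
  proof -
    \<comment> \<open>A connection symmetric in (k, l) is contracted with a curvature matrix skew in
      (k, l).\<close>
    have 2: "(\<Sum>k\<in>UNIV. \<Sum>j\<in>UNIV. (?A k ** ?K j m) $ j $ k) = 0"
    proof -
      let ?s = "\<lambda>j. \<Sum>k\<in>UNIV. \<Sum>l\<in>UNIV. ?A k $ j $ l * ?K j m $ l $ k"
      have "?s j = - ?s j" for j
      proof -
        have "?s j = (\<Sum>l\<in>UNIV. \<Sum>k\<in>UNIV. ?A k $ j $ l * ?K j m $ l $ k)"
          by (rule sum.swap)
        also have "\<dots> = (\<Sum>l\<in>UNIV. \<Sum>k\<in>UNIV. ?A l $ j $ k * - ?K j m $ k $ l)"
        proof (intro sum.cong refl arg_cong2[where f = "(*)"] conn_component_sym[OF x])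
          fix l k
          show "?K j m $ l $ k = - ?K j m $ k $ l"
            using arg_cong[OF curv2_transpose[OF x, of "?e j" "?e m"], of "\<lambda>M. M $ k $ l"] by (simp add: transpose_def)
        qed
        finally show ?thesis by (simp add: sum_negf)
      qed
      then have zero: "?s j = 0" for j by (simp only: equal_neg_zero)
      have "(\<Sum>k\<in>UNIV. \<Sum>j\<in>UNIV. (?A k ** ?K j m) $ j $ k) = (\<Sum>j\<in>UNIV. ?s j)"
        unfolding matrix_matrix_mult_def vec_lambda_beta by (rule sum.swap)
      then show ?thesis by (simp only: zero sum.neutral_const)
    qed
    have 3: "(\<Sum>j\<in>UNIV. (?K j m ** transpose (?A k)) $ j $ k) = (?A k ** ricop x) $ k $ m" for k
    proof -
      have "(\<Sum>j\<in>UNIV. (?K j m ** transpose (?A k)) $ j $ k) = (\<Sum>l\<in>UNIV. \<Sum>j\<in>UNIV. ?K j m $ j $ l * ?A k $ k $ l)"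
        unfolding matrix_matrix_mult_def vec_lambda_beta transpose_def by (rule sum.swap)
      also have "\<dots> = (?A k ** ricop x) $ k $ m"
        unfolding matrix_matrix_mult_def vec_lambda_beta ricop_component[OF x] sum_distrib_left
        by (intro sum.cong refl mult.commute)
      finally show ?thesis .
    qed
    show ?thesis
      unfolding dcurv2_def vector_add_component sum.distrib 2 3 D_ricop_component[OF x] by simp
  qed
  \<comment> \<open>Torsion freeness exchanges k and m here, so the trace left over from
    \<open>left\<close> is the Christoffel term for the lower index of \<open>ricop\<close>.\<close>
  have "(\<Sum>k\<in>UNIV. (ricop x ** ?A k) $ k $ m) = trace (ricop x ** ?A m)"
    unfolding trace_def matrix_matrix_mult_def vec_lambda_beta
    by (intro sum.cong refl arg_cong2[where f = "(*)"] conn_component_sym[OF x])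
  then have "(\<Sum>k\<in>UNIV. (ricop x ** ?A k) $ k $ m) = trace (?A m ** ricop x)"
    by (simp only: trace_mul_sym[of "ricop x"])
  then show ?thesis
    using TT unfolding left right by (simp add: sum.distrib sum_subtractf algebra_simps)
qed

section \<open>The Einstein tensor, the volume density and the divergence\<close>

definition nabla :: "(real^'n \<Rightarrow> real^'n) \<Rightarrow> real^'n \<Rightarrow> real^'n^'n" where
  "nabla \<xi> x = matrix (\<lambda>u. D \<xi> x u + conn u x *v \<xi> x)"

definition einstein :: "real^'n \<Rightarrow> real^'n^'n" where
  "einstein x = ricop x - (scal x / 2) *\<^sub>R mat 1"

lemma nabla_component:
  "nabla \<xi> x $ i $ j = D \<xi> x (axis j 1) $ i + (conn (axis j 1) x *v \<xi> x) $ i"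
  by (simp add: nabla_def matrix_def)

lemma smooth_einstein: "smooth_on \<Omega> einstein"
  unfolding einstein_def[abs_def] divide_inverse
  by (intro smooth_on_diff smooth_on_scaleR smooth_on_mult smooth_on_const smooth_ricop smooth_scal open_\<Omega>)

lemma D_einstein: "x \<in> \<Omega> \<Longrightarrow> D einstein x v = D ricop x v - (D scal x v / 2) *\<^sub>R mat 1"
proof -
  assume x: "x \<in> \<Omega>"
  have d: "scal differentiable (at x)" "ricop differentiable (at x)"
    using smooth_on_differentiable[OF smooth_scal open_\<Omega> x] smooth_on_differentiable[OF smooth_ricop open_\<Omega> x] .
  have b: "bounded_linear (\<lambda>s. (s / 2) *\<^sub>R (mat 1 :: real^'n^'n))"
    by (intro bounded_linear_intros bounded_linear_divide)
  show ?thesis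
    unfolding einstein_def[abs_def]
    by (subst D_diff[OF d(2) differentiable_bounded_linear[OF b d(1)]]) (simp add: D_bounded_linear[OF b d(1)])
qed

text \<open>The multiple of the identity commutes with \<open>conn\<close> and contributes half the
  derivative of \<open>scal\<close>, which by \<open>contracted_bianchi\<close> is the divergence of
  \<open>ricop\<close>.\<close>

lemma divergence_einstein:
  assumes x: "x \<in> \<Omega>"
  shows "(\<Sum>k\<in>UNIV. (D einstein x (axis k 1) + conn (axis k 1) x ** einstein x
    - einstein x ** conn (axis k 1) x) $ k $ m) = 0"
proof -
  have e: "D einstein x (axis k 1) + conn (axis k 1) x ** einstein x - einstein x ** conn (axis k 1) x
    = D ricop x (axis k 1) + conn (axis k 1) x ** ricop x - ricop x ** conn (axis k 1) x
      - (D scal x (axis k 1) / 2) *\<^sub>R mat 1" for k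
    by (simp add: D_einstein x einstein_def mm.diff_left mm.diff_right mm.scaleR_left mm.scaleR_right)
  have "(\<Sum>k\<in>UNIV. ((D scal x (axis k 1) / 2) *\<^sub>R (mat 1 :: real^'n^'n)) $ k $ m) = D scal x (axis m 1) / 2"
    by (simp add: mat_def if_distrib cong: if_cong)
  then show ?thesis
    unfolding e vector_minus_component[of "_ + _ - _"] vector_minus_component[of "(_ + _ - _) $ _"] sum_subtractf[of "\<lambda>k. (_ k) $ k $ m"]
    using contracted_bianchi[OF x, of m] by (simp add: sum_subtractf)
qed

lemma dens_pos: "x \<in> \<Omega> \<Longrightarrow> dens x > 0"
  by (simp add: dens_def det_G_pos)

text \<open>In Jacobi's formula \<open>DG_conn\<close> turns the trace of H times D G into twice the
  trace of \<open>conn\<close>; the square root halves it.\<close>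

lemma has_derivative_dens:
  assumes x: "x \<in> \<Omega>"
  shows "(dens has_derivative (\<lambda>v. dens x * trace (conn v x))) (at x)"
proof -
  have "trace (H x ** D G x v) = 2 * trace (conn v x)" for v
  proof -
    have "trace (H x ** D G x v) = trace (H x ** G x ** conn v x) + trace (H x ** transpose (conn v x) ** G x)"
      by (simp add: DG_conn x matrix_algebra trace_add)
    also have "trace (H x ** transpose (conn v x) ** G x) = trace (G x ** H x ** transpose (conn v x))"
      using trace_mul_sym[of "H x ** transpose (conn v x)" "G x"] by (simp add: matrix_mul_assoc)
    finally show ?thesis by (simp add: HG GH x trace_transpose)
  qed
  then have 1: "((\<lambda>x. det (G x)) has_derivative (\<lambda>v. det (G x) * (2 * trace (conn v x)))) (at x)"
    using has_derivative_det[OF differentiable_G[OF x]] det_G_pos[OF x] by (simp add: H_def)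
  have "dens x * dens x = det (G x)" using det_G_pos[OF x] by (simp add: dens_def)
  then have e: "det (G x) * inverse (sqrt (det (G x))) = sqrt (det (G x))"
    using dens_pos[OF x] by (simp add: dens_def field_simps)
  have "((\<lambda>x. sqrt (det (G x))) has_derivative (\<lambda>v. sqrt (det (G x)) * trace (conn v x))) (at x)"
    by (rule has_derivative_eq_rhs[OF has_derivative_real_sqrt[OF det_G_pos[OF x] 1]])
      (simp add: fun_eq_iff, metis e mult.commute mult.left_commute)
  then show ?thesis unfolding dens_def[abs_def] .
qed

text \<open>The classical formula: sqrt (det g) div X is the coordinate divergence of sqrt (det g)
  X, here for X = h E \<xi>. In div (E \<xi>) the derivative of E contributes (div E) \<xi> = 0, and
  the trace remains.\<close>

theorem divergence_identity:
  fixes h :: "real^'n \<Rightarrow> real"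
  assumes x: "x \<in> \<Omega>" and \<xi>: "smooth_on \<Omega> \<xi>" and h: "smooth_on \<Omega> h"
  shows "(\<Sum>k\<in>UNIV. D (\<lambda>y. dens y * (h y * (einstein y *v \<xi> y) $ k)) x (axis k 1))
    = dens x * (h x * trace (einstein x ** nabla \<xi> x) + D h x (einstein x *v \<xi> x))"
proof -
  let ?e = "\<lambda>k::'n. axis k (1::real)"
  let ?E = "einstein x"
  have d: "\<xi> differentiable (at x)" "h differentiable (at x)" "einstein differentiable (at x)" "dens differentiable (at x)"
    using smooth_on_differentiable[OF \<xi> open_\<Omega> x] smooth_on_differentiable[OF h open_\<Omega> x]
      smooth_on_differentiable[OF smooth_einstein open_\<Omega> x] has_derivative_dens[OF x] differentiableI by blast+
  note dv = differentiable_bilinear[OF mv.bounded_bilinear_axioms d(3,1)]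
  note dvk = differentiable_nth[OF dv]
  have 1: "D (\<lambda>y. dens y * (h y * (einstein y *v \<xi> y) $ k)) x (?e k)
    = dens x * (h x * ((D einstein x (?e k) *v \<xi> x) $ k + (?E *v D \<xi> x (?e k)) $ k)
        + D h x (?e k) * (?E *v \<xi> x) $ k)
      + dens x * trace (conn (?e k) x) * (h x * (?E *v \<xi> x) $ k)" for k
    unfolding D_bilinear[OF bounded_bilinear_mult d(4) differentiable_bilinear[OF bounded_bilinear_mult d(2) dvk]]
      D_bilinear[OF bounded_bilinear_mult d(2) dvk] D_nth[OF dv] D_bilinear[OF mv.bounded_bilinear_axioms d(3,1)]
      D_eqI[OF has_derivative_dens[OF x]]
    by simp
  have 2: "(\<Sum>k\<in>UNIV. trace (conn (?e k) x) * (?E *v \<xi> x) $ k)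
      + (\<Sum>k\<in>UNIV. (D einstein x (?e k) *v \<xi> x) $ k + (?E *v D \<xi> x (?e k)) $ k) = trace (?E ** nabla \<xi> x)"
  proof -
    have "(\<Sum>k\<in>UNIV. ((D einstein x (?e k) + conn (?e k) x ** ?E - ?E ** conn (?e k) x) *v \<xi> x) $ k) = 0"
    proof -
      have "(\<Sum>k\<in>UNIV. ((D einstein x (?e k) + conn (?e k) x ** ?E - ?E ** conn (?e k) x) *v \<xi> x) $ k)
        = (\<Sum>m\<in>UNIV. (\<Sum>k\<in>UNIV. (D einstein x (?e k) + conn (?e k) x ** ?E - ?E ** conn (?e k) x) $ k $ m) * \<xi> x $ m)"
        unfolding matrix_vector_mult_def vec_lambda_beta sum_distrib_right by (rule sum.swap)
      then show ?thesis by (simp only: divergence_einstein[OF x] mult_zero_left sum.neutral_const)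
    qed
    then have 1: "(\<Sum>k\<in>UNIV. (D einstein x (?e k) *v \<xi> x) $ k) + (\<Sum>k\<in>UNIV. (conn (?e k) x *v (?E *v \<xi> x)) $ k)
       = (\<Sum>k\<in>UNIV. (?E *v (conn (?e k) x *v \<xi> x)) $ k)"
      by (simp add: mv.add_left mv.diff_left sum.distrib sum_subtractf matrix_vector_mul_assoc)
    \<comment> \<open>Torsion freeness identifies the contracted Christoffel term that the density
      produces with the upper-index term in the divergence of E.\<close>
    have 2: "(\<Sum>k\<in>UNIV. (conn (?e k) x *v w) $ k) = (\<Sum>k\<in>UNIV. trace (conn (?e k) x) * w $ k)" for w
    proof -
      have "(\<Sum>k\<in>UNIV. (conn (?e k) x *v w) $ k) = (\<Sum>k\<in>UNIV. \<Sum>l\<in>UNIV. conn (?e l) x $ k $ k * w $ l)"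
        unfolding matrix_vector_mult_def vec_lambda_beta
        by (intro sum.cong refl arg_cong2[where f = "(*)"] conn_component_sym[OF x])
      also have "\<dots> = (\<Sum>l\<in>UNIV. \<Sum>k\<in>UNIV. conn (?e l) x $ k $ k * w $ l)" by (rule sum.swap)
      finally show ?thesis by (simp add: trace_def sum_distrib_right)
    qed
    have 3: "trace (?E ** nabla \<xi> x) = (\<Sum>k\<in>UNIV. (?E *v D \<xi> x (?e k)) $ k) + (\<Sum>k\<in>UNIV. (?E *v (conn (?e k) x *v \<xi> x)) $ k)"
      unfolding trace_def matrix_matrix_mult_def vec_lambda_beta nabla_component
        matrix_vector_mult_def[of "einstein x"] sum.distrib[symmetric] distrib_left ..
    show ?thesis unfolding 3 sum.distrib 1[symmetric] 2 by simp
  qed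
  have 3: "D h x (?E *v \<xi> x) = (\<Sum>k\<in>UNIV. D h x (?e k) * (?E *v \<xi> x) $ k)"
    by (subst D_expand[OF d(2)]) (simp add: mult.commute)
  have "(\<Sum>k\<in>UNIV. dens x * (h x * p k + q k * w k) + dens x * a k * (h x * w k))
      = dens x * (h x * ((\<Sum>k\<in>UNIV. a k * w k) + (\<Sum>k\<in>UNIV. p k)) + (\<Sum>k\<in>UNIV. q k * w k))"
    for a p q w :: "'n \<Rightarrow> real"
    by (simp add: sum.distrib sum_distrib_left algebra_simps)
  then show ?thesis unfolding 1 2[symmetric] 3 by this
qed

end

section \<open>Covariant derivatives of vector fields\<close>

text \<open>A Leibniz rule for a family linear in a parameter that moves with the point. It serves
  for \<open>conn\<close> along a vector field and for the derivative of a map along one.\<close>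

lemma smooth_on_linear_family:
  fixes L :: "real^'n \<Rightarrow> real^'n \<Rightarrow> 'b::real_normed_vector"
  assumes S: "open S" and lin: "\<And>y. y \<in> S \<Longrightarrow> linear (\<lambda>u. L u y)"
    and L: "\<And>u. smooth_on S (L u)" and a: "smooth_on S a"
  shows "smooth_on S (\<lambda>y. L (a y) y)"
    and "x \<in> S \<Longrightarrow> D (\<lambda>y. L (a y) y) x v = L (D a x v) x + D (L (a x)) x v"
proof -
  have e: "L u y = (\<Sum>i\<in>UNIV. (u $ i) *\<^sub>R L (axis i 1) y)" if "y \<in> S" for u y
    by (rule linear_expand_axis[OF lin[OF that]])
  have "smooth_on S (\<lambda>y. \<Sum>i\<in>UNIV. (a y $ i) *\<^sub>R L (axis i 1) y)"
    by (intro smooth_on_sum smooth_on_scaleR smooth_on_nth S L a)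
  then show "smooth_on S (\<lambda>y. L (a y) y)"
    by (subst smooth_on_cong[OF S, of _ "\<lambda>y. \<Sum>i\<in>UNIV. (a y $ i) *\<^sub>R L (axis i 1) y"]) (use e in auto)
  assume x: "x \<in> S"
  have dL: "L u differentiable (at x)" for u by (rule smooth_on_differentiable[OF L S x])
  have da: "a differentiable (at x)" by (rule smooth_on_differentiable[OF a S x])
  note da' = differentiable_nth[OF da]
  have 1: "D (L u) x v = (\<Sum>i\<in>UNIV. (u $ i) *\<^sub>R D (L (axis i 1)) x v)" for u
  proof -
    have "D (L u) x v = D (\<lambda>y. \<Sum>i\<in>UNIV. (u $ i) *\<^sub>R L (axis i 1) y) x v"
      by (subst D_cong[OF S x, of _ "\<lambda>y. \<Sum>i\<in>UNIV. (u $ i) *\<^sub>R L (axis i 1) y"]) (use e in auto)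
    also have "\<dots> = (\<Sum>i\<in>UNIV. D (\<lambda>y. (u $ i) *\<^sub>R L (axis i 1) y) x v)"
      by (intro D_sum differentiable_bounded_linear[OF bounded_linear_scaleR_right] dL)
    also have "\<dots> = (\<Sum>i\<in>UNIV. (u $ i) *\<^sub>R D (L (axis i 1)) x v)"
      by (intro sum.cong refl D_bounded_linear[OF bounded_linear_scaleR_right] dL)
    finally show ?thesis .
  qed
  have "D (\<lambda>y. L (a y) y) x v = D (\<lambda>y. \<Sum>i\<in>UNIV. (a y $ i) *\<^sub>R L (axis i 1) y) x v"
    by (subst D_cong[OF S x, of _ "\<lambda>y. \<Sum>i\<in>UNIV. (a y $ i) *\<^sub>R L (axis i 1) y"]) (use e in auto)
  also have "\<dots> = (\<Sum>i\<in>UNIV. D (\<lambda>y. (a y $ i) *\<^sub>R L (axis i 1) y) x v)"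
    by (intro D_sum differentiable_bilinear[OF bounded_bilinear_scaleR] dL da')
  also have "\<dots> = (\<Sum>i\<in>UNIV. (a x $ i) *\<^sub>R D (L (axis i 1)) x v + (D a x v $ i) *\<^sub>R L (axis i 1) x)"
    by (simp add: D_bilinear[OF bounded_bilinear_scaleR da' dL] D_nth[OF da])
  also have "\<dots> = D (L (a x)) x v + L (D a x v) x"
    unfolding sum.distrib 1[symmetric] e[OF x, symmetric] ..
  finally show "D (\<lambda>y. L (a y) y) x v = L (D a x v) x + D (L (a x)) x v" by simp
qed

lemma D_D_along:
  fixes F :: "real^'n \<Rightarrow> 'b::real_normed_vector"
  assumes S: "open S" and F: "smooth_on S F" and b: "smooth_on S b" and x: "x \<in> S"
  shows "D (\<lambda>y. D F y (b y)) x v = D F x (D b x v) + D (\<lambda>y. D F y (b x)) x v"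
proof (rule smooth_on_linear_family(2)[where L = "\<lambda>u y. D F y u", OF S _ _ b x])
  show "linear (\<lambda>u. D F y u)" if "y \<in> S" for y
    using linear_frechet_derivative[OF smooth_on_differentiable[OF F S that]] .
  show "smooth_on S (\<lambda>y. D F y u)" for u by (rule smooth_on_D[OF F])
qed

context metric_patch
begin

lemma smooth_conn_along:
  assumes "open T" "T \<subseteq> \<Omega>" "smooth_on T a"
  shows "smooth_on T (\<lambda>y. conn (a y) y)"
    and "x \<in> T \<Longrightarrow> D (\<lambda>y. conn (a y) y) x v = conn (D a x v) x + D (conn (a x)) x v"
  using smooth_on_linear_family[where L = conn, OF assms(1) _ _ assms(3)]
    conn_linear assms(2) smooth_on_subset[OF smooth_conn assms(2)] by blast+

definition covd :: "(real^'n \<Rightarrow> real^'n) \<Rightarrow> (real^'n \<Rightarrow> real^'n) \<Rightarrow> real^'n \<Rightarrow> real^'n" where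
  "covd a b x = D b x (a x) + conn (a x) x *v b x"

lemma smooth_covd:
  assumes "open T" "T \<subseteq> \<Omega>" "smooth_on T a" "smooth_on T b"
  shows "smooth_on T (covd a b)"
  unfolding covd_def[abs_def]
  by (intro smooth_on_add smooth_on_mv smooth_on_D_along smooth_conn_along assms)

lemma D_inner_G:
  assumes T: "open T" "T \<subseteq> \<Omega>" and b: "smooth_on T b" and c: "smooth_on T c" and x: "x \<in> T"
  shows "D (\<lambda>y. b y \<bullet> (G y *v c y)) x v
    = D b x v \<bullet> (G x *v c x) + b x \<bullet> (D G x v *v c x) + b x \<bullet> (G x *v D c x v)"
proof -
  have d: "b differentiable (at x)" "c differentiable (at x)" "G differentiable (at x)"
    using smooth_on_differentiable[OF b T(1) x] smooth_on_differentiable[OF c T(1) x] differentiable_G x T by blast+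
  show ?thesis
    by (simp add: D_bilinear[OF bounded_bilinear_inner d(1) differentiable_bilinear[OF mv.bounded_bilinear_axioms d(3,2)]]
        D_bilinear[OF mv.bounded_bilinear_axioms d(3,2)] inner_add_right)
qed

text \<open>The derivatives of the components cancel except for that of b along a, which is counted
  twice; the derivatives of G assemble to twice the Christoffel form.\<close>

lemma koszul_identity:
  assumes T: "open T" "T \<subseteq> \<Omega>" and a: "smooth_on T a" and b: "smooth_on T b" and c: "smooth_on T c" and x: "x \<in> T"
  shows "D (\<lambda>y. b y \<bullet> (G y *v c y)) x (a x) + D (\<lambda>y. a y \<bullet> (G y *v c y)) x (b x)
    - D (\<lambda>y. a y \<bullet> (G y *v b y)) x (c x)
    + (D b x (a x) - D a x (b x)) \<bullet> (G x *v c x) - (D c x (a x) - D a x (c x)) \<bullet> (G x *v b x)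
    - (D c x (b x) - D b x (c x)) \<bullet> (G x *v a x) = 2 * (covd a b x \<bullet> (G x *v c x))"
proof -
  have x': "x \<in> \<Omega>" using x T by blast
  have s: "u \<bullet> (G x *v w) = w \<bullet> (G x *v u)" for u w by (rule inner_matrix_vector_sym[OF sym_G[OF x']])
  have "covd a b x \<bullet> (G x *v c x) = D b x (a x) \<bullet> (G x *v c x) + c x \<bullet> (G x *v (conn (a x) x *v b x))"
    by (simp add: covd_def inner_add_left s[of "conn (a x) x *v b x"])
  then show ?thesis
    unfolding D_inner_G[OF T b c x] D_inner_G[OF T a c x] D_inner_G[OF T a b x] conn_metric[OF x'] christoffel_def
    using s[of "b x" "D c x (a x)"] s[of "a x" "D c x (b x)"] s[of "a x" "D b x (c x)"]
    by (simp add: inner_diff_left inner_diff_right)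
qed

text \<open>Tensoriality of the curvature: second derivatives of c cancel by symmetry, first
  derivatives of a and b against the bracket term, first derivatives of c against each
  other.\<close>

lemma curvature_identity:
  assumes T: "open T" "T \<subseteq> \<Omega>" and a: "smooth_on T a" and b: "smooth_on T b" and c: "smooth_on T c" and x: "x \<in> T"
  shows "covd a (covd b c) x - covd b (covd a c) x - covd (\<lambda>y. D b y (a y) - D a y (b y)) c x
    = curv (a x) (b x) x *v c x"
proof -
  have x': "x \<in> \<Omega>" using x T by blast
  note sd = smooth_on_differentiable[OF _ T(1) x]
  note lin = linear_diff[OF linear_frechet_derivative[OF sd[OF c]]] linear_diff[OF conn_linear[OF x']]
  \<comment> \<open>Expanded for arbitrary fields, so that it applies to (a, b) and to (b,
    a).\<close>
  have e: "covd a (covd b c) x = D c x (D b x (a x)) + D (\<lambda>y. D c y (b x)) x (a x)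
    + (conn (b x) x *v D c x (a x) + (conn (D b x (a x)) x + D (conn (b x)) x (a x)) *v c x)
    + conn (a x) x *v (D c x (b x) + conn (b x) x *v c x)" if "smooth_on T a" "smooth_on T b" for a b
  proof -
    have 1: "D (\<lambda>y. conn (b y) y *v c y) x (a x) =
        conn (b x) x *v D c x (a x) + (conn (D b x (a x)) x + D (conn (b x)) x (a x)) *v c x"
      using D_bilinear[OF mv.bounded_bilinear_axioms sd[OF smooth_conn_along(1)[OF T that(2)]] sd[OF c]]
        smooth_conn_along(2)[OF T that(2) x] by simp
    have "D (covd b c) x (a x) = D (\<lambda>y. D c y (b y)) x (a x) + D (\<lambda>y. conn (b y) y *v c y) x (a x)"
      unfolding covd_def[abs_def]
      by (intro D_add sd smooth_on_mv smooth_on_D_along smooth_conn_along T that c)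
    then show ?thesis
      unfolding covd_def[of a] 1 D_D_along[OF T(1) c that(2) x] by (simp add: covd_def)
  qed
  have "D (\<lambda>y. D c y (b x)) x (a x) = D (\<lambda>y. D c y (a x)) x (b x)"
    by (rule D_D_sym[OF T(1) c x])
  then show ?thesis
    unfolding e[OF a b] e[OF b a]
    by (simp add: covd_def curv_def lin mv.add_left mv.add_right mv.diff_left matrix_vector_mul_assoc algebra_simps)
qed

text \<open>The Lie derivative of g is the symmetrised covariant derivative of the field. The
  derivatives of b and c drop out, and \<open>DG_conn\<close> resolves the derivative of G.\<close>

lemma lie_derivative_identity:
  assumes T: "open T" "T \<subseteq> \<Omega>" and a: "smooth_on T a" and b: "smooth_on T b" and c: "smooth_on T c" and x: "x \<in> T"
  shows "D (\<lambda>y. b y \<bullet> (G y *v c y)) x (a x) - (D b x (a x) - D a x (b x)) \<bullet> (G x *v c x)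
    - b x \<bullet> (G x *v (D c x (a x) - D a x (c x)))
    = b x \<bullet> ((G x ** nabla a x + transpose (nabla a x) ** G x) *v c x)"
proof -
  have x': "x \<in> \<Omega>" using x T by blast
  have "linear (\<lambda>u. D a x u + conn u x *v a x)"
    using linear_frechet_derivative[OF smooth_on_differentiable[OF a T(1) x]]
    by (intro linearI) (simp_all add: linear_add linear_scale linear_add[OF conn_linear[OF x']]
        linear_scale[OF conn_linear[OF x']] mv.add_left mv.scaleR_left scaleR_add_right)
  \<comment> \<open>By torsion freeness u and a x change places under \<open>conn\<close>, which
    gives the shape in which \<open>DG_conn\<close> delivers the Christoffel terms.\<close>
  then have n: "nabla a x *v u = D a x u + conn (a x) x *v u" for u
    unfolding nabla_def using matrix_works conn_sym[OF x'] by fastforce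
  have t: "b x \<bullet> ((transpose N ** G x) *v w) = (N *v b x) \<bullet> (G x *v w)" for N w
    by (metis dot_lmul_matrix inner_commute matrix_vector_mul_assoc transpose_matrix_vector)
  have "b x \<bullet> (D G x (a x) *v c x) = b x \<bullet> (G x *v (conn (a x) x *v c x)) + (conn (a x) x *v b x) \<bullet> (G x *v c x)"
    unfolding DG_conn[OF x'] mv.add_left inner_add_right t by (simp add: matrix_vector_mul_assoc)
  then show ?thesis
    unfolding D_inner_G[OF T b c x] mv.add_left inner_add_right t
    by (simp add: n matrix_vector_mul_assoc[symmetric] inner_diff_left mv.diff_right inner_diff_right
        inner_add_left mv.add_right inner_add_right)
qed

text \<open>The outer products of the e_i add up to H for every orthonormal basis; this makes the
  choice in \<open>onb\<close> immaterial.\<close>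

lemma trace_orthonormal:
  fixes e :: "'n \<Rightarrow> real^'n"
  assumes x: "x \<in> \<Omega>" and e: "\<And>i j. e i \<bullet> (G x *v e j) = (if i = j then 1 else 0)"
  shows "(\<Sum>i\<in>UNIV. e i \<bullet> (B *v e i)) = trace (B ** H x)"
proof -
  have "(\<Sum>i\<in>UNIV. e i \<bullet> (B *v e i)) = (\<Sum>i\<in>UNIV. \<Sum>k\<in>UNIV. \<Sum>l\<in>UNIV. B $ k $ l * (e i $ k * e i $ l))"
    by (simp add: inner_vec_def matrix_vector_mult_def sum_distrib_left algebra_simps)
  also have "\<dots> = (\<Sum>k\<in>UNIV. \<Sum>i\<in>UNIV. \<Sum>l\<in>UNIV. B $ k $ l * (e i $ k * e i $ l))"
    by (rule sum.swap)
  also have "\<dots> = (\<Sum>k\<in>UNIV. \<Sum>l\<in>UNIV. \<Sum>i\<in>UNIV. B $ k $ l * (e i $ k * e i $ l))"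
    by (intro sum.cong refl sum.swap)
  also have "\<dots> = (\<Sum>k\<in>UNIV. \<Sum>l\<in>UNIV. B $ k $ l * H x $ k $ l)"
    unfolding sum_distrib_left[symmetric] orthonormal_basis_gram(2)[OF e] H_def ..
  also have "\<dots> = trace (B ** transpose (H x))"
    by (simp add: trace_def matrix_matrix_mult_def transpose_def)
  finally show ?thesis by (simp add: sym_H x)
qed

lemma curv_linear:
  assumes x: "x \<in> \<Omega>" shows "linear (\<lambda>u. curv u v x)"
proof -
  have dl: "linear (\<lambda>u. D (conn u) x v)" for v
  proof -
    have d: "conn u differentiable (at x)" for u by (rule differentiable_conn[OF x])
    have "D (conn (u + w)) x v = D (\<lambda>y. conn u y + conn w y) x v" for u w
      by (subst D_cong[OF open_\<Omega> x, of _ "\<lambda>y. conn u y + conn w y"]) (use linear_add[OF conn_linear] in auto)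
    moreover have "D (conn (r *\<^sub>R u)) x v = D (\<lambda>y. r *\<^sub>R conn u y) x v" for r u
      by (subst D_cong[OF open_\<Omega> x, of _ "\<lambda>y. r *\<^sub>R conn u y"]) (use linear_scale[OF conn_linear] in auto)
    ultimately show ?thesis
      by (intro linearI) (simp_all add: D_add d D_bounded_linear[OF bounded_linear_scaleR_right])
  qed
  have d2: "linear (D (conn v) x)" by (rule linear_frechet_derivative[OF differentiable_conn[OF x]])
  show ?thesis
    by (rule linearI)
      (simp_all add: curv_def linear_add[OF dl] linear_scale[OF dl] linear_add[OF d2] linear_scale[OF d2]
        linear_add[OF conn_linear[OF x]] linear_scale[OF conn_linear[OF x]] mm.add_left mm.add_right
        mm.scaleR_left mm.scaleR_right algebra_simps)
qed

text \<open>For the matrix C of z |-> R (z, u) w the orthonormal trace is that of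
  \<open>G x ** C ** H x\<close>, by cyclicity the coordinate trace of C. Expanding u along the axes
  then meets the definition of \<open>ric\<close>.\<close>

lemma ric_trace:
  fixes e :: "'n \<Rightarrow> real^'n"
  assumes x: "x \<in> \<Omega>" and e: "\<And>i j. e i \<bullet> (G x *v e j) = (if i = j then 1 else 0)"
  shows "(\<Sum>i\<in>UNIV. (curv (e i) u x *v w) \<bullet> (G x *v e i)) = u \<bullet> (ric x *v w)"
proof -
  define C where "C = matrix (\<lambda>z. curv z u x *v w)"
  have lin: "linear (\<lambda>z. curv z u x *v w)"
    by (rule linearI) (simp_all add: linear_add[OF curv_linear[OF x]] linear_scale[OF curv_linear[OF x]] mv.add_left mv.scaleR_left)
  then have C: "C *v z = curv z u x *v w" for z unfolding C_def by (simp add: matrix_works)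
  have "(curv (e i) u x *v w) \<bullet> (G x *v e i) = e i \<bullet> ((G x ** C) *v e i)" for i
    by (metis C inner_matrix_vector_sym matrix_vector_mul_assoc sym_G x)
  then have "(\<Sum>i\<in>UNIV. (curv (e i) u x *v w) \<bullet> (G x *v e i)) = trace (G x ** C ** H x)"
    by (simp add: trace_orthonormal[OF x e])
  also have "\<dots> = trace C"
    using trace_mul_sym[of "G x ** C" "H x"] by (simp add: matrix_mul_assoc HG x)
  also have "\<dots> = (\<Sum>k\<in>UNIV. \<Sum>l\<in>UNIV. curv (axis k 1) u x $ k $ l * w $ l)"
    by (simp add: C_def trace_def matrix_def matrix_vector_mult_def)
  also have "\<dots> = (\<Sum>k\<in>UNIV. \<Sum>l\<in>UNIV. \<Sum>j\<in>UNIV. u $ j * (curv (axis k 1) (axis j 1) x $ k $ l * w $ l))"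
  proof (intro sum.cong refl)
    fix k l
    have "linear (\<lambda>v. curv (axis k 1) v x)"
      using linear_compose_neg[OF curv_linear[OF x]] curv_skew[of "axis k 1"] by simp
    then have "curv (axis k 1) u x = (\<Sum>j\<in>UNIV. (u $ j) *\<^sub>R curv (axis k 1) (axis j 1) x)"
      by (rule linear_expand_axis)
    then show "curv (axis k 1) u x $ k $ l * w $ l = (\<Sum>j\<in>UNIV. u $ j * (curv (axis k 1) (axis j 1) x $ k $ l * w $ l))"
      by (simp add: sum_distrib_right mult.assoc)
  qed
  also have "\<dots> = (\<Sum>j\<in>UNIV. u $ j * (\<Sum>l\<in>UNIV. (\<Sum>k\<in>UNIV. curv (axis k 1) (axis j 1) x $ k $ l) * w $ l))"
  proof -
    have "(\<Sum>k\<in>UNIV. \<Sum>l\<in>UNIV. \<Sum>j\<in>UNIV. f k l j) = (\<Sum>j\<in>UNIV. \<Sum>l\<in>UNIV. \<Sum>k\<in>UNIV. f k l j)"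
      for f :: "'n \<Rightarrow> 'n \<Rightarrow> 'n \<Rightarrow> real"
    proof -
      have "(\<Sum>k\<in>UNIV. \<Sum>l\<in>UNIV. \<Sum>j\<in>UNIV. f k l j) = (\<Sum>l\<in>UNIV. \<Sum>k\<in>UNIV. \<Sum>j\<in>UNIV. f k l j)" by (rule sum.swap)
      also have "\<dots> = (\<Sum>l\<in>UNIV. \<Sum>j\<in>UNIV. \<Sum>k\<in>UNIV. f k l j)" by (intro sum.cong refl sum.swap)
      also have "\<dots> = (\<Sum>j\<in>UNIV. \<Sum>l\<in>UNIV. \<Sum>k\<in>UNIV. f k l j)" by (rule sum.swap)
      finally show ?thesis .
    qed
    then show ?thesis by (simp only: sum_distrib_left sum_distrib_right)
  qed
  also have "\<dots> = u \<bullet> (ric x *v w)"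
    by (simp add: inner_vec_def matrix_vector_mult_def ric_def)
  finally show ?thesis .
qed

lemma scal_eq: "x \<in> \<Omega> \<Longrightarrow> scal x = trace (ric x ** H x)"
  by (simp add: scal_def ricop_def trace_transpose)

lemma ricop_metric:
  assumes x: "x \<in> \<Omega>"
  shows "(ricop x *v u) \<bullet> (G x *v w) = u \<bullet> (ric x *v w)"
proof -
  have "(ricop x *v u) \<bullet> (G x *v w) = u \<bullet> ((ric x ** H x) *v (G x *v w))"
    unfolding ricop_def transpose_matrix_vector by (rule dot_lmul_matrix)
  also have "\<dots> = u \<bullet> ((ric x ** (H x ** G x)) *v w)" by (simp add: matrix_vector_mul_assoc matrix_mul_assoc)
  finally show ?thesis by (simp add: HG x)
qed

text \<open>B stands for the covariant derivative of the potential field. Its adjoint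
  \<open>H x ** transpose B ** G x\<close> has the same trace as B, also after multiplication by the
  self-adjoint \<open>ricop x\<close>.\<close>

lemma soliton_algebra:
  assumes x: "x \<in> \<Omega>"
    and sol: "ric x + (1/2) *\<^sub>R (G x ** B + transpose B ** G x) = \<mu> *\<^sub>R G x"
  shows "\<mu> * scal x - trace (transpose (ricop x) ** G x ** ricop x ** H x) - 1/2 * scal x * (real CARD('n) * \<mu> - scal x)
     = trace (einstein x ** B)"
proof -
  let ?R = "ric x" and ?G = "G x" and ?H = "H x" and ?Q = "ricop x"
  have R: "?R = \<mu> *\<^sub>R ?G - (1/2) *\<^sub>R (?G ** B + transpose B ** ?G)"
    using sol by (simp add: eq_diff_eq)
  \<comment> \<open>The symmetry of Ricci comes from the soliton equation itself, whose other terms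
    are symmetric.\<close>
  have symR: "transpose ?R = ?R"
    unfolding R by (simp add: transpose_diff transpose_add transpose_scalar matrix_transpose_mul sym_G x add.commute)
  have Q: "?Q = ?H ** ?R" by (simp add: ricop_def matrix_transpose_mul symR sym_H x)
  then have GQ: "?G ** ?Q = ?R" by (simp add: matrix_mul_assoc GH x)
  have Qe: "?Q = \<mu> *\<^sub>R mat 1 - (1/2) *\<^sub>R (B + ?H ** transpose B ** ?G)"
    unfolding Q by (subst R) (simp add: mm.diff_right mm.scaleR_right mm.add_right matrix_mul_assoc HG x)
  have "trace (?H ** transpose B ** ?G) = trace (?G ** ?H ** transpose B)"
    using trace_mul_sym[of "?H ** transpose B" ?G] by (simp add: matrix_mul_assoc)
  then have t1: "trace (?H ** transpose B ** ?G) = trace B" by (simp add: GH x trace_transpose)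
  have scale: "trace (r *\<^sub>R A) = r * trace A" for r and A :: "real^'n^'n"
    by (simp add: trace_def sum_distrib_left)
  have S: "scal x = real CARD('n) * \<mu> - trace B"
    unfolding scal_def by (subst Qe) (simp add: trace_sub trace_add scale trace_I t1)
  have "trace (?Q ** (?H ** transpose B ** ?G)) = trace (?R ** ?H ** transpose B)"
    using trace_mul_sym[of "?Q ** ?H ** transpose B" ?G] by (simp add: matrix_mul_assoc GQ)
  also have "\<dots> = trace (transpose (?R ** ?H ** transpose B))" by (simp add: trace_transpose)
  also have "\<dots> = trace (B ** ?Q)" by (simp add: matrix_transpose_mul sym_H symR x Q)
  also have "\<dots> = trace (?Q ** B)" by (rule trace_mul_sym)
  finally have t2: "trace (?Q ** (?H ** transpose B ** ?G)) = trace (?Q ** B)" .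
  have "trace (?Q ** ?Q) = trace (?Q ** (\<mu> *\<^sub>R mat 1 - (1/2) *\<^sub>R (B + ?H ** transpose B ** ?G)))"
    using Qe by simp
  also have "\<dots> = \<mu> * scal x - trace (?Q ** B)"
    by (simp add: mm.diff_right mm.scaleR_right mm.add_right trace_sub trace_add scale t2 scal_def)
  finally have QQ: "trace (?Q ** ?Q) = \<mu> * scal x - trace (?Q ** B)" .
  have "trace (transpose ?Q ** ?G ** ?Q ** ?H) = trace (?R ** ?H ** ?R ** ?H)"
    using GQ by (simp add: ricop_def matrix_mul_assoc[symmetric] GQ)
  also have "\<dots> = trace (?Q ** ?Q)"
    using trace_mul_sym[of "?R ** ?H ** ?R" ?H] by (simp add: Q matrix_mul_assoc)
  finally have N: "trace (transpose ?Q ** ?G ** ?Q ** ?H) = \<mu> * scal x - trace (?Q ** B)" using QQ by simp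
  have "trace (einstein x ** B) = trace (?Q ** B) - scal x / 2 * trace B"
    by (simp add: einstein_def mm.diff_left mm.scaleR_left trace_sub scale)
  moreover have "real CARD('n) * \<mu> - scal x = trace B" using S by simp
  ultimately show ?thesis unfolding N by simp
qed

end

section \<open>Charts, vector fields and curvature\<close>

text \<open>One chart is fixed throughout; overlaps are treated by interpreting the locale a second
  time.\<close>

locale mfd_chart =
  fixes M :: "('a, 'n::finite) charted_space" and U :: "'a set" and \<phi> :: "'a \<Rightarrow> real^'n"
  assumes mfd: "smooth_manifold M" and chart: "(U, \<phi>) \<in> atlas M"
begin

abbreviation "pt \<equiv> inv_into U \<phi>"
abbreviation "cv \<equiv> chart_vec M (U, \<phi>)"

lemma openin_U: "openin (mtop M) U" and open_image_U: "open (\<phi> ` U)"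
  and homeo: "homeomorphic_map (subtopology (mtop M) U) (top_of_set (\<phi> ` U)) \<phi>"
  using mfd chart unfolding smooth_manifold_def by auto

lemma U_points: "U \<subseteq> points M"
  using openin_U openin_subset by blast

lemma inj_\<phi>: "inj_on \<phi> U"
  using homeomorphic_imp_injective_map[OF homeo] U_points by (simp add: Int_absorb1)

lemma pt [simp]: "p \<in> U \<Longrightarrow> pt (\<phi> p) = p" and \<phi>_pt [simp]: "x \<in> \<phi> ` U \<Longrightarrow> \<phi> (pt x) = x"
  and pt_U: "x \<in> \<phi> ` U \<Longrightarrow> pt x \<in> U"
  using inj_\<phi> by (auto simp: f_inv_into_f inv_into_into)

lemma \<phi>_image_pt: "T \<subseteq> \<phi> ` U \<Longrightarrow> \<phi> ` pt ` T = T"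
  by (force simp: image_iff subset_iff)

lemma pt_image_\<phi>: "W \<subseteq> U \<Longrightarrow> pt ` \<phi> ` W = W"
  by (force simp: image_iff subset_iff)

lemma open_image:
  assumes "openin (mtop M) W" "W \<subseteq> U" shows "open (\<phi> ` W)"
proof -
  have "openin (subtopology (mtop M) U) W"
    using assms openin_open_subtopology[OF openin_U] by blast
  then have "openin (top_of_set (\<phi> ` U)) (\<phi> ` W)"
    using homeomorphic_map_openness[OF homeo, of W] assms U_points by auto
  then show ?thesis using open_image_U openin_open_trans by blast
qed

lemma openin_pt:
  assumes "open T" "T \<subseteq> \<phi> ` U" shows "openin (mtop M) (pt ` T)"
proof -
  have sub: "pt ` T \<subseteq> U" using assms(2) pt_U by blast
  have "openin (top_of_set (\<phi> ` U)) (\<phi> ` pt ` T)"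
    unfolding \<phi>_image_pt[OF assms(2)] using assms by (simp add: openin_open_eq open_image_U)
  then have "openin (subtopology (mtop M) U) (pt ` T)"
    using homeomorphic_map_openness[OF homeo, of "pt ` T"] sub U_points by auto
  then show ?thesis using openin_open_subtopology[OF openin_U] by blast
qed

lemma transition_smooth:
  assumes "(V, \<psi>) \<in> atlas M"
  shows "smooth_on (\<phi> ` (U \<inter> V)) (\<psi> \<circ> pt)"
  using mfd chart assms unfolding smooth_manifold_def by auto

lemma openin_Int_U: "openin (mtop M) W \<Longrightarrow> openin (mtop M) (U \<inter> W)"
  using openin_U by blast

lemma smooth_funD: "smooth_fun M W f \<Longrightarrow> smooth_on (\<phi> ` (U \<inter> W)) (f \<circ> pt)"
  using chart unfolding smooth_fun_def by auto

text \<open>As W lies in U, every other chart that the definition asks about is reached through a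
  smooth transition map.\<close>

lemma smooth_funI:
  assumes W: "openin (mtop M) W" "W \<subseteq> U" and f: "smooth_on (\<phi> ` W) (f \<circ> pt)"
  shows "smooth_fun M W f"
  unfolding smooth_fun_def
proof (safe)
  fix V \<psi> assume V: "(V, \<psi>) \<in> atlas M"
  interpret c: mfd_chart M V \<psi> by standard (use mfd V in auto)
  have o: "open (\<psi> ` (V \<inter> W))" by (rule c.open_image) (use c.openin_Int_U[OF W(1)] in auto)
  have "smooth_on (\<psi> ` (V \<inter> W)) (\<lambda>x. (f \<circ> pt) ((\<phi> \<circ> c.pt) x))"
  proof (rule smooth_on_compose[OF o open_image[OF W] f])
    show "smooth_on (\<psi> ` (V \<inter> W)) (\<phi> \<circ> c.pt)"
      by (rule smooth_on_subset[OF c.transition_smooth[OF chart]]) (use W in auto)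
    show "(\<phi> \<circ> c.pt) ` \<psi> ` (V \<inter> W) \<subseteq> \<phi> ` W" by auto
  qed
  then show "smooth_on (\<psi> ` (V \<inter> W)) (f \<circ> c.pt)"
    by (subst smooth_on_cong[OF o, of _ "\<lambda>x. (f \<circ> pt) ((\<phi> \<circ> c.pt) x)"]) (use W in auto)
qed

lemma smooth_nearI:
  assumes "open T" "T \<subseteq> \<phi> ` U" "x \<in> T" "smooth_on T F" "\<And>y. y \<in> T \<Longrightarrow> f (pt y) = F y"
  shows "smooth_near M (pt x) f"
  unfolding smooth_near_def
proof (intro exI conjI)
  show "openin (mtop M) (pt ` T)" by (rule openin_pt[OF assms(1,2)])
  show "pt x \<in> pt ` T" using assms by blast
  have "smooth_on T (f \<circ> pt)"
    by (subst smooth_on_cong[OF assms(1), of _ F]) (use assms in auto)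
  then show "smooth_fun M (pt ` T) f"
    using assms by (intro smooth_funI openin_pt) (auto simp: \<phi>_image_pt pt_U)
qed

lemma smooth_nearE:
  assumes "smooth_near M (pt x) f" "x \<in> \<phi> ` U"
  obtains T where "open T" "T \<subseteq> \<phi> ` U" "x \<in> T" "smooth_on T (f \<circ> pt)"
proof -
  obtain W where W: "openin (mtop M) W" "pt x \<in> W" "smooth_fun M W f"
    using assms unfolding smooth_near_def by blast
  show ?thesis
  proof (rule that)
    show "open (\<phi> ` (U \<inter> W))" by (rule open_image[OF openin_Int_U[OF W(1)]]) auto
    show "x \<in> \<phi> ` (U \<inter> W)" using assms W by (intro image_eqI[of _ _ "pt x"]) (auto simp: pt_U)
  qed (use smooth_funD[OF W(3)] in auto)
qed

text \<open>A tangent vector sees f only near the point, so any smooth F that represents f there may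
  be differentiated instead.\<close>

lemma cv_apply:
  assumes "open T" "T \<subseteq> \<phi> ` U" "x \<in> T" "smooth_on T F" "\<And>y. y \<in> T \<Longrightarrow> f (pt y) = F y"
  shows "cv (pt x) u f = D F x u"
proof -
  have "D (f \<circ> pt) x = D F x" by (rule D_cong[OF assms(1,3)]) (use assms in auto)
  then show ?thesis
    using smooth_nearI[OF assms] assms by (auto simp: chart_vec_def subset_iff)
qed

lemma cv_not_near: "\<not> smooth_near M p f \<Longrightarrow> cv p u f = 0"
  by (simp add: chart_vec_def)

lemma cv_linear:
  assumes "p \<in> U" shows "cv p (a *\<^sub>R u + b *\<^sub>R v) = (\<lambda>f. a * cv p u f + b * cv p v f)"
proof
  fix f
  show "cv p (a *\<^sub>R u + b *\<^sub>R v) f = a * cv p u f + b * cv p v f"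
  proof (cases "smooth_near M p f")
    case True
    then obtain T where T: "open T" "T \<subseteq> \<phi> ` U" "\<phi> p \<in> T" "smooth_on T (f \<circ> pt)"
      using assms smooth_nearE[of "\<phi> p" f] by auto
    have "(f \<circ> pt) differentiable (at (\<phi> p))" by (rule smooth_on_differentiable[OF T(4,1,3)])
    then show ?thesis using True by (simp add: chart_vec_def D_linear)
  qed (simp add: cv_not_near)
qed

text \<open>Recovers the components of a tangent vector from its values on the coordinate functions,
  which are smooth near every point of U whatever \<phi> is elsewhere.\<close>

definition coords :: "'a tvec \<Rightarrow> real^'n" where
  "coords v = (\<chi> i. v (\<lambda>q. \<phi> q $ i))"

lemma coords_cv: assumes "p \<in> U" shows "coords (cv p u) = u"
proof -
  have "cv (pt (\<phi> p)) u (\<lambda>q. \<phi> q $ i) = D (\<lambda>x. x $ i) (\<phi> p) u" for i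
    using assms by (intro cv_apply[OF open_image_U] smooth_on_nth smooth_on_id open_image_U) auto
  also have "\<dots> i = u $ i" for i
    by (subst D_nth) auto
  finally show ?thesis using assms by (simp add: coords_def)
qed

text \<open>The chain rule for the transition map; on functions that are not smooth near p both
  sides are 0 by convention.\<close>

lemma chart_vec_change:
  assumes V: "(V, \<psi>) \<in> atlas M" and p: "p \<in> U" "p \<in> V"
  shows "chart_vec M (V, \<psi>) p u = cv p (D (\<phi> \<circ> inv_into V \<psi>) (\<psi> p) u)"
proof
  fix f
  interpret c: mfd_chart M V \<psi> by standard (use mfd V in auto)
  show "chart_vec M (V, \<psi>) p u f = cv p (D (\<phi> \<circ> inv_into V \<psi>) (\<psi> p) u) f"
  proof (cases "smooth_near M p f")
    case True
    then obtain T where T: "open T" "T \<subseteq> \<phi> ` U" "\<phi> p \<in> T" "smooth_on T (f \<circ> pt)"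
      using p smooth_nearE[of "\<phi> p" f] by auto
    have d1: "(f \<circ> pt) differentiable (at ((\<phi> \<circ> c.pt) (\<psi> p)))"
      using smooth_on_differentiable[OF T(4,1,3)] p by simp
    have o: "open (\<psi> ` (V \<inter> U))" by (rule c.open_image[OF c.openin_Int_U[OF openin_U]]) auto
    have d2: "(\<phi> \<circ> c.pt) differentiable (at (\<psi> p))"
      by (rule smooth_on_differentiable[OF c.transition_smooth[OF chart] o]) (use p in auto)
    have "D (f \<circ> c.pt) (\<psi> p) = D ((f \<circ> pt) \<circ> (\<phi> \<circ> c.pt)) (\<psi> p)"
      by (rule D_cong[OF o]) (use p in auto)
    also have "\<dots> = D (f \<circ> pt) (\<phi> p) \<circ> D (\<phi> \<circ> c.pt) (\<psi> p)"
      unfolding frechet_derivative_compose[OF d2 d1] using p by (simp only: o_apply c.pt)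
    finally show ?thesis using True by (simp add: chart_vec_def)
  qed (simp add: chart_vec_def)
qed

text \<open>\<open>tangent_space\<close> collects vectors from all charts at p, and
  \<open>chart_vec_change\<close> brings each of them into the fixed one.\<close>

lemma tangent_space_eq:
  assumes "p \<in> U" shows "tangent_space M p = range (cv p)"
proof
  show "tangent_space M p \<subseteq> range (cv p)"
    unfolding tangent_space_def using chart_vec_change assms by fastforce
  show "range (cv p) \<subseteq> tangent_space M p"
    unfolding tangent_space_def using chart assms by fastforce
qed

lemma cv_tangent: "p \<in> U \<Longrightarrow> cv p u \<in> tangent_space M p"
  by (simp add: tangent_space_eq)

lemma cv_coords: "p \<in> U \<Longrightarrow> v \<in> tangent_space M p \<Longrightarrow> cv p (coords v) = v"
  using tangent_space_eq coords_cv by auto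

lemma cv_inject: "p \<in> U \<Longrightarrow> cv p u = cv p w \<longleftrightarrow> u = w"
  using coords_cv by metis

text \<open>\<open>vrep T X a\<close>: over the open set \<open>T\<close> of coordinates, \<open>X\<close> has the smooth components \<open>a\<close>.\<close>

definition vrep :: "(real^'n) set \<Rightarrow> 'a vfield \<Rightarrow> (real^'n \<Rightarrow> real^'n) \<Rightarrow> bool" where
  "vrep T X a \<longleftrightarrow> open T \<and> T \<subseteq> \<phi> ` U \<and> smooth_on T a \<and> (\<forall>x\<in>T. X (pt x) = cv (pt x) (a x))"

section \<open>Vector fields and brackets through local components\<close>

lemma vrepD:
  assumes "vrep T X a"
  shows "open T" "T \<subseteq> \<phi> ` U" "smooth_on T a" "x \<in> T \<Longrightarrow> X (pt x) = cv (pt x) (a x)"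
  using assms by (auto simp: vrep_def)

lemma vrep_subset: "vrep T X a \<Longrightarrow> open T' \<Longrightarrow> T' \<subseteq> T \<Longrightarrow> vrep T' X a"
  unfolding vrep_def using smooth_on_subset by blast

lemma vrep_apply:
  assumes "vrep T X a" "smooth_on T F" "\<And>y. y \<in> T \<Longrightarrow> f (pt y) = F y" "x \<in> T"
  shows "X (pt x) f = D F x (a x)"
  using vrepD[OF assms(1)] cv_apply[of T x F f] assms by auto

text \<open>The components are the results of applying X to the coordinate functions, and
  \<open>smooth_vfield\<close> makes such results smooth.\<close>

lemma smooth_vfield_vrep:
  assumes X: "smooth_vfield M W X" and W: "openin (mtop M) W"
  shows "vrep (\<phi> ` (U \<inter> W)) X (\<lambda>x. coords (X (pt x)))"
  unfolding vrep_def
proof (intro conjI ballI)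
  show o: "open (\<phi> ` (U \<inter> W))" by (rule open_image[OF openin_Int_U[OF W]]) auto
  show "\<phi> ` (U \<inter> W) \<subseteq> \<phi> ` U" by auto
  show "smooth_on (\<phi> ` (U \<inter> W)) (\<lambda>x. coords (X (pt x)))"
  proof (rule smooth_on_vec[OF o])
    fix i
    have "smooth_fun M (U \<inter> W) (\<lambda>q. \<phi> q $ i)"
    proof (rule smooth_funI[OF openin_Int_U[OF W]])
      have "smooth_on (\<phi> ` (U \<inter> W)) (\<lambda>x. x $ i)" by (intro smooth_on_nth smooth_on_id o)
      then show "smooth_on (\<phi> ` (U \<inter> W)) ((\<lambda>q. \<phi> q $ i) \<circ> pt)"
        by (subst smooth_on_cong[OF o, of _ "\<lambda>x. x $ i"]) auto
    qed auto
    then have "smooth_fun M (U \<inter> W) (\<lambda>p. X p (\<lambda>q. \<phi> q $ i))"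
      using X openin_Int_U[OF W] unfolding smooth_vfield_def by auto
    from smooth_funD[OF this] show "smooth_on (\<phi> ` (U \<inter> W)) (\<lambda>x. coords (X (pt x)) $ i)"
      by (simp add: coords_def o_def Int_assoc[symmetric])
  qed
  show "X (pt x) = cv (pt x) (coords (X (pt x)))" if "x \<in> \<phi> ` (U \<inter> W)" for x
    using that X cv_coords unfolding smooth_vfield_def by auto
qed

lemma smooth_vfield_near_vrep:
  assumes "smooth_vfield_near M p X" "p \<in> U"
  obtains T a where "\<phi> p \<in> T" "vrep T X a"
proof -
  obtain W where W: "openin (mtop M) W" "p \<in> W" "smooth_vfield M W X"
    using assms unfolding smooth_vfield_near_def by blast
  show ?thesis by (rule that[OF _ smooth_vfield_vrep[OF W(3,1)]]) (use W assms in auto)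
qed

lemma vrep_smooth_vfield:
  assumes "vrep T X a" shows "smooth_vfield M (pt ` T) X"
  unfolding smooth_vfield_def
proof (intro conjI ballI allI impI)
  note v = vrepD[OF assms]
  fix p assume "p \<in> pt ` T"
  then obtain x where x: "x \<in> T" "p = pt x" by blast
  then have "p \<in> U" using v(2) pt_U by blast
  then show "X p \<in> tangent_space M p" using v(4)[OF x(1)] cv_tangent x by simp
next
  note v = vrepD[OF assms]
  fix V f assume V: "openin (mtop M) V \<and> V \<subseteq> pt ` T \<and> smooth_fun M V f"
  then have VU: "V \<subseteq> U" using v pt_U by blast
  have o: "open (\<phi> ` V)" using V VU open_image by blast
  have VT: "\<phi> ` V \<subseteq> T" using V v(2) \<phi>_image_pt by (metis image_mono)
  have f: "smooth_on (\<phi> ` V) (f \<circ> pt)" using smooth_funD[of V f] V VU by (simp add: Int_absorb1)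
  have r: "vrep (\<phi> ` V) X a" by (rule vrep_subset[OF assms o VT])
  have "smooth_on (\<phi> ` V) (\<lambda>x. D (f \<circ> pt) x (a x))"
    by (intro smooth_on_D_along o f smooth_on_subset[OF v(3) VT])
  then have "smooth_on (\<phi> ` V) ((\<lambda>p. X p f) \<circ> pt)"
    by (subst smooth_on_cong[OF o, of _ "\<lambda>x. D (f \<circ> pt) x (a x)"]) (use vrep_apply[OF r f] in auto)
  then show "smooth_fun M V (\<lambda>p. X p f)"
    using V VU by (intro smooth_funI) auto
qed

lemma vrep_near: "vrep T X a \<Longrightarrow> x \<in> T \<Longrightarrow> smooth_vfield_near M (pt x) X"
  unfolding smooth_vfield_near_def
  by (intro exI[of _ "pt ` T"] conjI openin_pt imageI vrep_smooth_vfield) (auto simp: vrep_def)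

lemma vrep_const: "vrep (\<phi> ` U) (\<lambda>p. cv p u) (\<lambda>x. u)"
  by (simp add: vrep_def open_image_U smooth_on_const)

lemma extension_vrep:
  assumes "p \<in> U" "v \<in> tangent_space M p"
  obtains T a where "\<phi> p \<in> T" "vrep T (extension M p v) a" "a (\<phi> p) = coords v"
proof -
  \<comment> \<open>The field with constant components is a witness that the choice in
    \<open>extension\<close> has something to choose from.\<close>
  have "smooth_vfield_near M p (\<lambda>p. cv p (coords v)) \<and> cv p (coords v) = v"
    using vrep_near[OF vrep_const, of "\<phi> p" "coords v"] cv_coords[OF assms] assms by simp
  then have e: "smooth_vfield_near M p (extension M p v) \<and> extension M p v p = v"
    unfolding extension_def
    by (rule someI[where P = "\<lambda>X. smooth_vfield_near M p X \<and> X p = v"])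
  then obtain T a where T: "\<phi> p \<in> T" "vrep T (extension M p v) a"
    using smooth_vfield_near_vrep assms by blast
  then have "cv p (a (\<phi> p)) = v" using vrepD(4)[OF T(2,1)] e assms by simp
  then show ?thesis using that[OF T] coords_cv[OF assms(1)] by metis
qed

text \<open>Second derivatives of the test function cancel by symmetry, and only derivatives of the
  components remain. The guard in \<open>lie_bracket\<close> makes both sides 0 on functions not
  smooth near the point.\<close>

lemma vrep_lie_bracket:
  assumes X: "vrep T X a" and Y: "vrep T Y b"
  shows "vrep T (lie_bracket M X Y) (\<lambda>x. D b x (a x) - D a x (b x))"
  unfolding vrep_def
proof (intro conjI ballI)
  note v = vrepD[OF X] and w = vrepD[OF Y]
  show "open T" "T \<subseteq> \<phi> ` U" by fact+
  show "smooth_on T (\<lambda>x. D b x (a x) - D a x (b x))"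
    using v w by (intro smooth_on_diff smooth_on_D_along)
  fix x assume x: "x \<in> T"
  show "lie_bracket M X Y (pt x) = cv (pt x) (D b x (a x) - D a x (b x))"
  proof
    fix f
    show "lie_bracket M X Y (pt x) f = cv (pt x) (D b x (a x) - D a x (b x)) f"
    proof (cases "smooth_near M (pt x) f")
      case False
      then show ?thesis by (simp add: lie_bracket_def cv_not_near)
    next
      case True
      have xU: "x \<in> \<phi> ` U" using x v(2) by blast
      obtain T0 where T0: "open T0" "T0 \<subseteq> \<phi> ` U" "x \<in> T0" "smooth_on T0 (f \<circ> pt)"
        by (rule smooth_nearE[OF True xU])
      \<comment> \<open>The test function is smooth only near the point, so the computation takes
        place on a smaller set.\<close>
      define T' where "T' = T \<inter> T0"
      define F where "F = f \<circ> pt"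
      have T': "open T'" "T' \<subseteq> T" "x \<in> T'" using T0 v(1) x by (auto simp: T'_def)
      have F: "smooth_on T' F" unfolding F_def by (rule smooth_on_subset[OF T0(4)]) (simp add: T'_def)
      have Xr: "vrep T' X a" and Yr: "vrep T' Y b" using vrep_subset[OF X T'(1,2)] vrep_subset[OF Y T'(1,2)] .
      note a = vrepD(3)[OF Xr] and b = vrepD(3)[OF Yr]
      have fF: "f (pt y) = F y" for y by (simp add: F_def)
      have "X (pt x) (\<lambda>q. Y q f) = D (\<lambda>y. D F y (b y)) x (a x)"
        by (rule vrep_apply[OF Xr _ _ T'(3)])
          (intro smooth_on_D_along T' F b, rule vrep_apply[OF Yr F fF])
      moreover have "Y (pt x) (\<lambda>q. X q f) = D (\<lambda>y. D F y (a y)) x (b x)"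
        by (rule vrep_apply[OF Yr _ _ T'(3)])
          (intro smooth_on_D_along T' F a, rule vrep_apply[OF Xr F fF])
      moreover have "cv (pt x) (D b x (a x) - D a x (b x)) f = D F x (D b x (a x) - D a x (b x))"
        by (rule cv_apply[OF T'(1) _ T'(3) F fF]) (use T' v in auto)
      moreover have "D (\<lambda>y. D F y (b x)) x (a x) = D (\<lambda>y. D F y (a x)) x (b x)"
        by (rule D_D_sym_real[OF T'(1) F T'(3)])
      ultimately show ?thesis
        using True D_D_along[OF T'(1) F b T'(3), of "a x"] D_D_along[OF T'(1) F a T'(3), of "b x"]
          linear_diff[OF linear_frechet_derivative[OF smooth_on_differentiable[OF F T'(1,3)]]]
        by (simp add: lie_bracket_def)
    qed
  qed
qed

end

locale riemannian_chart = mfd_chart M U \<phi> for M :: "('a, 'n::finite) charted_space" and U \<phi> +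
  fixes g :: "'a metric_tensor"
  assumes metric: "riemannian_metric M g"
begin

section \<open>The metric, the Levi-Civita connection and the curvature in a chart\<close>

definition metric_of :: "real^'n \<Rightarrow> real^'n^'n" where
  "metric_of x = metric_matrix M g (U, \<phi>) (pt x)"

lemma g_sym: "p \<in> U \<Longrightarrow> u \<in> tangent_space M p \<Longrightarrow> v \<in> tangent_space M p \<Longrightarrow> g p u v = g p v u"
  using metric U_points unfolding riemannian_metric_def by blast

lemma g_lin: "p \<in> U \<Longrightarrow> u \<in> tangent_space M p \<Longrightarrow> v \<in> tangent_space M p \<Longrightarrow> w \<in> tangent_space M p \<Longrightarrow>
    g p (\<lambda>f. a * u f + b * v f) w = a * g p u w + b * g p v w"
  using metric U_points unfolding riemannian_metric_def by blast

lemma linear_g: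
  assumes "p \<in> U" "w \<in> tangent_space M p" shows "linear (\<lambda>u. g p (cv p u) w)"
proof (rule linearI)
  show "g p (cv p (u + v)) w = g p (cv p u) w + g p (cv p v) w" for u v
    using cv_linear[OF assms(1), of 1 u 1 v] g_lin[OF assms(1) cv_tangent[OF assms(1), of u] cv_tangent[OF assms(1), of v] assms(2), where a = 1 and b = 1] by simp
  show "g p (cv p (r *\<^sub>R u)) w = r *\<^sub>R g p (cv p u) w" for r u
    using cv_linear[OF assms(1), of r u 0 u] g_lin[OF assms(1) cv_tangent[OF assms(1), of u] cv_tangent[OF assms(1), of u] assms(2), where a = r and b = 0] by simp
qed

lemma g_cv:
  assumes p: "p \<in> U" shows "g p (cv p u) (cv p w) = u \<bullet> (metric_of (\<phi> p) *v w)"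
proof -
  have "g p (cv p u) (cv p w) = (\<Sum>i\<in>UNIV. u $ i * g p (cv p (axis i 1)) (cv p w))"
    using linear_expand_axis[OF linear_g[OF p cv_tangent[OF p]], of u w] by simp
  also have "\<dots> = (\<Sum>i\<in>UNIV. u $ i * (\<Sum>j\<in>UNIV. w $ j * g p (cv p (axis i 1)) (cv p (axis j 1))))"
  proof (intro sum.cong refl arg_cong2[where f = "(*)"])
    fix i
    have "g p (cv p (axis i 1)) (cv p w) = g p (cv p w) (cv p (axis i 1))"
      by (intro g_sym cv_tangent p)
    also have "\<dots> = (\<Sum>j\<in>UNIV. w $ j * g p (cv p (axis j 1)) (cv p (axis i 1)))"
      using linear_expand_axis[OF linear_g[OF p cv_tangent[OF p]], of w "axis i 1"] by simp
    also have "\<dots> = (\<Sum>j\<in>UNIV. w $ j * g p (cv p (axis i 1)) (cv p (axis j 1)))"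
      by (intro sum.cong refl arg_cong2[where f = "(*)"] g_sym cv_tangent p)
    finally show "g p (cv p (axis i 1)) (cv p w) = (\<Sum>j\<in>UNIV. w $ j * g p (cv p (axis i 1)) (cv p (axis j 1)))" .
  qed
  finally show ?thesis
    using p by (simp add: inner_vec_def matrix_vector_mult_def metric_of_def metric_matrix_def mult.commute)
qed

lemma smooth_metric_of: "smooth_on (\<phi> ` U) metric_of"
proof (intro smooth_on_vec open_image_U)
  fix i j
  have sv: "smooth_vfield M U (\<lambda>p. cv p u)" for u
    using vrep_smooth_vfield[OF vrep_const] pt_image_\<phi> by simp
  have "smooth_fun M U (\<lambda>p. g p (cv p (axis i 1)) (cv p (axis j 1)))"
    using metric openin_U sv[of "axis i 1"] sv[of "axis j 1"] unfolding riemannian_metric_def by (elim conjE allE impE) auto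
  from smooth_funD[OF this] show "smooth_on (\<phi> ` U) (\<lambda>x. metric_of x $ i $ j)"
    by (simp add: metric_of_def metric_matrix_def o_def)
qed

sublocale metric_patch "\<phi> ` U" metric_of
proof
  show "open (\<phi> ` U)" "smooth_on (\<phi> ` U) metric_of" by (fact open_image_U smooth_metric_of)+
  fix x assume x: "x \<in> \<phi> ` U"
  then have p: "pt x \<in> U" by (rule pt_U)
  show "transpose (metric_of x) = metric_of x"
    using g_sym[OF p cv_tangent[OF p] cv_tangent[OF p]] by (simp add: transpose_def metric_of_def metric_matrix_def vec_eq_iff)
  fix u :: "real^'n" assume "u \<noteq> 0"
  then have "cv (pt x) u \<noteq> cv (pt x) 0" using cv_inject[OF p] by simp
  moreover have "cv (pt x) 0 = (\<lambda>f. 0)" using cv_linear[OF p, of 0 0 0 0] by simp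
  ultimately have "0 < g (pt x) (cv (pt x) u) (cv (pt x) u)"
    using metric p U_points cv_tangent[OF p] unfolding riemannian_metric_def by (metis subsetD)
  then show "0 < u \<bullet> (metric_of x *v u)" using g_cv[OF p] x by simp
qed

lemma g_vrep:
  assumes "vrep T X a" "vrep T Y b" "x \<in> T"
  shows "g (pt x) (X (pt x)) (Y (pt x)) = a x \<bullet> (metric_of x *v b x)"
proof -
  have "x \<in> \<phi> ` U" using assms vrepD(2) by blast
  then show ?thesis using vrepD(4)[OF assms(1,3)] vrepD(4)[OF assms(2,3)] g_cv[OF pt_U] by simp
qed

lemma smooth_inner_metric_of:
  assumes "vrep T X a" "vrep T Y b" shows "smooth_on T (\<lambda>y. a y \<bullet> (metric_of y *v b y))"
  using vrepD[OF assms(1)] vrepD[OF assms(2)] smooth_on_subset[OF smooth_metric_of]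
  by (intro smooth_on_inner smooth_on_mv) auto

lemma koszul_vrep:
  assumes X: "vrep T X a" and Y: "vrep T Y b" and Z: "vrep T Z c" and x: "x \<in> T"
  shows "koszul M g X Y Z (pt x) = 2 * (covd a b x \<bullet> (metric_of x *v c x))"
proof -
  have ap: "X (pt x) (\<lambda>q. g q (Y q) (Z q)) = D (\<lambda>y. b y \<bullet> (metric_of y *v c y)) x (a x)"
    if "vrep T X a" "vrep T Y b" "vrep T Z c" for X a Y b Z c
    by (rule vrep_apply[OF that(1) smooth_inner_metric_of[OF that(2,3)] g_vrep[OF that(2,3)] x])
  have lb: "g (pt x) (lie_bracket M X Y (pt x)) (Z (pt x)) = (D b x (a x) - D a x (b x)) \<bullet> (metric_of x *v c x)"
    if "vrep T X a" "vrep T Y b" "vrep T Z c" for X a Y b Z c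
    by (rule g_vrep[OF vrep_lie_bracket[OF that(1,2)] that(3) x])
  show ?thesis
    unfolding koszul_def ap[OF X Y Z] ap[OF Y X Z] ap[OF Z X Y] lb[OF X Y Z] lb[OF X Z Y] lb[OF Y Z X]
    using koszul_identity[OF vrepD(1,2,3)[OF X] vrepD(3)[OF Y] vrepD(3)[OF Z] x] .
qed

text \<open>By \<open>koszul_vrep\<close> the vector with components \<open>covd a b x\<close> meets
  the definite description. Nondegeneracy of the metric, tested on fields with constant components,
  excludes every other vector.\<close>

lemma levi_civita_vrep:
  assumes X: "vrep T X a" and Y: "vrep T Y b"
  shows "vrep T (levi_civita M g X Y) (covd a b)"
  unfolding vrep_def
proof (intro conjI ballI)
  note v = vrepD[OF X] and w = vrepD[OF Y]
  show "open T" "T \<subseteq> \<phi> ` U" by fact+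
  show "smooth_on T (covd a b)" by (rule smooth_covd[OF v(1-3) w(3)])
  fix x assume x: "x \<in> T"
  then have xU: "x \<in> \<phi> ` U" using v by blast
  have p: "pt x \<in> U" by (rule pt_U[OF xU])
  have key: "koszul M g X Y Z (pt x) = 2 * g (pt x) (cv (pt x) (covd a b x)) (Z (pt x))"
    if Z: "smooth_vfield_near M (pt x) Z" for Z
  proof -
    obtain T0 c where T0: "x \<in> T0" "vrep T0 Z c"
      using smooth_vfield_near_vrep[OF Z p] xU by auto
    have o: "open (T \<inter> T0)" and xT: "x \<in> T \<inter> T0" using v(1) vrepD(1)[OF T0(2)] T0 x by auto
    have "koszul M g X Y Z (pt x) = 2 * (covd a b x \<bullet> (metric_of x *v c x))"
      using o by (intro koszul_vrep[OF _ _ _ xT] vrep_subset[OF X] vrep_subset[OF Y] vrep_subset[OF T0(2)]) auto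
    then show ?thesis using g_cv[OF p] vrepD(4)[OF T0(2,1)] xU by simp
  qed
  show "levi_civita M g X Y (pt x) = cv (pt x) (covd a b x)"
    unfolding levi_civita_def
  proof (rule the_equality)
    show "cv (pt x) (covd a b x) \<in> tangent_space M (pt x) \<and>
      (\<forall>Z. smooth_vfield_near M (pt x) Z \<longrightarrow> 2 * g (pt x) (cv (pt x) (covd a b x)) (Z (pt x)) = koszul M g X Y Z (pt x))"
      using key cv_tangent[OF p] by simp
    fix t assume t: "t \<in> tangent_space M (pt x) \<and>
      (\<forall>Z. smooth_vfield_near M (pt x) Z \<longrightarrow> 2 * g (pt x) t (Z (pt x)) = koszul M g X Y Z (pt x))"
    have tc: "t = cv (pt x) (coords t)" using cv_coords[OF p] t by simp
    have "coords t = covd a b x"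
    proof (rule nondegenerate_G[OF xU])
      fix z
      have n: "smooth_vfield_near M (pt x) (\<lambda>p. cv p z)" by (rule vrep_near[OF vrep_const xU])
      have "g (pt x) t (cv (pt x) z) = g (pt x) (cv (pt x) (covd a b x)) (cv (pt x) z)"
        using t key[OF n] n by auto
      then have "coords t \<bullet> (metric_of x *v z) = covd a b x \<bullet> (metric_of x *v z)"
        using g_cv[OF p] tc xU by (metis \<phi>_pt)
      then show "z \<bullet> (metric_of x *v coords t) = z \<bullet> (metric_of x *v covd a b x)"
        using inner_matrix_vector_sym[OF sym_G[OF xU]] by metis
    qed
    then show "t = cv (pt x) (covd a b x)" using tc by simp
  qed
qed

lemma curvature_vrep:
  assumes X: "vrep T X a" and Y: "vrep T Y b" and Z: "vrep T Z c" and x: "x \<in> T"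
  shows "curvature M g X Y Z (pt x) = cv (pt x) (curv (a x) (b x) x *v c x)"
proof -
  note L = levi_civita_vrep
  have p: "pt x \<in> U" using x vrepD(2)[OF X] pt_U by blast
  note 1 = vrepD(4)[OF L[OF X L[OF Y Z]] x] and 2 = vrepD(4)[OF L[OF Y L[OF X Z]] x]
    and 3 = vrepD(4)[OF L[OF vrep_lie_bracket[OF X Y] Z] x]
  have diff: "cv (pt x) (u - w) = (\<lambda>f. cv (pt x) u f - cv (pt x) w f)" for u w
    using cv_linear[OF p, of 1 u "-1" w] by simp
  show ?thesis
    unfolding curvature_def 1 2 3
    using curvature_identity[OF vrepD(1,2,3)[OF X] vrepD(3)[OF Y] vrepD(3)[OF Z] x, symmetric] by (simp add: diff)
qed

lemma orthonormal_basis_onb: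
  assumes p: "p \<in> U" shows "orthonormal_basis M g p (onb M g p)"
proof -
  have x: "\<phi> p \<in> \<phi> ` U" using p by simp
  obtain e :: "'n \<Rightarrow> real^'n" where e: "\<And>i j. e i \<bullet> (metric_of (\<phi> p) *v e j) = (if i = j then 1 else 0)"
    using orthonormal_basis_exists[OF sym_G[OF x] pos_G[OF x]] by metis
  then have "orthonormal_basis M g p (\<lambda>i. cv p (e i))"
    unfolding orthonormal_basis_def using p by (simp add: cv_tangent g_cv)
  then show ?thesis unfolding onb_def by (rule someI[of "orthonormal_basis M g p"])
qed

definition onbc :: "real^'n \<Rightarrow> 'n \<Rightarrow> real^'n" where
  "onbc x i = coords (onb M g (pt x) i)"

lemma onb_cv: assumes x: "x \<in> \<phi> ` U" shows "onb M g (pt x) i = cv (pt x) (onbc x i)"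
  using orthonormal_basis_onb[OF pt_U[OF x]] cv_coords[OF pt_U[OF x]]
  unfolding orthonormal_basis_def onbc_def by metis

lemma onbc_orthonormal:
  assumes x: "x \<in> \<phi> ` U" shows "onbc x i \<bullet> (metric_of x *v onbc x j) = (if i = j then 1 else 0)"
  using orthonormal_basis_onb[OF pt_U[OF x]] g_cv[OF pt_U[OF x]] x
  unfolding orthonormal_basis_def onb_cv[OF x] by simp

text \<open>Both choices disappear here: the curvature depends on the extensions only through their
  values at the point, and \<open>ric_trace\<close> holds in every orthonormal basis.\<close>

lemma ricci_cv:
  assumes x: "x \<in> \<phi> ` U"
  shows "ricci M g (pt x) (cv (pt x) u) (cv (pt x) w) = u \<bullet> (ric x *v w)"
proof -
  have p: "pt x \<in> U" by (rule pt_U[OF x])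
  have ex: "\<exists>T a. x \<in> T \<and> vrep T (extension M (pt x) (cv (pt x) z)) a \<and> a x = z" for z
    using extension_vrep[OF p cv_tangent[OF p]] coords_cv[OF p] x by (metis \<phi>_pt)
  have "g (pt x) (curvature M g (extension M (pt x) (cv (pt x) e)) (extension M (pt x) (cv (pt x) u))
      (extension M (pt x) (cv (pt x) w)) (pt x)) (cv (pt x) e) = (curv e u x *v w) \<bullet> (metric_of x *v e)" for e
  proof -
    obtain T1 a1 where 1: "x \<in> T1" "vrep T1 (extension M (pt x) (cv (pt x) e)) a1" "a1 x = e" using ex by blast
    obtain T2 a2 where 2: "x \<in> T2" "vrep T2 (extension M (pt x) (cv (pt x) u)) a2" "a2 x = u" using ex by blast
    obtain T3 a3 where 3: "x \<in> T3" "vrep T3 (extension M (pt x) (cv (pt x) w)) a3" "a3 x = w" using ex by blast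
    let ?T = "T1 \<inter> T2 \<inter> T3"
    have o: "open ?T" using vrepD(1)[OF 1(2)] vrepD(1)[OF 2(2)] vrepD(1)[OF 3(2)] by blast
    have xT: "x \<in> ?T" using 1 2 3 by blast
    have v1: "vrep ?T (extension M (pt x) (cv (pt x) e)) a1" by (rule vrep_subset[OF 1(2) o]) auto
    have v2: "vrep ?T (extension M (pt x) (cv (pt x) u)) a2" by (rule vrep_subset[OF 2(2) o]) auto
    have v3: "vrep ?T (extension M (pt x) (cv (pt x) w)) a3" by (rule vrep_subset[OF 3(2) o]) auto
    show ?thesis
      unfolding curvature_vrep[OF v1 v2 v3 xT] g_cv[OF p] using 1 2 3 x by simp
  qed
  then show ?thesis
    unfolding ricci_def onb_cv[OF x]
    using ric_trace[OF x onbc_orthonormal[OF x]] by simp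
qed

lemma scalar_curvature_chart: "x \<in> \<phi> ` U \<Longrightarrow> scalar_curvature M g (pt x) = scal x"
  unfolding scalar_curvature_def
  by (simp add: onb_cv ricci_cv trace_orthonormal onbc_orthonormal scal_eq)

text \<open>Existence is \<open>ricop_metric\<close>, uniqueness the nondegeneracy of the
  metric.\<close>

lemma ricci_operator_cv:
  assumes x: "x \<in> \<phi> ` U"
  shows "ricci_operator M g (pt x) (cv (pt x) u) = cv (pt x) (ricop x *v u)"
  unfolding ricci_operator_def
proof (rule the_equality)
  have p: "pt x \<in> U" by (rule pt_U[OF x])
  have gc: "g (pt x) (cv (pt x) a) (cv (pt x) b) = a \<bullet> (metric_of x *v b)" for a b
    using g_cv[OF p] x by simp
  show "cv (pt x) (ricop x *v u) \<in> tangent_space M (pt x) \<and>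
    (\<forall>w\<in>tangent_space M (pt x). ricci M g (pt x) (cv (pt x) u) w = g (pt x) (cv (pt x) (ricop x *v u)) w)"
    using cv_tangent[OF p] by (auto simp: tangent_space_eq[OF p] ricci_cv x gc ricop_metric)
  fix t assume t: "t \<in> tangent_space M (pt x) \<and>
    (\<forall>w\<in>tangent_space M (pt x). ricci M g (pt x) (cv (pt x) u) w = g (pt x) t w)"
  have tc: "t = cv (pt x) (coords t)" using cv_coords[OF p] t by simp
  have "coords t = ricop x *v u"
  proof (rule nondegenerate_G[OF x])
    fix z
    have "ricci M g (pt x) (cv (pt x) u) (cv (pt x) z) = g (pt x) (cv (pt x) (coords t)) (cv (pt x) z)"
      using t cv_tangent[OF p] tc by metis
    then have "coords t \<bullet> (metric_of x *v z) = (ricop x *v u) \<bullet> (metric_of x *v z)"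
      by (simp add: gc ricci_cv x ricop_metric)
    then show "z \<bullet> (metric_of x *v coords t) = z \<bullet> (metric_of x *v (ricop x *v u))"
      using inner_matrix_vector_sym[OF sym_G[OF x]] by metis
  qed
  then show "t = cv (pt x) (ricop x *v u)" using tc by simp
qed

lemma ricci_operator_norm_sq_chart:
  assumes x: "x \<in> \<phi> ` U"
  shows "ricci_operator_norm_sq M g (pt x) = trace (transpose (ricop x) ** metric_of x ** ricop x ** H x)"
proof -
  have "(ricop x *v u) \<bullet> (metric_of x *v (ricop x *v u)) = u \<bullet> ((transpose (ricop x) ** metric_of x ** ricop x) *v u)" for u
    by (simp only: matrix_vector_mul_assoc[symmetric] inner_transpose)
  then show ?thesis
    unfolding ricci_operator_norm_sq_def
    using trace_orthonormal[OF x onbc_orthonormal[OF x], of "transpose (ricop x) ** metric_of x ** ricop x"]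
    by (simp add: onb_cv ricci_operator_cv g_cv[OF pt_U[OF x]] x)
qed

lemma lie_derivative_metric_cv:
  assumes \<xi>: "vrep T \<xi> a" and x: "x \<in> T"
  shows "lie_derivative_metric M \<xi> g (pt x) (cv (pt x) u) (cv (pt x) w)
    = u \<bullet> ((metric_of x ** nabla a x + transpose (nabla a x) ** metric_of x) *v w)"
proof -
  have xU: "x \<in> \<phi> ` U" using x vrepD(2)[OF \<xi>] by blast
  have p: "pt x \<in> U" by (rule pt_U[OF xU])
  have ex: "\<exists>T a. x \<in> T \<and> vrep T (extension M (pt x) (cv (pt x) z)) a \<and> a x = z" for z
    using extension_vrep[OF p cv_tangent[OF p]] coords_cv[OF p] xU by (metis \<phi>_pt)
  obtain T2 b where 2: "x \<in> T2" "vrep T2 (extension M (pt x) (cv (pt x) u)) b" "b x = u" using ex by blast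
  obtain T3 c where 3: "x \<in> T3" "vrep T3 (extension M (pt x) (cv (pt x) w)) c" "c x = w" using ex by blast
  let ?T = "T \<inter> T2 \<inter> T3"
  have o: "open ?T" using vrepD(1)[OF \<xi>] vrepD(1)[OF 2(2)] vrepD(1)[OF 3(2)] by blast
  have xT: "x \<in> ?T" using x 2 3 by blast
  have v1: "vrep ?T \<xi> a" by (rule vrep_subset[OF \<xi> o]) auto
  have v2: "vrep ?T (extension M (pt x) (cv (pt x) u)) b" by (rule vrep_subset[OF 2(2) o]) auto
  have v3: "vrep ?T (extension M (pt x) (cv (pt x) w)) c" by (rule vrep_subset[OF 3(2) o]) auto
  have ap: "\<xi> (pt x) (\<lambda>q. g q (extension M (pt x) (cv (pt x) u) q) (extension M (pt x) (cv (pt x) w) q))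
    = D (\<lambda>y. b y \<bullet> (metric_of y *v c y)) x (a x)"
    by (rule vrep_apply[OF v1 smooth_inner_metric_of[OF v2 v3] g_vrep[OF v2 v3] xT])
  show ?thesis
    unfolding lie_derivative_metric_def Let_def ap
      g_vrep[OF vrep_lie_bracket[OF v1 v2] v3 xT] g_vrep[OF v2 vrep_lie_bracket[OF v1 v3] xT]
    using lie_derivative_identity[OF vrepD(1,2,3)[OF v1] vrepD(3)[OF v2] vrepD(3)[OF v3] xT] 2 3 by simp
qed

end

section \<open>The Riemannian volume\<close>

text \<open>The measurable space on which all chart measures live, so that they can be compared and
  added.\<close>

definition mborel :: "('a, 'n::finite) charted_space \<Rightarrow> 'a measure" where
  "mborel M = sigma (points M) {U. openin (mtop M) U}"

lemma space_mborel [simp]: "space (mborel M) = points M"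
  and sets_mborel: "sets (mborel M) = sigma_sets (points M) {U. openin (mtop M) U}"
proof -
  have "{U. openin (mtop M) U} \<subseteq> Pow (points M)" using openin_subset by blast
  then show "space (mborel M) = points M" "sets (mborel M) = sigma_sets (points M) {U. openin (mtop M) U}"
    by (simp_all add: mborel_def space_measure_of sets_measure_of)
qed

lemma openin_mborel: "openin (mtop M) W \<Longrightarrow> W \<in> sets (mborel M)"
  unfolding sets_mborel by (rule sigma_sets.Basic) simp

text \<open>The derivative of \<open>dens\<close> is \<open>dens\<close> times a smooth function, so
  smoothness bootstraps by induction on k.\<close>

lemma (in metric_patch) smooth_dens: "smooth_on \<Omega> dens"
proof -
  have d: "dens differentiable (at x)" if "x \<in> \<Omega>" for x
    using has_derivative_dens[OF that] by (rule differentiableI)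
  have "Ck_on k \<Omega> dens" for k
  proof (induction k)
    case 0
    show ?case
      unfolding Ck_on.simps
      by (intro continuous_at_imp_continuous_on ballI has_derivative_continuous[OF has_derivative_dens])
  next
    case (Suc k)
    have "Ck_on k \<Omega> (\<lambda>x. trace (conn v x))" for v
      using smooth_on_trace[OF open_\<Omega> smooth_conn[of v]] by (simp add: smooth_on_def)
    then have *: "Ck_on k \<Omega> (\<lambda>x. dens x * trace (conn v x))" for v
      by (intro Ck_on_bilinear[OF bounded_bilinear_mult open_\<Omega>] Suc)
    have "Ck_on k \<Omega> (\<lambda>x. D dens x v)" for v
      by (rule Ck_on_cong[OF open_\<Omega> _ *[of v]]) (simp add: D_eqI[OF has_derivative_dens])
    then show ?case
      unfolding Ck_on.simps using d by (intro conjI allI differentiable_on_openI)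
  qed
  then show ?thesis by (simp add: smooth_on_def)
qed

section \<open>Borel sets and measurability in a chart\<close>

context mfd_chart
begin

lemma vimage_pt: "pt -` B \<inter> \<phi> ` U = \<phi> ` (U \<inter> B)"
proof
  show "pt -` B \<inter> \<phi> ` U \<subseteq> \<phi> ` (U \<inter> B)" by auto
  show "\<phi> ` (U \<inter> B) \<subseteq> pt -` B \<inter> \<phi> ` U" by auto
qed

lemma measurable_pt: "pt \<in> measurable (restrict_space borel (\<phi> ` U)) (mborel M)"
  unfolding mborel_def
proof (rule measurable_measure_of)
  show "{U. openin (mtop M) U} \<subseteq> Pow (points M)" using openin_subset by blast
  show "pt \<in> space (restrict_space borel (\<phi> ` U)) \<rightarrow> points M"
    using pt_U U_points by (auto simp: space_restrict_space)
  fix W assume "W \<in> {U. openin (mtop M) U}"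
  then have "open (\<phi> ` (U \<inter> W))" by (intro open_image openin_Int_U) auto
  then show "pt -` W \<inter> space (restrict_space borel (\<phi> ` U)) \<in> sets (restrict_space borel (\<phi> ` U))"
    by (simp add: space_restrict_space vimage_pt sets_restrict_space_iff open_image_U borel_open) auto
qed

lemma image_borel:
  assumes "B \<in> sets (mborel M)" shows "\<phi> ` (U \<inter> B) \<in> sets borel"
  using measurable_sets[OF measurable_pt assms]
  by (simp add: space_restrict_space vimage_pt sets_restrict_space_iff open_image_U borel_open)

lemma measurable_\<phi>: "\<phi> \<in> measurable (restrict_space (mborel M) U) borel"
proof (rule borel_measurableI)
  fix S :: "(real^'n) set" assume S: "open S"
  have "x \<in> pt ` (S \<inter> \<phi> ` U)" if "x \<in> U" "\<phi> x \<in> S" for x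
    by (rule image_eqI[of _ _ "\<phi> x"]) (use that in auto)
  then have "\<phi> -` S \<inter> space (restrict_space (mborel M) U) = pt ` (S \<inter> \<phi> ` U)"
    using U_points by (auto simp: space_restrict_space pt_U)
  moreover have "openin (mtop M) (pt ` (S \<inter> \<phi> ` U))"
    by (rule openin_pt) (use S open_image_U in auto)
  moreover have "pt ` (S \<inter> \<phi> ` U) \<subseteq> U" using pt_U by auto
  ultimately show "\<phi> -` S \<inter> space (restrict_space (mborel M) U) \<in> sets (restrict_space (mborel M) U)"
    by (simp add: sets_restrict_space_iff Int_absorb2[OF U_points] openin_mborel openin_U)
qed

lemma measurable_chart_function:
  assumes h: "h \<in> borel_measurable borel" and f: "\<And>p. p \<in> points M \<Longrightarrow> f p = (if p \<in> U then h (\<phi> p) else (0::real))"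
  shows "f \<in> borel_measurable (mborel M)"
proof -
  have "(\<lambda>p. h (\<phi> p)) \<in> borel_measurable (restrict_space (mborel M) U)"
    by (rule measurable_compose[OF measurable_\<phi> h])
  then have "(\<lambda>p. if p \<in> U then h (\<phi> p) else 0) \<in> borel_measurable (mborel M)"
    by (subst (asm) measurable_restrict_space_iff[where c = 0]) (use openin_mborel[OF openin_U] in \<open>auto simp: Int_absorb2[OF U_points]\<close>)
  then show ?thesis
    by (subst measurable_cong[of _ f]) (auto simp: f)
qed

end

context riemannian_chart
begin

text \<open>The chart volume as a measure on all of M: by the pushforward, sets that miss U have
  measure 0.\<close>

definition cvol :: "'a measure" where
  "cvol = distr (density (restrict_space lborel (\<phi> ` U)) (\<lambda>x. ennreal (dens x))) (mborel M) pt"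

lemma sets_cvol [simp]: "sets cvol = sets (mborel M)" and space_cvol [simp]: "space cvol = points M"
  by (simp_all add: cvol_def)

lemma measurable_dens: "dens \<in> borel_measurable (restrict_space lborel (\<phi> ` U))"
  using borel_measurable_continuous_on_restrict[OF smooth_on_continuous[OF smooth_dens]]
  by (simp add: measurable_def space_restrict_space sets_restrict_space)

lemma measurable_pt_lborel: "pt \<in> measurable (restrict_space lborel (\<phi> ` U)) (mborel M)"
  using measurable_pt by (simp add: measurable_def space_restrict_space sets_restrict_space)

lemma emeasure_cvol:
  assumes B: "B \<in> sets (mborel M)"
  shows "emeasure cvol B = (\<integral>\<^sup>+x\<in>\<phi> ` (U \<inter> B). ennreal (dens x) \<partial>lborel)"
proof -
  let ?R = "restrict_space lborel (\<phi> ` U)"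
  have m: "pt \<in> measurable (density ?R (\<lambda>x. ennreal (dens x))) (mborel M)"
    using measurable_pt_lborel by simp
  have d: "(\<lambda>x. ennreal (dens x)) \<in> borel_measurable ?R" using measurable_dens by simp
  have i: "pt -` B \<inter> space ?R = \<phi> ` (U \<inter> B)" by (simp add: space_restrict_space vimage_pt)
  have s: "\<phi> ` (U \<inter> B) \<in> sets ?R"
    using measurable_sets[OF measurable_pt_lborel B] i by simp
  have "emeasure cvol B = emeasure (density ?R (\<lambda>x. ennreal (dens x))) (\<phi> ` (U \<inter> B))"
    unfolding cvol_def by (subst emeasure_distr[OF m B]) (simp add: vimage_pt space_restrict_space)
  also have "\<dots> = (\<integral>\<^sup>+x. ennreal (dens x) * indicator (\<phi> ` (U \<inter> B)) x \<partial>?R)"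
    by (rule emeasure_density[OF d s])
  also have "\<dots> = (\<integral>\<^sup>+x. ennreal (dens x) * indicator (\<phi> ` (U \<inter> B)) x * indicator (\<phi> ` U) x \<partial>lborel)"
    by (rule nn_integral_restrict_space) (simp add: open_image_U borel_open)
  also have "\<dots> = (\<integral>\<^sup>+x\<in>\<phi> ` (U \<inter> B). ennreal (dens x) \<partial>lborel)"
    by (intro nn_integral_cong) (auto simp: indicator_def)
  finally show ?thesis .
qed

lemma cvol_definition_form:
  assumes "B \<in> sets (mborel M)" "B \<subseteq> U"
  shows "emeasure cvol B = (\<integral>\<^sup>+x\<in>\<phi> ` B. ennreal (sqrt (det (metric_matrix M g (U, \<phi>) (inv_into U \<phi> x)))) \<partial>lborel)"
  using emeasure_cvol[OF assms(1)] assms(2) by (simp add: dens_def metric_of_def Int_absorb1)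

text \<open>The coordinate matrices of g in two charts are congruent through the Jacobian matrix;
  take determinants and square roots.\<close>

lemma dens_change:
  assumes V: "(V, \<psi>) \<in> atlas M" and x: "x \<in> \<phi> ` (U \<inter> V)"
  shows "dens x = \<bar>det (matrix (D (\<psi> \<circ> pt) x))\<bar> * sqrt (det (metric_matrix M g (V, \<psi>) (pt x)))"
proof -
  interpret c: riemannian_chart M V \<psi> g by standard (use mfd V metric in auto)
  let ?J = "matrix (D (\<psi> \<circ> pt) x)" and ?p = "pt x"
  have xU: "x \<in> \<phi> ` U" and p: "?p \<in> U" "?p \<in> V" "\<phi> ?p = x" using x by auto
  have "(\<psi> \<circ> pt) differentiable (at x)"
    by (rule smooth_on_differentiable[OF transition_smooth[OF V] _ x]) (rule open_image[OF openin_Int_U[OF c.openin_U]], simp)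
  then have J: "?J *v u = D (\<psi> \<circ> pt) x u" for u
    by (simp add: matrix_works linear_frechet_derivative)
  have cv: "cv ?p u = c.cv ?p (?J *v u)" for u
    using c.chart_vec_change[OF chart p(2,1), of u] p(3) by (simp add: J)
  have "u \<bullet> (metric_of x *v w) = (?J *v u) \<bullet> (c.metric_of (\<psi> ?p) *v (?J *v w))" for u w
    using g_cv[OF p(1), of u w] c.g_cv[OF p(2), of "?J *v u" "?J *v w"] cv p(3) by simp
  then have "u \<bullet> (metric_of x *v w) = u \<bullet> ((transpose ?J ** c.metric_of (\<psi> ?p) ** ?J) *v w)" for u w
    by (simp only: matrix_vector_mul_assoc[symmetric] inner_transpose)
  then have "metric_of x *v w = (transpose ?J ** c.metric_of (\<psi> ?p) ** ?J) *v w" for w using vector_eq_ldot by blast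
  then have "metric_of x = transpose ?J ** c.metric_of (\<psi> ?p) ** ?J" using matrix_eq by blast
  then have "det (metric_of x) = (det ?J)\<^sup>2 * det (c.metric_of (\<psi> ?p))"
    by (simp add: det_mul det_transpose power2_eq_square)
  then show ?thesis
    using p by (simp add: dens_def real_sqrt_mult c.metric_of_def)
qed

text \<open>Change of variables along the transition map, with \<open>dens_change\<close>
  identifying the transformed integrand. This compatibility is what permits gluing.\<close>

lemma cvol_change:
  assumes V: "(V, \<psi>) \<in> atlas M" and B: "B \<in> sets (mborel M)" "B \<subseteq> U" "B \<subseteq> V"
  shows "emeasure cvol B = emeasure (riemannian_chart.cvol M V \<psi> g) B"
proof -
  interpret c: riemannian_chart M V \<psi> g by standard (use mfd V metric in auto)
  let ?S = "\<phi> ` B" and ?T = "\<psi> \<circ> pt"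
  have UB: "U \<inter> B = B" "V \<inter> B = B" using B by auto
  have S: "?S \<in> sets borel" using image_borel[OF B(1)] UB by simp
  have TS: "?T ` ?S = \<psi> ` B" using B(2) by (force simp: image_iff subset_iff)
  have TSb: "\<psi> ` B \<in> sets borel" using c.image_borel[OF B(1)] UB by simp
  have sub: "?S \<subseteq> \<phi> ` (U \<inter> V)" using B by auto
  have d: "\<bar>det (matrix (D ?T x))\<bar> * c.dens (?T x) = dens x" if "x \<in> ?S" for x
  proof -
    have "x \<in> \<phi> ` (U \<inter> V)" using that sub by blast
    moreover from this have "c.pt (\<psi> (pt x)) = pt x" by auto
    ultimately show ?thesis using dens_change[OF V] by (simp add: c.dens_def c.metric_of_def)
  qed
  have "(\<integral>\<^sup>+y. ennreal (indicator (?T ` ?S) y * c.dens y) \<partial>lborel)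
      = (\<integral>\<^sup>+x. ennreal (indicator ?S x * (\<bar>det (matrix (D ?T x))\<bar> * c.dens (?T x))) \<partial>lborel)"
  proof (rule nn_integral_change_of_variables[OF S])
    show "?T differentiable (at x)" if "x \<in> ?S" for x
      by (rule smooth_on_differentiable[OF transition_smooth[OF V]])
        (use that sub open_image[OF openin_Int_U[OF c.openin_U]] in auto)
    show "inj_on ?T ?S"
    proof (rule inj_onI)
      fix x y assume xy: "x \<in> ?S" "y \<in> ?S" "?T x = ?T y"
      then have "x \<in> \<phi> ` U" "y \<in> \<phi> ` U" "pt x \<in> V" "pt y \<in> V"
        using B by (auto simp: subset_iff)
      then show "x = y" using inj_onD[OF c.inj_\<phi>] xy(3) by (metis \<phi>_pt comp_apply)
    qed
    show "0 \<le> c.dens (?T x)" if "x \<in> ?S" for x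
      using that B c.dens_pos[of "?T x"] by (force simp: subset_iff)
    have "continuous_on (\<psi> ` B) c.dens"
      by (rule continuous_on_subset[OF smooth_on_continuous[OF c.smooth_dens]]) (use B in auto)
    from borel_measurable_continuous_on_indicator[OF TSb this]
    show "(\<lambda>y. indicator (?T ` ?S) y * c.dens y) \<in> borel_measurable borel" unfolding TS by simp
    \<comment> \<open>The Jacobian integrand equals \<open>dens\<close> on the image of B, so its
      measurability comes from the continuity of \<open>dens\<close>.\<close>
    have "continuous_on ?S dens"
      by (rule continuous_on_subset[OF smooth_on_continuous[OF smooth_dens]]) (use B in auto)
    from borel_measurable_continuous_on_indicator[OF S this]
    have "(\<lambda>x. indicator ?S x * dens x) \<in> borel_measurable borel" by simp
    also have "(\<lambda>x. indicator ?S x * dens x) = (\<lambda>x. indicator ?S x * (\<bar>det (matrix (D ?T x))\<bar> * c.dens (?T x)))"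
      using d by (auto simp: indicator_def fun_eq_iff)
    finally show "(\<lambda>x. indicator ?S x * (\<bar>det (matrix (D ?T x))\<bar> * c.dens (?T x))) \<in> borel_measurable borel" .
  qed
  also have "(\<integral>\<^sup>+x. ennreal (indicator ?S x * (\<bar>det (matrix (D ?T x))\<bar> * c.dens (?T x))) \<partial>lborel)
    = (\<integral>\<^sup>+x\<in>?S. ennreal (dens x) \<partial>lborel)"
    by (intro nn_integral_cong) (use d in \<open>auto simp: indicator_def\<close>)
  also have "\<dots> = emeasure cvol B" unfolding emeasure_cvol[OF B(1)] UB ..
  also have "(\<integral>\<^sup>+y. ennreal (indicator (?T ` ?S) y * c.dens y) \<partial>lborel) = (\<integral>\<^sup>+y\<in>\<psi> ` B. ennreal (c.dens y) \<partial>lborel)"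
    unfolding TS by (intro nn_integral_cong) (auto simp: indicator_def)
  also have "\<dots> = emeasure c.cvol B" unfolding c.emeasure_cvol[OF B(1)] UB ..
  finally show ?thesis by simp
qed

end

section \<open>Gluing the chart measures to the Riemannian volume\<close>

lemma emeasure_glued:
  fixes m :: "nat \<Rightarrow> 'a measure"
  assumes sets: "\<And>n. n < N \<Longrightarrow> sets (m n) = sets B" and A: "\<And>n. n < N \<Longrightarrow> A n \<in> sets B" and X: "X \<in> sets B"
  shows "emeasure (measure_of (space B) (sets B) (\<lambda>X. \<Sum>n<N. emeasure (m n) (X \<inter> A n))) X
    = (\<Sum>n<N. emeasure (m n) (X \<inter> A n))"
proof (rule emeasure_measure_of_sigma[OF sets.sigma_algebra_axioms _ _ X])
  show "positive (sets B) (\<lambda>X. \<Sum>n<N. emeasure (m n) (X \<inter> A n))"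
    by (simp add: positive_def)
  show "countably_additive (sets B) (\<lambda>X. \<Sum>n<N. emeasure (m n) (X \<inter> A n))"
  proof (rule countably_additiveI)
    fix F :: "nat \<Rightarrow> 'a set"
    assume F: "range F \<subseteq> sets B" "disjoint_family F"
    \<comment> \<open>A finite sum commutes with a series, so countable additivity passes from the
      pieces to the sum.\<close>
    have "(\<Sum>i. \<Sum>n<N. emeasure (m n) (F i \<inter> A n)) = (\<Sum>n<N. \<Sum>i. emeasure (m n) (F i \<inter> A n))"
      by (rule suminf_sum) auto
    also have "\<dots> = (\<Sum>n<N. emeasure (m n) ((\<Union>i. F i) \<inter> A n))"
    proof (intro sum.cong refl)
      fix n assume n: "n \<in> {..<N}"
      have "(\<Sum>i. emeasure (m n) (F i \<inter> A n)) = emeasure (m n) (\<Union>i. F i \<inter> A n)"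
        using F sets[of n] A[of n] n by (intro suminf_emeasure) (auto simp: disjoint_family_on_def)
      also have "(\<Union>i. F i \<inter> A n) = (\<Union>i. F i) \<inter> A n" by auto
      finally show "(\<Sum>i. emeasure (m n) (F i \<inter> A n)) = emeasure (m n) ((\<Union>i. F i) \<inter> A n)" .
    qed
    finally show "(\<Sum>i. \<Sum>n<N. emeasure (m n) (F i \<inter> A n)) = (\<Sum>n<N. emeasure (m n) ((\<Union>i. F i) \<inter> A n))" .
  qed
qed

text \<open>Gives the definite description in \<open>riemannian_volume\<close> its meaning. Finitely
  many charts, made disjoint, cut M into Borel pieces on which the chart formula prescribes the
  measure. This forces uniqueness, and \<open>cvol_change\<close> yields existence.\<close>

theorem riemannian_volume_exists_unique:
  assumes mfd: "smooth_manifold M" and metric: "riemannian_metric M g" and compact: "compact_space (mtop M)"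
  shows "\<exists>!\<mu>. space \<mu> = points M \<and> sets \<mu> = sigma_sets (points M) {U. openin (mtop M) U} \<and>
     (\<forall>(U, \<phi>) \<in> atlas M. \<forall>B \<in> sets \<mu>. B \<subseteq> U \<longrightarrow>
        emeasure \<mu> B = (\<integral>\<^sup>+x\<in>\<phi> ` B.
          ennreal (sqrt (det (metric_matrix M g (U, \<phi>) (inv_into U \<phi> x)))) \<partial>lborel))"
    (is "\<exists>!\<mu>. ?P \<mu>")
proof -
  have rc: "riemannian_chart M U \<phi> g" if "(U, \<phi>) \<in> atlas M" for U \<phi>
    by standard (use mfd metric that in auto)
  have "\<exists>\<F>. finite \<F> \<and> \<F> \<subseteq> fst ` atlas M \<and> points M \<subseteq> \<Union>\<F>"
  proof -
    have "\<forall>U\<in>fst ` atlas M. openin (mtop M) U" using mfd unfolding smooth_manifold_def by auto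
    moreover have "\<Union>(fst ` atlas M) = points M" using mfd unfolding smooth_manifold_def by (auto simp: case_prod_beta)
    ultimately show ?thesis using compact unfolding compact_space_def compactin_def by (metis order_refl)
  qed
  then obtain \<F> where "finite \<F>" "\<F> \<subseteq> fst ` atlas M" "points M \<subseteq> \<Union>\<F>" by blast
  then obtain C where C: "C \<subseteq> atlas M" "finite C" "points M \<subseteq> \<Union>(fst ` C)"
    using finite_subset_image[of \<F> fst "atlas M"] by auto
  obtain N :: nat and c :: "nat \<Rightarrow> ('a, 'b) chart" where c: "C = c ` {n. n < N}"
    using finite_imp_nat_seg_image_inj_on[OF C(2)] by blast
  have cM: "(fst (c n), snd (c n)) \<in> atlas M" if "n < N" for n using C(1) c that by auto
  note rcn = rc[OF cM]
  \<comment> \<open>Empty from N on, which turns the finite cover into the sequence that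
    \<open>disjointed\<close> takes.\<close>
  define W where "W n = (if n < N then fst (c n) else {})" for n
  define A where "A = disjointed W"
  have W: "W n \<in> sets (mborel M)" for n
    using mfd_chart.openin_U[OF riemannian_chart.axioms(1)[OF rcn]] openin_mborel by (auto simp: W_def)
  have A: "A n \<in> sets (mborel M)" for n
    using sets.range_disjointed_sets[of W "mborel M"] W by (auto simp: A_def)
  have AW: "A n \<subseteq> fst (c n)" if "n < N" for n
    using disjointed_subset[of W n] that by (simp add: A_def W_def)
  have disj: "disjoint_family_on A {..<N}"
    using disjoint_family_disjointed[of W] by (auto simp: A_def disjoint_family_on_def)
  have cov: "points M \<subseteq> (\<Union>n<N. A n)"
  proof
    fix p assume "p \<in> points M"
    then obtain n where "n < N" "p \<in> fst (c n)" using C(3) c by auto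
    then have "p \<in> (\<Union>n. W n)" by (auto simp: W_def)
    then obtain k where k: "p \<in> A k" unfolding A_def UN_disjointed_eq[of W, symmetric] by blast
    then have "p \<in> W k" using disjointed_subset[of W k] by (auto simp: A_def)
    then have "k < N" by (auto simp: W_def split: if_splits)
    with k show "p \<in> (\<Union>n<N. A n)" by blast
  qed
  define m where "m n = riemannian_chart.cvol M (fst (c n)) (snd (c n)) g" for n
  have sm: "sets (m n) = sets (mborel M)" if "n < N" for n
    unfolding m_def by (rule riemannian_chart.sets_cvol[OF rcn[OF that]])
  have formula: "emeasure \<nu> B = (\<integral>\<^sup>+x\<in>\<phi> ` B.
        ennreal (sqrt (det (metric_matrix M g (U, \<phi>) (inv_into U \<phi> x)))) \<partial>lborel)"
    if "?P \<nu>" "(U, \<phi>) \<in> atlas M" "B \<in> sets (mborel M)" "B \<subseteq> U" for \<nu> U \<phi> B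
  proof -
    from that(1) have "\<forall>(U, \<phi>) \<in> atlas M. \<forall>B \<in> sets \<nu>. B \<subseteq> U \<longrightarrow> emeasure \<nu> B = (\<integral>\<^sup>+x\<in>\<phi> ` B.
          ennreal (sqrt (det (metric_matrix M g (U, \<phi>) (inv_into U \<phi> x)))) \<partial>lborel)" by blast
    moreover have "B \<in> sets \<nu>" using that(1,3) by (simp add: sets_mborel)
    ultimately show ?thesis using that(2,4) by auto
  qed
  define \<mu> where "\<mu> = measure_of (points M) (sets (mborel M)) (\<lambda>X. \<Sum>n<N. emeasure (m n) (X \<inter> A n))"
  have s\<mu>: "space \<mu> = points M" "sets \<mu> = sets (mborel M)"
    using sets.sets_into_space[of _ "mborel M"] sets.sigma_sets_eq[of "mborel M"]
    by (auto simp: \<mu>_def space_measure_of_conv sets_measure_of_conv)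
  have e\<mu>: "emeasure \<mu> X = (\<Sum>n<N. emeasure (m n) (X \<inter> A n))" if "X \<in> sets (mborel M)" for X
    using emeasure_glued[of N m "mborel M" A X] sm A that by (simp add: \<mu>_def)
  \<comment> \<open>Reduces existence as well as uniqueness to sets that lie inside one
    chart.\<close>
  have split: "emeasure \<nu> X = (\<Sum>n<N. emeasure \<nu> (X \<inter> A n))"
    if "sets \<nu> = sets (mborel M)" "X \<in> sets (mborel M)" for \<nu> X
    by (rule sum_emeasure_cover) (use that A cov disj sets.sets_into_space[OF that(2)] in auto)
  have P: "?P \<mu>"
  proof (intro conjI)
    show "space \<mu> = points M" "sets \<mu> = sigma_sets (points M) {U. openin (mtop M) U}"
      using s\<mu> by (simp_all add: sets_mborel)
    show "\<forall>(U, \<phi>) \<in> atlas M. \<forall>B \<in> sets \<mu>. B \<subseteq> U \<longrightarrow> emeasure \<mu> B = (\<integral>\<^sup>+x\<in>\<phi> ` B.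
          ennreal (sqrt (det (metric_matrix M g (U, \<phi>) (inv_into U \<phi> x)))) \<partial>lborel)"
    proof safe
      fix U \<phi> B assume U: "(U, \<phi>) \<in> atlas M" and B: "B \<in> sets \<mu>" "B \<subseteq> U"
      interpret r: riemannian_chart M U \<phi> g by (rule rc[OF U])
      have B': "B \<in> sets (mborel M)" using B s\<mu> by simp
      \<comment> \<open>The chart is arbitrary and need not belong to the finite subcover; piece by
        piece its measure replaces that of the n-th chart.\<close>
      have "emeasure \<mu> B = (\<Sum>n<N. emeasure r.cvol (B \<inter> A n))"
        unfolding e\<mu>[OF B']
      proof (intro sum.cong refl)
        fix n assume "n \<in> {..<N}"
        then have n: "n < N" by simp
        show "emeasure (m n) (B \<inter> A n) = emeasure r.cvol (B \<inter> A n)"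
          unfolding m_def
          by (rule r.cvol_change[OF cM[OF n], symmetric]) (use B B' A AW[OF n] in auto)
      qed
      also have "\<dots> = emeasure r.cvol B" by (rule split[symmetric]) (simp_all add: B')
      finally show "emeasure \<mu> B = (\<integral>\<^sup>+x\<in>\<phi> ` B.
          ennreal (sqrt (det (metric_matrix M g (U, \<phi>) (inv_into U \<phi> x)))) \<partial>lborel)"
        using r.cvol_definition_form[OF B' B(2)] by simp
    qed
  qed
  have unique: "\<nu> = \<mu>" if \<nu>: "?P \<nu>" for \<nu>
  proof (rule measure_eqI)
    have s\<nu>: "sets \<nu> = sets (mborel M)" using \<nu> by (simp add: sets_mborel)
    then show "sets \<nu> = sets \<mu>" using s\<mu> by simp
    fix X assume "X \<in> sets \<nu>"
    then have X: "X \<in> sets (mborel M)" using s\<nu> by simp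
    have "emeasure \<nu> (X \<inter> A n) = emeasure \<mu> (X \<inter> A n)" if "n < N" for n
    proof -
      have "X \<inter> A n \<in> sets (mborel M)" "X \<inter> A n \<subseteq> fst (c n)" using X A AW[OF that] by auto
      then show ?thesis using formula[OF \<nu> cM[OF that]] formula[OF P cM[OF that]] by simp
    qed
    then show "emeasure \<nu> X = emeasure \<mu> X"
      unfolding split[OF s\<nu> X] split[OF s\<mu>(2) X] by simp
  qed
  show ?thesis by (rule ex1I[of ?P \<mu>, OF P unique])
qed

section \<open>Partitions of unity and the divergence theorem\<close>

lemma riemannian_volume_properties:
  assumes mfd: "smooth_manifold M" and metric: "riemannian_metric M g" and compact: "compact_space (mtop M)"
  shows "space (riemannian_volume M g) = points M" "sets (riemannian_volume M g) = sets (mborel M)"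
    "(U, \<phi>) \<in> atlas M \<Longrightarrow> B \<in> sets (mborel M) \<Longrightarrow> B \<subseteq> U \<Longrightarrow>
      emeasure (riemannian_volume M g) B = (\<integral>\<^sup>+x\<in>\<phi> ` B.
          ennreal (sqrt (det (metric_matrix M g (U, \<phi>) (inv_into U \<phi> x)))) \<partial>lborel)"
  using theI'[OF riemannian_volume_exists_unique[OF assms], folded riemannian_volume_def]
  by (auto simp: sets_mborel)

context metric_patch
begin

lemma smooth_nabla:
  assumes \<xi>: "smooth_on \<Omega> \<xi>" shows "smooth_on \<Omega> (nabla \<xi>)"
proof (intro smooth_on_vec open_\<Omega>)
  fix i j
  have "smooth_on \<Omega> (\<lambda>x. D \<xi> x (axis j 1) $ i + (conn (axis j 1) x *v \<xi> x) $ i)"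
    by (intro smooth_on_add smooth_on_nth smooth_on_mv smooth_on_D smooth_conn open_\<Omega> \<xi>)
  then show "smooth_on \<Omega> (\<lambda>x. nabla \<xi> x $ i $ j)" by (simp add: nabla_component)
qed

end

text \<open>The field E \<xi> as a derivation on M, defined without charts so that contributions of
  different charts can be added at the same point.\<close>

definition einstein_field ::
    "('a, 'n::finite) charted_space \<Rightarrow> 'a metric_tensor \<Rightarrow> 'a vfield \<Rightarrow> 'a vfield" where
  "einstein_field M g \<xi> = (\<lambda>p f. ricci_operator M g p (\<xi> p) f - scalar_curvature M g p / 2 * \<xi> p f)"

context mfd_chart
begin

lemma pt_image_subset: "K \<subseteq> \<phi> ` U \<Longrightarrow> pt ` K \<subseteq> U"
  using pt_U by auto

text \<open>The inverse of the chart is continuous and M is Hausdorff. Being closed in M, and not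
  only in U, gives the support of a bump an open complement on which the extension by 0 is
  smooth.\<close>

lemma closedin_image_compact:
  assumes K: "compact K" "K \<subseteq> \<phi> ` U" shows "closedin (mtop M) (pt ` K)"
proof (rule compactin_imp_closedin)
  show "Hausdorff_space (mtop M)" using mfd by (simp add: smooth_manifold_def)
  have "continuous_map (top_of_set (\<phi> ` U)) (mtop M) pt"
    unfolding continuous_map_def
  proof (intro conjI allI impI)
    show "pt \<in> topspace (top_of_set (\<phi> ` U)) \<rightarrow> points M"
      using pt_U U_points by auto
    fix W assume W: "openin (mtop M) W"
    have "{x \<in> topspace (top_of_set (\<phi> ` U)). pt x \<in> W} = \<phi> ` (U \<inter> W)" using vimage_pt[of W] by auto
    then show "openin (top_of_set (\<phi> ` U)) {x \<in> topspace (top_of_set (\<phi> ` U)). pt x \<in> W}"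
      using open_image[OF openin_Int_U[OF W]] by (simp add: openin_open_eq open_image_U) auto
  qed
  moreover have "compactin (top_of_set (\<phi> ` U)) K" using K by (simp add: compactin_subtopology)
  ultimately show "compactin (mtop M) (pt ` K)" by (rule image_compactin[rotated])
qed

text \<open>A Euclidean bump around the image of p, moved to U and extended by 0. K lies in the
  chart image, so U and the complement of the support cover M, and smoothness is checked on each of
  these two open sets.\<close>

lemma bump_on_manifold:
  assumes p: "p \<in> U"
  shows "\<exists>K b W. compact K \<and> K \<subseteq> \<phi> ` U \<and> smooth_fun M (points M) b \<and> (\<forall>q. 0 \<le> b q) \<and>
    openin (mtop M) W \<and> p \<in> W \<and> (\<forall>q\<in>W. 0 < b q) \<and> (\<forall>q\<in>points M - pt ` K. b q = 0)"
proof -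
  obtain r where r: "r > 0" "cball (\<phi> p) r \<subseteq> \<phi> ` U"
    using open_image_U p open_contains_cball by (metis imageI)
  define K where "K = cball (\<phi> p) r"
  have K: "compact K" "K \<subseteq> \<phi> ` U" using r by (auto simp: K_def)
  obtain \<beta> :: "real^'n \<Rightarrow> real" where \<beta>: "smooth_on UNIV \<beta>" "\<And>x. 0 \<le> \<beta> x" "\<beta> (\<phi> p) > 0" "\<And>x. dist (\<phi> p) x \<ge> r \<Longrightarrow> \<beta> x = 0"
    using bump_function_exists[OF r(1)] by metis
  define b where "b q = (if q \<in> U then \<beta> (\<phi> q) else 0)" for q
  define W where "W = pt ` ({x. 0 < \<beta> x} \<inter> \<phi> ` U)"
  have zero: "b q = 0" if "q \<in> points M - pt ` K" for q
  proof (cases "q \<in> U")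
    case True
    then have "\<phi> q \<notin> K" using that pt by (metis DiffE imageI)
    then show ?thesis using \<beta>(4)[of "\<phi> q"] by (auto simp: b_def K_def)
  qed (simp add: b_def)
  have "smooth_fun M (points M) b"
    unfolding smooth_fun_def
  proof safe
    fix V \<psi> assume V: "(V, \<psi>) \<in> atlas M"
    interpret c: mfd_chart M V \<psi> by standard (use mfd V in auto)
    have "smooth_on (\<psi> ` V) (b \<circ> c.pt)"
    proof (rule smooth_on_local)
      fix x assume x: "x \<in> \<psi> ` V"
      show "\<exists>T. open T \<and> x \<in> T \<and> smooth_on T (b \<circ> c.pt)"
      proof (cases "c.pt x \<in> U")
        case True
        let ?T = "\<psi> ` (V \<inter> U)"
        have o: "open ?T" by (rule c.open_image[OF c.openin_Int_U[OF openin_U]]) auto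
        have "smooth_on ?T (\<lambda>x. \<beta> ((\<phi> \<circ> c.pt) x))"
          by (rule smooth_on_compose[OF o open_UNIV \<beta>(1) c.transition_smooth[OF chart]]) auto
        then have "smooth_on ?T (b \<circ> c.pt)"
          by (subst smooth_on_cong[OF o, of _ "\<lambda>x. \<beta> ((\<phi> \<circ> c.pt) x)"]) (auto simp: b_def)
        moreover have "x \<in> ?T" using x True by (intro image_eqI[of _ _ "c.pt x"]) (auto simp: c.pt_U)
        ultimately show ?thesis using o by blast
      next
        case False
        let ?W = "points M - pt ` K"
        let ?T = "\<psi> ` (V \<inter> ?W)"
        have "openin (mtop M) ?W" using closedin_image_compact[OF K] by (simp add: openin_diff)
        then have o: "open ?T" by (intro c.open_image c.openin_Int_U) auto
        have "smooth_on ?T (b \<circ> c.pt)"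
          by (subst smooth_on_cong[OF o, of _ "\<lambda>x. 0"]) (auto simp: zero smooth_on_const)
        moreover have "x \<in> ?T"
        proof (intro image_eqI[of _ _ "c.pt x"])
          have "c.pt x \<in> V" using x by (rule c.pt_U)
          moreover have "c.pt x \<notin> pt ` K" using False pt_image_subset[OF K(2)] by (meson subsetD)
          ultimately show "c.pt x \<in> V \<inter> ?W" using c.U_points by blast
        qed (use x in simp)
        ultimately show ?thesis using o by blast
      qed
    qed
    then show "smooth_on (\<psi> ` (V \<inter> points M)) (b \<circ> c.pt)"
      using c.U_points by (simp add: Int_absorb2)
  qed
  moreover have "openin (mtop M) W"
  proof -
    have "open {x. 0 < \<beta> x}"
      using smooth_on_continuous[OF \<beta>(1)] by (intro open_Collect_less continuous_on_const)
    then show ?thesis unfolding W_def using open_image_U by (intro openin_pt) auto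
  qed
  moreover have "p \<in> W" unfolding W_def using p \<beta>(3) by (intro image_eqI[of _ _ "\<phi> p"]) auto
  moreover have "\<forall>q\<in>W. 0 < b q" by (auto simp: W_def b_def pt_U)
  moreover have "\<forall>q. 0 \<le> b q" using \<beta>(2) by (simp add: b_def)
  moreover have "\<forall>q\<in>points M - pt ` K. b q = 0" using zero by simp
  ultimately show ?thesis using K by (intro exI[of _ K] exI[of _ b] exI[of _ W] conjI)
qed

end

context riemannian_chart
begin

text \<open>As f vanishes off U, the volume may be replaced by its restriction to U, which is
  \<open>cvol\<close>; the rules for pushforward, density and restriction then lead to Lebesgue
  measure.\<close>

lemma integral_riemannian_volume_chart:
  fixes f :: "'a \<Rightarrow> real"
  assumes compact: "compact_space (mtop M)"
    and f: "\<And>p. p \<in> points M \<Longrightarrow> p \<notin> U \<Longrightarrow> f p = 0"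
    and meas: "(\<lambda>x. indicator (\<phi> ` U) x * f (pt x)) \<in> borel_measurable borel"
    and int: "integrable lborel (\<lambda>x. indicator (\<phi> ` U) x * (dens x * f (pt x)))"
  shows "integrable (riemannian_volume M g) f"
    "integral\<^sup>L (riemannian_volume M g) f = integral\<^sup>L lborel (\<lambda>x. indicator (\<phi> ` U) x * (dens x * f (pt x)))"
proof -
  let ?\<mu> = "riemannian_volume M g" and ?R = "restrict_space lborel (\<phi> ` U)"
  note \<mu> = riemannian_volume_properties[OF mfd metric compact]
  have U: "U \<in> sets (mborel M)" by (rule openin_mborel[OF openin_U])
  have fm: "f \<in> borel_measurable (mborel M)"
    by (rule measurable_chart_function[OF meas]) (use f in auto)
  have fm\<mu>: "f \<in> borel_measurable ?\<mu>" using fm \<mu>(2) measurable_cong_sets by blast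
  have Um: "(indicator U :: 'a \<Rightarrow> real) \<in> borel_measurable ?\<mu>" using U \<mu>(2) by simp
  \<comment> \<open>Restriction to U is expressed as a density, so that integrals of f transform
    without a change of the underlying space.\<close>
  have dens_cvol: "density ?\<mu> (\<lambda>p. ennreal (indicator U p)) = cvol"
  proof (rule measure_eqI)
    show "sets (density ?\<mu> (\<lambda>p. ennreal (indicator U p))) = sets cvol" using \<mu>(2) by simp
    fix B assume "B \<in> sets (density ?\<mu> (\<lambda>p. ennreal (indicator U p)))"
    then have B: "B \<in> sets (mborel M)" using \<mu>(2) by simp
    have UB: "U \<inter> B \<in> sets (mborel M)" using U B by blast
    have "emeasure (density ?\<mu> (\<lambda>p. ennreal (indicator U p))) B = (\<integral>\<^sup>+p. ennreal (indicator U p) * indicator B p \<partial>?\<mu>)"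
      using B \<mu>(2) Um by (intro emeasure_density) auto
    also have "\<dots> = (\<integral>\<^sup>+p. indicator (U \<inter> B) p \<partial>?\<mu>)"
      by (intro nn_integral_cong) (auto simp: indicator_def)
    also have "\<dots> = emeasure ?\<mu> (U \<inter> B)" using UB \<mu>(2) by simp
    also have "\<dots> = emeasure cvol (U \<inter> B)"
      unfolding \<mu>(3)[OF chart UB Int_lower1] cvol_definition_form[OF UB Int_lower1] ..
    also have "\<dots> = emeasure cvol B"
      unfolding emeasure_cvol[OF UB] emeasure_cvol[OF B] by (simp add: Int_assoc[symmetric])
    finally show "emeasure (density ?\<mu> (\<lambda>p. ennreal (indicator U p))) B = emeasure cvol B" .
  qed
  have oU: "\<phi> ` U \<inter> space lborel \<in> sets lborel" using open_image_U by (simp add: borel_open)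
  have fi: "(\<lambda>x. f (pt x)) \<in> borel_measurable ?R" by (rule measurable_compose[OF measurable_pt_lborel fm])
  have nn: "AE x in ?R. 0 \<le> dens x"
    by (rule AE_I2) (use dens_pos in \<open>force simp: space_restrict_space\<close>)
  have im: "pt \<in> measurable (density ?R (\<lambda>x. ennreal (dens x))) (mborel M)" using measurable_pt_lborel by simp
  have eq: "f p = indicator U p *\<^sub>R f p" if "p \<in> space ?\<mu>" for p
    using that f[of p] \<mu>(1) by (cases "p \<in> U") auto
  have "integrable ?\<mu> f \<longleftrightarrow> integrable ?\<mu> (\<lambda>p. indicator U p *\<^sub>R f p)"
    by (rule Bochner_Integration.integrable_cong[OF refl eq])
  also have "\<dots> \<longleftrightarrow> integrable cvol f"
    unfolding dens_cvol[symmetric] by (rule integrable_density[OF fm\<mu> Um, symmetric]) simp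
  also have "\<dots> \<longleftrightarrow> integrable (density ?R (\<lambda>x. ennreal (dens x))) (\<lambda>x. f (pt x))"
    unfolding cvol_def by (rule integrable_distr_eq[OF im fm])
  also have "\<dots> \<longleftrightarrow> integrable ?R (\<lambda>x. dens x *\<^sub>R f (pt x))"
    by (rule integrable_density[OF fi measurable_dens nn])
  also have "\<dots> \<longleftrightarrow> integrable lborel (\<lambda>x. indicator (\<phi> ` U) x *\<^sub>R (dens x *\<^sub>R f (pt x)))"
    by (rule integrable_restrict_space[OF oU])
  finally show "integrable ?\<mu> f" using int by simp
  have "integral\<^sup>L ?\<mu> f = integral\<^sup>L ?\<mu> (\<lambda>p. indicator U p *\<^sub>R f p)"
    by (rule Bochner_Integration.integral_cong[OF refl eq])
  also have "\<dots> = integral\<^sup>L cvol f"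
    unfolding dens_cvol[symmetric] by (rule integral_density[OF fm\<mu> Um, symmetric]) simp
  also have "\<dots> = integral\<^sup>L (density ?R (\<lambda>x. ennreal (dens x))) (\<lambda>x. f (pt x))"
    unfolding cvol_def by (rule integral_distr[OF im fm])
  also have "\<dots> = integral\<^sup>L ?R (\<lambda>x. dens x *\<^sub>R f (pt x))"
    by (rule integral_density[OF fi measurable_dens nn])
  also have "\<dots> = integral\<^sup>L lborel (\<lambda>x. indicator (\<phi> ` U) x *\<^sub>R (dens x *\<^sub>R f (pt x)))"
    by (rule integral_restrict_space[OF oU])
  finally show "integral\<^sup>L ?\<mu> f = integral\<^sup>L lborel (\<lambda>x. indicator (\<phi> ` U) x * (dens x * f (pt x)))" by simp
qed

abbreviation "fcoords \<xi> \<equiv> \<lambda>x. coords (\<xi> (pt x))"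

lemma global_vrep:
  assumes "smooth_vfield M (points M) \<xi>" shows "vrep (\<phi> ` U) \<xi> (fcoords \<xi>)"
  using smooth_vfield_vrep[OF assms openin_topspace] U_points by (simp add: Int_absorb2)

lemma einstein_field_cv:
  assumes \<xi>: "smooth_vfield M (points M) \<xi>" and x: "x \<in> \<phi> ` U"
  shows "einstein_field M g \<xi> (pt x) = cv (pt x) (einstein x *v fcoords \<xi> x)"
proof -
  have p: "pt x \<in> U" by (rule pt_U[OF x])
  define w where "w = fcoords \<xi> x"
  have c: "\<xi> (pt x) = cv (pt x) w"
    unfolding w_def by (rule vrepD(4)[OF global_vrep[OF \<xi>] x])
  have e: "einstein x *v w = 1 *\<^sub>R (ricop x *v w) + (- (scal x / 2)) *\<^sub>R w"
    by (simp add: einstein_def mv.diff_left mv.scaleR_left)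
  show ?thesis
    unfolding w_def[symmetric] unfolding e cv_linear[OF p] einstein_field_def c ricci_operator_cv[OF x] scalar_curvature_chart[OF x]
    by simp
qed

lemma einstein_field_apply:
  assumes \<xi>: "smooth_vfield M (points M) \<xi>" and x: "x \<in> \<phi> ` U" and f: "smooth_fun M (points M) f"
  shows "einstein_field M g \<xi> (pt x) f = D (f \<circ> pt) x (einstein x *v fcoords \<xi> x)"
  unfolding einstein_field_cv[OF \<xi> x]
  by (rule cv_apply[OF open_image_U subset_refl x])
    (use smooth_funD[OF f] U_points in \<open>simp_all add: Int_absorb2\<close>)

lemma soliton_chart:
  assumes sol: "almost_RB_soliton M g \<xi> lam \<rho>" and x: "x \<in> \<phi> ` U"
  defines "\<mu> \<equiv> lam (pt x) + \<rho> * scalar_curvature M g (pt x)"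
  shows "\<mu> * scalar_curvature M g (pt x) - ricci_operator_norm_sq M g (pt x)
      - 1/2 * scalar_curvature M g (pt x) * (real CARD('n) * \<mu> - scalar_curvature M g (pt x))
    = trace (einstein x ** nabla (fcoords \<xi>) x)"
proof -
  have p: "pt x \<in> U" by (rule pt_U[OF x])
  have \<xi>: "smooth_vfield M (points M) \<xi>" using sol by (simp add: almost_RB_soliton_def)
  let ?B = "nabla (fcoords \<xi>) x"
  have "u \<bullet> ((ric x + (1/2) *\<^sub>R (metric_of x ** ?B + transpose ?B ** metric_of x)) *v w) = u \<bullet> ((\<mu> *\<^sub>R metric_of x) *v w)" for u w
  proof -
    have "ricci M g (pt x) (cv (pt x) u) (cv (pt x) w) + 1/2 * lie_derivative_metric M \<xi> g (pt x) (cv (pt x) u) (cv (pt x) w)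
      = \<mu> * g (pt x) (cv (pt x) u) (cv (pt x) w)"
      using sol p U_points cv_tangent[OF p] unfolding almost_RB_soliton_def \<mu>_def by blast
    then show ?thesis
      using x by (simp add: ricci_cv lie_derivative_metric_cv[OF global_vrep[OF \<xi>] x] g_cv[OF p]
        mv.add_left mv.scaleR_left inner_add_right)
  qed
  then have "(ric x + (1/2) *\<^sub>R (metric_of x ** ?B + transpose ?B ** metric_of x)) *v w = (\<mu> *\<^sub>R metric_of x) *v w" for w
    using vector_eq_ldot by blast
  then have "ric x + (1/2) *\<^sub>R (metric_of x ** ?B + transpose ?B ** metric_of x) = \<mu> *\<^sub>R metric_of x"
    using matrix_eq by blast
  from soliton_algebra[OF x this] show ?thesis
    by (simp add: scalar_curvature_chart x ricci_operator_norm_sq_chart)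
qed

text \<open>In coordinates the integrand times \<open>dens\<close> is the divergence of the field
  \<open>?V\<close>, by \<open>divergence_identity\<close>. As h vanishes off K, each component has
  compact support and its derivative integrates to 0.\<close>

lemma integral_divergence_chart:
  assumes compact: "compact_space (mtop M)" and \<xi>: "smooth_vfield M (points M) \<xi>"
    and h: "smooth_fun M (points M) h" and K: "compact K" "K \<subseteq> \<phi> ` U"
    and supp: "\<And>q. q \<in> points M - pt ` K \<Longrightarrow> h q = 0"
    and F: "\<And>x. x \<in> \<phi> ` U \<Longrightarrow> F (pt x) = trace (einstein x ** nabla (fcoords \<xi>) x)"
    and outside: "\<And>q. q \<in> points M \<Longrightarrow> q \<notin> U \<Longrightarrow> einstein_field M g \<xi> q h = 0"
  shows "integrable (riemannian_volume M g) (\<lambda>q. h q * F q + einstein_field M g \<xi> q h)"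
    "integral\<^sup>L (riemannian_volume M g) (\<lambda>q. h q * F q + einstein_field M g \<xi> q h) = 0"
proof -
  let ?f = "\<lambda>q. h q * F q + einstein_field M g \<xi> q h" and ?a = "fcoords \<xi>" and ?h = "h \<circ> pt"
  let ?V = "\<lambda>k y. dens y * (?h y * (einstein y *v ?a y) $ k)"
  have a: "smooth_on (\<phi> ` U) ?a" by (rule vrepD(3)[OF global_vrep[OF \<xi>]])
  have hs: "smooth_on (\<phi> ` U) ?h" using smooth_funD[OF h] U_points by (simp add: Int_absorb2)
  have V: "smooth_on (\<phi> ` U) (?V k)" for k
    by (intro smooth_on_mult smooth_on_nth smooth_on_mv smooth_dens smooth_einstein hs a open_image_U)
  have V0: "?V k x = 0" if "x \<in> \<phi> ` U - K" for k x
  proof -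
    have "pt x \<notin> pt ` K"
    proof
      assume "pt x \<in> pt ` K"
      then obtain y where y: "y \<in> K" "pt x = pt y" by blast
      have xU: "x \<in> \<phi> ` U" and yU: "y \<in> \<phi> ` U" using that y(1) K(2) by auto
      have "x = y" using arg_cong[OF y(2), of \<phi>] by (simp only: \<phi>_pt[OF xU] \<phi>_pt[OF yU])
      then show False using that y(1) by blast
    qed
    moreover have "pt x \<in> points M" using that pt_U[of x] U_points by blast
    ultimately show ?thesis using supp[of "pt x"] by simp
  qed
  note int = integral_D_smooth_compact_support[OF open_image_U V K V0]
  have f: "?f (pt x) = ?h x * trace (einstein x ** nabla ?a x) + D ?h x (einstein x *v ?a x)" if "x \<in> \<phi> ` U" for x
    using that by (simp add: F einstein_field_apply[OF \<xi> that h])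
  have div: "(\<Sum>k\<in>UNIV. indicator (\<phi> ` U) x * D (?V k) x (axis k 1)) = indicator (\<phi> ` U) x * (dens x * ?f (pt x))" for x
  proof (cases "x \<in> \<phi> ` U")
    case True
    then show ?thesis using divergence_identity[OF True a hs] f[OF True] by simp
  qed simp
  have "smooth_on (\<phi> ` U) (\<lambda>x. ?h x * trace (einstein x ** nabla ?a x) + D ?h x (einstein x *v ?a x))"
    by (intro smooth_on_add smooth_on_mult smooth_on_trace smooth_on_mm smooth_on_D_along smooth_on_mv
        smooth_einstein smooth_nabla hs a open_image_U)
  from borel_measurable_continuous_on_indicator[OF borel_open[OF open_image_U] smooth_on_continuous[OF this]]
  have m: "(\<lambda>x. indicator (\<phi> ` U) x * (?h x * trace (einstein x ** nabla ?a x) + D ?h x (einstein x *v ?a x))) \<in> borel_measurable borel"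
    by simp
  have e: "indicator (\<phi> ` U) x * ?f (pt x)
      = indicator (\<phi> ` U) x * (?h x * trace (einstein x ** nabla ?a x) + D ?h x (einstein x *v ?a x))" for x
    using f[of x] by (cases "x \<in> \<phi> ` U") simp_all
  have meas: "(\<lambda>x. indicator (\<phi> ` U) x * ?f (pt x)) \<in> borel_measurable borel"
    unfolding e by (rule m)
  have i: "integrable lborel (\<lambda>x. indicator (\<phi> ` U) x * (dens x * ?f (pt x)))"
    unfolding div[symmetric] by (intro Bochner_Integration.integrable_sum int(1))
  have z: "integral\<^sup>L lborel (\<lambda>x. indicator (\<phi> ` U) x * (dens x * ?f (pt x))) = 0"
  proof -
    have "integral\<^sup>L lborel (\<lambda>x. \<Sum>k\<in>UNIV. indicator (\<phi> ` U) x * D (?V k) x (axis k 1))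
        = (\<Sum>k\<in>UNIV. integral\<^sup>L lborel (\<lambda>x. indicator (\<phi> ` U) x * D (?V k) x (axis k 1)))"
      by (rule Bochner_Integration.integral_sum[OF int(1)])
    also have "\<dots> = 0" by (simp only: int(2) sum.neutral_const)
    finally show ?thesis unfolding div .
  qed
  have "?f p = 0" if "p \<in> points M" "p \<notin> U" for p
  proof -
    have "p \<notin> pt ` K" using that pt_image_subset[OF K(2)] by (meson subsetD)
    then show ?thesis using that outside supp by simp
  qed
  from integral_riemannian_volume_chart[OF compact this meas i] z
  show "integrable (riemannian_volume M g) ?f" "integral\<^sup>L (riemannian_volume M g) ?f = 0" by simp_all
qed

text \<open>A derivation annihilates functions that vanish near the point. This supplies the values
  outside the chart that carries the support of h.\<close>

lemma einstein_field_local: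
  assumes \<xi>: "smooth_vfield M (points M) \<xi>" and h: "smooth_fun M (points M) h"
    and W: "openin (mtop M) W" "\<And>q. q \<in> W \<Longrightarrow> h q = 0" and p: "p \<in> U" "p \<in> W"
  shows "einstein_field M g \<xi> p h = 0"
proof -
  have "D (h \<circ> pt) (\<phi> p) = D (\<lambda>x. 0) (\<phi> p)"
    by (rule D_cong[OF open_image[OF openin_Int_U[OF W(1)]]]) (use p W(2) in auto)
  then show ?thesis using einstein_field_apply[OF \<xi> _ h, of "\<phi> p"] p by simp
qed

text \<open>A derivation annihilates the constant 1, to which the functions add up.\<close>

lemma einstein_field_partition:
  assumes \<xi>: "smooth_vfield M (points M) \<xi>" and h: "\<And>i. i \<in> I \<Longrightarrow> smooth_fun M (points M) (h i)"
    and one: "\<And>q. q \<in> points M \<Longrightarrow> (\<Sum>i\<in>I. h i q) = 1" and p: "p \<in> U"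
  shows "(\<Sum>i\<in>I. einstein_field M g \<xi> p (h i)) = 0"
proof -
  have x: "\<phi> p \<in> \<phi> ` U" using p by simp
  let ?w = "einstein (\<phi> p) *v fcoords \<xi> (\<phi> p)"
  have d: "(h i \<circ> pt) differentiable (at (\<phi> p))" if "i \<in> I" for i
    by (rule smooth_on_differentiable[OF _ open_image_U x])
      (use smooth_funD[OF h[OF that]] U_points in \<open>simp add: Int_absorb2\<close>)
  have "(\<Sum>i\<in>I. einstein_field M g \<xi> p (h i)) = (\<Sum>i\<in>I. D (h i \<circ> pt) (\<phi> p) ?w)"
    by (intro sum.cong refl) (use einstein_field_apply[OF \<xi> x h] p in simp)
  also have "\<dots> = D (\<lambda>x. \<Sum>i\<in>I. (h i \<circ> pt) x) (\<phi> p) ?w"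
    by (rule D_sum[OF d, symmetric])
  also have "D (\<lambda>x. \<Sum>i\<in>I. (h i \<circ> pt) x) (\<phi> p) = D (\<lambda>x. 1) (\<phi> p)"
    by (rule D_cong[OF open_image_U x]) (use one U_points pt_U in auto)
  finally show ?thesis by simp
qed

end

text \<open>Bumps whose positivity sets form a finite subcover, divided by their sum. Each function
  comes with its chart and with a compact set of coordinates outside which it vanishes, as the
  divergence theorem in a chart requires.\<close>

lemma partition_of_unity_exists:
  fixes M :: "('a, 'n::finite) charted_space"
  assumes mfd: "smooth_manifold M" and compact: "compact_space (mtop M)"
  obtains P :: "'a set" and c :: "'a \<Rightarrow> ('a, 'n) chart" and K :: "'a \<Rightarrow> (real^'n) set" and h :: "'a \<Rightarrow> 'a \<Rightarrow> real"
  where "finite P" "\<forall>p\<in>P. c p \<in> atlas M" "\<forall>p\<in>P. compact (K p)" "\<forall>p\<in>P. K p \<subseteq> snd (c p) ` fst (c p)"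
    "\<forall>p\<in>P. smooth_fun M (points M) (h p)"
    "\<forall>p\<in>P. \<forall>q\<in>points M - inv_into (fst (c p)) (snd (c p)) ` K p. h p q = 0"
    "\<forall>q\<in>points M. (\<Sum>p\<in>P. h p q) = 1"
proof -
  have "\<exists>c K b W. c \<in> atlas M \<and> compact K \<and> K \<subseteq> snd c ` fst c \<and> smooth_fun M (points M) b \<and> (\<forall>q. 0 \<le> b q) \<and>
    openin (mtop M) W \<and> p \<in> W \<and> (\<forall>q\<in>W. 0 < b q) \<and> (\<forall>q\<in>points M - inv_into (fst c) (snd c) ` K. b q = 0)"
    if "p \<in> points M" for p
  proof -
    have "(\<Union>(U, \<phi>) \<in> atlas M. U) = points M" using mfd by (simp add: smooth_manifold_def)
    then obtain U \<phi> where U: "(U, \<phi>) \<in> atlas M" "p \<in> U" using \<open>p \<in> points M\<close> by blast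
    interpret mfd_chart M U \<phi> by standard (use mfd U in auto)
    from bump_on_manifold[OF U(2)] show ?thesis
      using U(1) by (metis fst_conv snd_conv)
  qed
  then obtain c K b W where *: "\<And>p. p \<in> points M \<Longrightarrow> c p \<in> atlas M \<and> compact (K p) \<and> K p \<subseteq> snd (c p) ` fst (c p) \<and>
    smooth_fun M (points M) (b p) \<and> (\<forall>q. 0 \<le> b p q) \<and> openin (mtop M) (W p) \<and> p \<in> W p \<and> (\<forall>q\<in>W p. 0 < b p q) \<and>
    (\<forall>q\<in>points M - inv_into (fst (c p)) (snd (c p)) ` K p. b p q = (0::real))"
    by metis
  have "\<exists>\<F>. finite \<F> \<and> \<F> \<subseteq> W ` points M \<and> points M \<subseteq> \<Union>\<F>"
  proof -
    have "\<forall>V\<in>W ` points M. openin (mtop M) V" "points M \<subseteq> \<Union>(W ` points M)" using * by auto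
    then show ?thesis using compact unfolding compact_space_def compactin_def by metis
  qed
  then obtain \<F> where \<F>: "finite \<F>" "\<F> \<subseteq> W ` points M" "points M \<subseteq> \<Union>\<F>" by blast
  then obtain P where P: "P \<subseteq> points M" "finite P" "\<F> = W ` P" using finite_subset_image by metis
  have cK: "c p \<in> atlas M" "compact (K p)" "K p \<subseteq> snd (c p) ` fst (c p)"
    "q \<in> points M - inv_into (fst (c p)) (snd (c p)) ` K p \<Longrightarrow> b p q = 0"
    if "p \<in> P" for p q
    using *[of p] P(1) that by blast+
  define s where "s q = (\<Sum>p\<in>P. b p q)" for q
  \<comment> \<open>Each point lies in a member of the finite subcover, where one term of the
    nonnegative sum is positive; hence the normalised functions are smooth.\<close>
  have s: "s q > 0" if "q \<in> points M" for q
  proof -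
    obtain p where p: "p \<in> P" "q \<in> W p" using \<F>(3) P(3) \<open>q \<in> points M\<close> by blast
    then show ?thesis
      unfolding s_def using * P(1,2) by (intro sum_pos2[of P p]) auto
  qed
  define h where "h p q = b p q * inverse (s q)" for p q
  show ?thesis
  proof (rule that[of P c K h])
    show "finite P" by fact
    show "\<forall>p\<in>P. c p \<in> atlas M" "\<forall>p\<in>P. compact (K p)" "\<forall>p\<in>P. K p \<subseteq> snd (c p) ` fst (c p)"
      by (simp_all add: cK)
    show "\<forall>p\<in>P. \<forall>q\<in>points M - inv_into (fst (c p)) (snd (c p)) ` K p. h p q = 0"
      by (simp add: h_def cK)
    show "\<forall>p\<in>P. smooth_fun M (points M) (h p)"
      unfolding smooth_fun_def
    proof safe
      fix p V \<psi> assume p: "p \<in> P" and V: "(V, \<psi>) \<in> atlas M"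
      interpret c: mfd_chart M V \<psi> by standard (use mfd V in auto)
      have VM: "V \<inter> points M = V" using c.U_points by blast
      have b: "smooth_on (\<psi> ` V) (\<lambda>x. b p (c.pt x))" if "p \<in> P" for p
        using c.smooth_funD[of "points M" "b p"] * P(1) that VM by (auto simp: o_def)
      have "smooth_on (\<psi> ` V) (\<lambda>x. b p (c.pt x) * inverse (\<Sum>p\<in>P. b p (c.pt x)))"
      proof (intro smooth_on_mult smooth_on_inverse smooth_on_sum c.open_image_U b p)
        show "(\<Sum>p\<in>P. b p (c.pt x)) \<noteq> 0" if "x \<in> \<psi> ` V" for x
          using s[of "c.pt x"] c.pt_U[OF that] c.U_points by (auto simp: s_def)
      qed
      then show "smooth_on (\<psi> ` (V \<inter> points M)) (h p \<circ> c.pt)"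
        unfolding VM by (simp add: h_def s_def o_def)
    qed
    show "\<forall>q\<in>points M. (\<Sum>p\<in>P. h p q) = 1"
    proof
      fix q assume "q \<in> points M"
      then have "s q \<noteq> 0" using s by force
      moreover have "(\<Sum>p\<in>P. h p q) = s q * inverse (s q)"
        unfolding h_def s_def by (rule sum_distrib_right[symmetric])
      ultimately show "(\<Sum>p\<in>P. h p q) = 1" by simp
    qed
  qed
qed

theorem lemma2p1:
  fixes M :: "('a, 'n::finite) charted_space" and g :: "'a metric_tensor"
    and \<xi> :: "'a vfield" and lam :: "'a \<Rightarrow> real" and \<rho> :: real
    and S :: "'a \<Rightarrow> real" and F :: "'a \<Rightarrow> real"
  assumes soliton: "almost_RB_soliton M g \<xi> lam \<rho>"
    and compact: "compact_space (mtop M)"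
    and S_def: "S = scalar_curvature M g"
    and F_def: "F = (\<lambda>p. (lam p + \<rho> * S p) * S p - ricci_operator_norm_sq M g p
                    - 1/2 * S p * (real CARD('n) * (lam p + \<rho> * S p) - S p))"
  shows "integrable (riemannian_volume M g) F \<and>
         (\<integral>p. F p \<partial>(riemannian_volume M g)) = 0"
proof -
  have mfd: "smooth_manifold M" and metric: "riemannian_metric M g" and \<xi>: "smooth_vfield M (points M) \<xi>"
    using soliton by (auto simp: almost_RB_soliton_def)
  have rc: "riemannian_chart M U \<phi> g" if "(U, \<phi>) \<in> atlas M" for U \<phi>
    by standard (use mfd metric that in auto)
  obtain P :: "'a set" and c :: "'a \<Rightarrow> ('a, 'n) chart" and K h where P: "finite P"
    "\<forall>p\<in>P. c p \<in> atlas M" "\<forall>p\<in>P. compact (K p)" "\<forall>p\<in>P. K p \<subseteq> snd (c p) ` fst (c p)"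
    and h: "\<forall>p\<in>P. smooth_fun M (points M) (h p)"
    "\<forall>p\<in>P. \<forall>q\<in>points M - inv_into (fst (c p)) (snd (c p)) ` K p. h p q = 0"
    "\<forall>q\<in>points M. (\<Sum>p\<in>P. h p q) = 1"
    by (rule partition_of_unity_exists[OF mfd compact])
  let ?\<mu> = "riemannian_volume M g" and ?Z = "einstein_field M g \<xi>"
  have cover: "\<exists>U \<phi>. (U, \<phi>) \<in> atlas M \<and> q \<in> U" if "q \<in> points M" for q
    using mfd that unfolding smooth_manifold_def by blast
  have int: "integrable ?\<mu> (\<lambda>q. h p q * F q + ?Z q (h p)) \<and> integral\<^sup>L ?\<mu> (\<lambda>q. h p q * F q + ?Z q (h p)) = 0"
    if p: "p \<in> P" for p
  proof -
    obtain U \<phi> where c: "c p = (U, \<phi>)" by fastforce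
    have U: "(U, \<phi>) \<in> atlas M" using P(2) p c by force
    interpret r: riemannian_chart M U \<phi> g by (rule rc[OF U])
    have K: "compact (K p)" "K p \<subseteq> \<phi> ` U" using P(3,4) p c by force+
    have supp: "h p q = 0" if "q \<in> points M - r.pt ` K p" for q using h(2) p that c by force
    have F: "F (r.pt x) = trace (r.einstein x ** r.nabla (r.fcoords \<xi>) x)" if "x \<in> \<phi> ` U" for x
      using r.soliton_chart[OF soliton that] by (simp add: F_def S_def)
    \<comment> \<open>At q the chart of \<open>h p\<close> gives no coordinates, so the vanishing is
      checked in a chart around q, where \<open>h p\<close> is 0 on an open set.\<close>
    have outside: "?Z q (h p) = 0" if q: "q \<in> points M" "q \<notin> U" for q
    proof -
      obtain V \<psi> where V: "(V, \<psi>) \<in> atlas M" "q \<in> V" using cover[OF q(1)] by blast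
      have "openin (mtop M) (points M - r.pt ` K p)"
        using r.closedin_image_compact[OF K] by (simp add: openin_diff)
      moreover have "q \<in> points M - r.pt ` K p" using q r.pt_image_subset[OF K(2)] by (meson DiffI subsetD)
      ultimately show ?thesis
        using riemannian_chart.einstein_field_local[OF rc[OF V(1)] \<xi> bspec[OF h(1) p] _ supp V(2)] by blast
    qed
    show ?thesis
      using r.integral_divergence_chart[OF compact \<xi> bspec[OF h(1) p] K supp F outside] by simp
  qed
  \<comment> \<open>Claimed on the space of the measure only, where the partition sums to 1; the
    congruence rules for integrals ask for no more.\<close>
  have sum: "F q = (\<Sum>p\<in>P. h p q * F q + ?Z q (h p))" if "q \<in> space ?\<mu>" for q
  proof -
    have q: "q \<in> points M" using that riemannian_volume_properties(1)[OF mfd metric compact] by simp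
    obtain V \<psi> where V: "(V, \<psi>) \<in> atlas M" "q \<in> V" using cover[OF q] by blast
    have "(\<Sum>p\<in>P. ?Z q (h p)) = 0"
      by (rule riemannian_chart.einstein_field_partition[OF rc[OF V(1)] \<xi> _ _ V(2)]) (use h in auto)
    moreover have "(\<Sum>p\<in>P. h p q * F q) = F q"
      using h(3) q by (simp add: sum_distrib_right[symmetric])
    ultimately show ?thesis by (simp add: sum.distrib)
  qed
  have "integrable ?\<mu> F \<longleftrightarrow> integrable ?\<mu> (\<lambda>q. \<Sum>p\<in>P. h p q * F q + ?Z q (h p))"
    by (rule Bochner_Integration.integrable_cong[OF refl sum])
  moreover have "integral\<^sup>L ?\<mu> F = integral\<^sup>L ?\<mu> (\<lambda>q. \<Sum>p\<in>P. h p q * F q + ?Z q (h p))"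
    by (rule Bochner_Integration.integral_cong[OF refl sum])
  ultimately show ?thesis
    using int by (simp add: Bochner_Integration.integrable_sum Bochner_Integration.integral_sum)
qed

end
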